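(* Let $1\leq p_1,\dots,p_m<\infty$, and let $\frac1p=\frac1{p_1}+\dots+\frac1{p_m}$. Let $w_1,\dots,w_m$ be weights on $\mathbb R^n$ with $w_i\in A_{p_i}^{\mathcal R}$ for $i=1,\dots,m$, and write $\nu_{\vec w}=w_1^{p/p_1}\cdots w_m^{p/p_m}$. Let $v$ be a weight such that $\nu_{\vec w}v^p$ is a weight, and $w_iv^{p_i}\in A_\infty$ for $i=1,\dots,m$. Then there exists a constant $C>0$ such that the inequalities $$\left\Vert \frac{\mathcal M(\vec f)}{v}\right\Vert_{L^{p,\infty}(\nu_{\vec w}v^p)}\leq \left\Vert \frac{M^\otimes(\vec f)}{v}\right\Vert_{L^{p,\infty}(\nu_{\vec w}v^p)}\leq C\prod_{i=1}^m\Vert f_i\Vert_{L^{p_i,1}(w_i)}$$ hold for every vector of measurable functions $\vec f=(f_1,\dots,f_m)$ on $\mathbb R^n$.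
   Context: A weight is a positive, locally integrable function on $\mathbb R^n$. Cubes have sides parallel to the axes. For a weight $w$ and a measurable set $E$, $w(E)=\int_E w(x)\,dx$, and $\frac1q+\frac1{q'}=1$. The Hardy-Littlewood maximal operator is $Mf(x)=\sup_{Q\ni x}\frac1{|Q|}\int_Q|f|$ (supremum over all cubes $Q$ containing $x$), its $m$-fold product is $M^\otimes(\vec f)(x)=\prod_{i=1}^m Mf_i(x)$, and the multi(sub)linear maximal operator is $\mathcal M(\vec f)=\sup_Q\left(\prod_{i=1}^m\frac1{|Q|}\int_Q|f_i|\right)\chi_Q$, the supremum being over all cubes $Q$. For a weight $w$ (identified with the measure $w(x)\,dx$), put $\lambda_f^w(y)=w(\{x:|f(x)|>y\})$. For $q>0$: $\Vert f\Vert_{L^{q,1}(w)}=q\int_0^\infty \lambda_f^w(y)^{1/q}\,dy$ and $\Vert f\Vert_{L^{q,\infty}(w)}=\sup_{y>0} y\,\lambda_f^w(y)^{1/q}$; $L^{\infty,\infty}(w)$ means $L^\infty(w)$. For $1\le q<\infty$, $w\in A_q^{\mathcal R}$ means $[w]_{A_q^{\mathcal R}}=\sup_Q w(Q)^{1/q}\,\frac{\Vert \chi_Q w^{-1}\Vert_{L^{q',\infty}(w)}}{|Q|}<\infty$ (supremum over all cubes), so $A_1^{\mathcal R}=A_1$. $A_\infty=\bigcup_{q\ge1}A_q=\bigcup_{q\geq 1}A_q^{\mathcal R}$, where $A_q$ denotes the Muckenhoupt classes. *)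

theory Defs
  imports "HOL-Analysis.Analysis" "HOL-Probability.Essential_Supremum"
begin

definition weight :: "(real ^ 'n \<Rightarrow> real) \<Rightarrow> bool"
  where "weight w \<longleftrightarrow>
    (\<forall>x. 0 < w x) \<and> (\<forall>K. compact K \<longrightarrow> w absolutely_integrable_on K)"

definition weight_measure :: "(real ^ 'n \<Rightarrow> real) \<Rightarrow> (real ^ 'n) measure"
  where "weight_measure w = density lebesgue (\<lambda>x. ennreal (w x))"

definition cubes :: "(real ^ 'n) set set"
  where "cubes = {cbox a (\<chi> i. a $ i + s) | a s. 0 < s}"

text \<open>
  Powers of extended nonnegative numbers; only positive exponents \<open>a\<close> are used below.
\<close>
definition ennreal_power :: "ennreal \<Rightarrow> real \<Rightarrow> ennreal"
  where "ennreal_power t a = (if t = \<infinity> then \<infinity> else ennreal (enn2real t powr a))"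

definition average :: "(real ^ 'n) set \<Rightarrow> (real ^ 'n \<Rightarrow> ennreal) \<Rightarrow> ennreal"
  where "average Q g = (\<integral>\<^sup>+x\<in>Q. g x \<partial>lebesgue) / emeasure lebesgue Q"

definition HL_maximal :: "(real ^ 'n \<Rightarrow> real) \<Rightarrow> real ^ 'n \<Rightarrow> ennreal"
  where "HL_maximal f x = (SUP Q\<in>{Q \<in> cubes. x \<in> Q}. average Q (\<lambda>y. ennreal \<bar>f y\<bar>))"

text \<open>
  The two multilinear operators act on vectors \<open>(f 1, \<dots>, f m)\<close>.  Products are taken in
  \<^typ>\<open>ennreal\<close>, with the convention that zero times infinity is zero.
\<close>
definition HL_maximal_tensor ::
    "nat \<Rightarrow> (nat \<Rightarrow> real ^ 'n \<Rightarrow> real) \<Rightarrow> real ^ 'n \<Rightarrow> ennreal"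
  where "HL_maximal_tensor m f x = (\<Prod>i=1..m. HL_maximal (f i) x)"

definition multi_maximal ::
    "nat \<Rightarrow> (nat \<Rightarrow> real ^ 'n \<Rightarrow> real) \<Rightarrow> real ^ 'n \<Rightarrow> ennreal"
  where "multi_maximal m f x =
    (SUP Q\<in>cubes. (\<Prod>i=1..m. average Q (\<lambda>y. ennreal \<bar>f i y\<bar>)) * indicator Q x)"

text \<open>
  Distribution functions and (quasi)norms are defined for functions with values in
  \<^typ>\<open>ennreal\<close>, so that they apply to maximal functions; for a real function \<open>f\<close> take
  \<open>g = (\<lambda>x. ennreal \<bar>f x\<bar>)\<close>.
\<close>
definition distribution_function :: "'a measure \<Rightarrow> ('a \<Rightarrow> ennreal) \<Rightarrow> real \<Rightarrow> ennreal"
  where "distribution_function \<mu> g y = emeasure \<mu> {x \<in> space \<mu>. ennreal y < g x}"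

definition Lorentz_q1_norm :: "real \<Rightarrow> 'a measure \<Rightarrow> ('a \<Rightarrow> ennreal) \<Rightarrow> ennreal"
  where "Lorentz_q1_norm q \<mu> g =
    ennreal q * (\<integral>\<^sup>+y\<in>{0<..}. ennreal_power (distribution_function \<mu> g y) (1 / q) \<partial>lborel)"

text \<open>The exponent is extended, since the weak norm with infinite exponent occurs for \<open>q = 1\<close> below.\<close>
definition weak_norm :: "ennreal \<Rightarrow> 'a measure \<Rightarrow> ('a \<Rightarrow> ennreal) \<Rightarrow> ennreal"
  where "weak_norm q \<mu> g =
    (if q = \<infinity> then esssup \<mu> g
     else SUP y\<in>{0<..}. ennreal y * ennreal_power (distribution_function \<mu> g y) (1 / enn2real q))"

definition conjugate_exponent :: "real \<Rightarrow> ennreal"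
  where "conjugate_exponent q = (if q = 1 then \<infinity> else ennreal (q / (q - 1)))"

definition A_R_constant :: "real \<Rightarrow> (real ^ 'n \<Rightarrow> real) \<Rightarrow> ennreal"
  where "A_R_constant q w =
    (SUP Q\<in>cubes. ennreal_power (emeasure (weight_measure w) Q) (1 / q)
       * weak_norm (conjugate_exponent q) (weight_measure w)
           (\<lambda>x. indicator Q x * ennreal (inverse (w x)))
       / emeasure lebesgue Q)"

definition A_R_class :: "real \<Rightarrow> (real ^ 'n \<Rightarrow> real) set"
  where "A_R_class q = {w. weight w \<and> A_R_constant q w < \<infinity>}"

text \<open>
  The Muckenhoupt classes, for \<open>q \<ge> 1\<close>.  For \<open>q > 1\<close> the exponent \<open>1 - q / (q - 1)\<close> is
  \<open>1 - q'\<close>, where \<open>q'\<close> is the conjugate exponent.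
\<close>
definition A_class :: "real \<Rightarrow> (real ^ 'n \<Rightarrow> real) set"
  where "A_class q = {w. weight w \<and>
    (if q = 1 then
       \<exists>C::real. \<forall>Q\<in>cubes. AE x in lebesgue.
         x \<in> Q \<longrightarrow> average Q (\<lambda>y. ennreal (w y)) \<le> ennreal (C * w x)
     else
       (SUP Q\<in>cubes. average Q (\<lambda>y. ennreal (w y))
          * ennreal_power (average Q (\<lambda>y. ennreal (w y powr (1 - q / (q - 1))))) (q - 1)) < \<infinity>)}"

definition A_infinity :: "(real ^ 'n \<Rightarrow> real) set"
  where "A_infinity = (\<Union>q\<in>{1..}. A_class q)"

end

theory Submission
  imports Defs
begin


text \<open>
  The first inequality holds pointwise.  For the second one, the level sets of \<open>M f / v\<close> are first
  estimated for a single weight \<open>w\<close> in the restricted class of exponent \<open>p\<close>, with respect to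
  \<open>u = w v^p\<close>; then the product is reduced to its factors.

  One weight.  The restricted condition says that \<open>|E| / |Q|\<close> is at most a multiple of
  \<open>(w(E) / w(Q))^(1/p)\<close> for \<open>E \<subseteq> Q\<close>.  Hence a point with \<open>M \<chi>\<^sub>E > t v\<close> lies in a cube \<open>Q\<close> with
  \<open>V(x) w(Q) < \<nu>(Q)\<close>, where \<open>V = v^p\<close> and \<open>\<nu>\<close> is a multiple of \<open>t^(-p) \<chi>\<^sub>E w\<close>.  It remains to bound the
  \<open>u\<close>-measure of the set of these points by the total mass of \<open>\<nu>\<close> (\<open>mixed_weak_type\<close>), where only the
  \<open>A\<close>-infinity conditions of \<open>w\<close> and \<open>u = V w\<close> enter.  On a dyadic grid the cubes with \<open>\<nu>(Q) > b u(Q)\<close>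
  cover a set of \<open>u\<close>-measure at most \<open>\<nu> / b\<close>.  At any other point \<open>V(x)\<close> is small compared with its
  \<open>w\<close>-average \<open>u(Q) / w(Q)\<close>.  By the \<open>A\<close>-infinity conditions such points are so rare inside each cube
  (\<open>local_level_bound\<close>) that the sum over a geometric sequence of heights \<open>b\<close> converges.  The one-third
  trick (\<open>cube_in_cell\<close>) passes from dyadic cubes to all cubes.  Kolmogorov's inequality and a dyadic
  decomposition of \<open>f\<close> into its layers pass from characteristic functions to the Lorentz space with
  second exponent one (\<open>mixed_maximal_bound_gt_1\<close>); for \<open>p = 1\<close> the same argument applies to \<open>f\<close> itself.

  Products.  The product of the functions \<open>M f\<^sub>i\<close> exceeds \<open>s v\<close> exactly where \<open>M f\<^sub>i > s v\<^sub>i\<close>, with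
  \<open>v\<^sub>i = v / (\<Prod>j \<noteq> i. M f\<^sub>j)\<close>.  On a cube \<open>Q\<close>, a maximal function exceeds \<open>\<lambda>\<close> times its infimum only on a set
  of measure at most \<open>D |Q| / \<lambda>\<close> (\<open>HL_maximal_oscillation\<close>).  So multiplication by negative powers of
  maximal functions preserves the \<open>A\<close>-infinity condition, with constants that do not depend on the
  functions \<open>f\<^sub>j\<close> (\<open>quant_A_infinity_times_powr\<close>).  Therefore the estimate for one weight holds uniformly
  for all \<open>v\<^sub>i\<close>.  On a shell where the quotient of the product by \<open>v\<close> lies between \<open>s\<close> and \<open>2 s\<close>, Hoelder's
  inequality combines the \<open>m\<close> estimates (\<open>tensor_level_bound\<close>), and the shells \<open>s = 2^k y\<close> yield a
  geometric series.
\<close>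


section \<open>Laminar families of cells\<close>

lemma emeasure_finite_subset:
  "A \<subseteq> B \<Longrightarrow> B \<in> sets \<mu> \<Longrightarrow> emeasure \<mu> B < \<infinity> \<Longrightarrow> emeasure \<mu> A < \<infinity>"
  by (meson emeasure_mono le_less_trans)

text \<open>
  The combinatorial features of the dyadic cubes of bounded side length.  That a cell has only
  finitely many ancestors replaces the choice of largest cubes: every subfamily is covered by its
  maximal members.
\<close>
locale laminar_family =
  fixes M :: "'a measure" and \<D> :: "'a set set"
  assumes countable_cells: "countable \<D>"
    and cells_measurable: "\<D> \<subseteq> sets M"
    and nested_cells: "Q \<in> \<D> \<Longrightarrow> R \<in> \<D> \<Longrightarrow> Q \<inter> R \<noteq> {} \<Longrightarrow> Q \<subseteq> R \<or> R \<subseteq> Q"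
    and finite_ancestors: "Q \<in> \<D> \<Longrightarrow> finite {R \<in> \<D>. Q \<subseteq> R}"
begin

definition maximal_cells :: "'a set set \<Rightarrow> 'a set set"
  where "maximal_cells \<Phi> = {Q \<in> \<Phi>. \<forall>R\<in>\<Phi>. Q \<subseteq> R \<longrightarrow> R = Q}"

lemma maximal_cells_subset: "maximal_cells \<Phi> \<subseteq> \<Phi>"
  by (auto simp: maximal_cells_def)

lemma maximal_cell_above:
  assumes "\<Phi> \<subseteq> \<D>" "Q \<in> \<Phi>"
  obtains R where "R \<in> maximal_cells \<Phi>" "Q \<subseteq> R"
proof -
  let ?A = "{R \<in> \<Phi>. Q \<subseteq> R}"
  have "finite ?A"
    by (rule finite_subset[of _ "{R \<in> \<D>. Q \<subseteq> R}"]) (use finite_ancestors[of Q] assms in auto)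
  moreover have "Q \<in> ?A" using assms by auto
  ultimately obtain R where R: "R \<in> ?A" "\<And>S. S \<in> ?A \<Longrightarrow> R \<subseteq> S \<Longrightarrow> S = R"
    using finite_has_maximal[of ?A] by (metis (no_types, lifting) empty_iff)
  then have "R \<in> maximal_cells \<Phi>"
    unfolding maximal_cells_def by auto
  with R that show ?thesis by auto
qed

lemma Union_maximal_cells:
  assumes "\<Phi> \<subseteq> \<D>" shows "\<Union>(maximal_cells \<Phi>) = \<Union>\<Phi>"
proof
  show "\<Union>\<Phi> \<subseteq> \<Union>(maximal_cells \<Phi>)"
    using maximal_cell_above[OF assms] by (metis Sup_least Union_upper order_trans)
qed (use maximal_cells_subset in auto)

lemma disjoint_maximal_cells:
  assumes "\<Phi> \<subseteq> \<D>" shows "disjoint_family_on (\<lambda>Q. Q) (maximal_cells \<Phi>)"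
  unfolding disjoint_family_on_def
proof (intro ballI impI)
  fix Q R assume *: "Q \<in> maximal_cells \<Phi>" "R \<in> maximal_cells \<Phi>" "Q \<noteq> R"
  then have "Q \<in> \<D>" "R \<in> \<D>" using assms maximal_cells_subset by auto
  then show "Q \<inter> R = {}"
    using nested_cells[of Q R] * unfolding maximal_cells_def by blast
qed

lemma sets_Union_cells: "\<Phi> \<subseteq> \<D> \<Longrightarrow> \<Union>\<Phi> \<in> sets M"
  using countable_cells cells_measurable
  by (meson countable_subset order_trans sets.countable_Union)

lemma emeasure_maximal_cells:
  assumes "\<Phi> \<subseteq> \<D>" "sets \<mu> = sets M" "A \<in> sets M"
  shows "emeasure \<mu> (A \<inter> \<Union>\<Phi>) = (\<integral>\<^sup>+Q. emeasure \<mu> (A \<inter> Q) \<partial>count_space (maximal_cells \<Phi>))"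
proof -
  have sub: "maximal_cells \<Phi> \<subseteq> \<D>" using assms(1) maximal_cells_subset by auto
  have "emeasure \<mu> (\<Union>Q\<in>maximal_cells \<Phi>. A \<inter> Q)
      = (\<integral>\<^sup>+Q. emeasure \<mu> (A \<inter> Q) \<partial>count_space (maximal_cells \<Phi>))"
  proof (rule emeasure_UN_countable)
    show "countable (maximal_cells \<Phi>)"
      using sub countable_cells countable_subset by auto
    show "\<And>Q. Q \<in> maximal_cells \<Phi> \<Longrightarrow> A \<inter> Q \<in> sets \<mu>"
      using sub assms cells_measurable by auto
    show "disjoint_family_on (\<lambda>Q. A \<inter> Q) (maximal_cells \<Phi>)"
      using disjoint_maximal_cells[OF assms(1)] unfolding disjoint_family_on_def by blast
  qed
  moreover have "(\<Union>Q\<in>maximal_cells \<Phi>. A \<inter> Q) = A \<inter> \<Union>\<Phi>"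
    using Union_maximal_cells[OF assms(1)] by auto
  ultimately show ?thesis by simp
qed

text \<open>
  Estimates on the maximal members of a family of cells add up, because these members are
  disjoint and have the same union as the family.
\<close>
lemma emeasure_Union_cells_le:
  assumes "\<Phi> \<subseteq> \<D>" "sets \<mu> = sets M" "sets \<nu> = sets M" "A \<in> sets M" "B \<in> sets M"
    and "\<And>Q. Q \<in> maximal_cells \<Phi> \<Longrightarrow> emeasure \<mu> (A \<inter> Q) \<le> c * emeasure \<nu> (B \<inter> Q)"
  shows "emeasure \<mu> (A \<inter> \<Union>\<Phi>) \<le> c * emeasure \<nu> (B \<inter> \<Union>\<Phi>)"
proof -
  have "emeasure \<mu> (A \<inter> \<Union>\<Phi>)
      \<le> (\<integral>\<^sup>+Q. c * emeasure \<nu> (B \<inter> Q) \<partial>count_space (maximal_cells \<Phi>))"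
    unfolding emeasure_maximal_cells[OF assms(1,2,4)]
    by (rule nn_integral_mono) (use assms(6) in auto)
  also have "\<dots> = c * emeasure \<nu> (B \<inter> \<Union>\<Phi>)"
    unfolding emeasure_maximal_cells[OF assms(1,3,5)] by (rule nn_integral_cmult) auto
  finally show ?thesis .
qed

lemma measure_Union_cells_le:
  assumes "\<Phi> \<subseteq> \<D>" "sets \<mu> = sets M" "sets \<nu> = sets M" "A \<in> sets M" "B \<in> sets M" "0 \<le> c"
    and fin: "emeasure \<mu> (A \<inter> \<Union>\<Phi>) < \<infinity>" "emeasure \<nu> (B \<inter> \<Union>\<Phi>) < \<infinity>"
    and le: "\<And>Q. Q \<in> maximal_cells \<Phi> \<Longrightarrow> measure \<mu> (A \<inter> Q) \<le> c * measure \<nu> (B \<inter> Q)"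
  shows "measure \<mu> (A \<inter> \<Union>\<Phi>) \<le> c * measure \<nu> (B \<inter> \<Union>\<Phi>)"
proof -
  have "emeasure \<mu> (A \<inter> \<Union>\<Phi>) \<le> ennreal c * emeasure \<nu> (B \<inter> \<Union>\<Phi>)"
  proof (rule emeasure_Union_cells_le[OF assms(1-5)])
    fix Q assume Q: "Q \<in> maximal_cells \<Phi>"
    then have "Q \<subseteq> \<Union>\<Phi>" using maximal_cells_subset by auto
    moreover have "\<Union>\<Phi> \<in> sets M" using sets_Union_cells assms(1) by auto
    ultimately have "emeasure \<mu> (A \<inter> Q) < \<infinity>" "emeasure \<nu> (B \<inter> Q) < \<infinity>"
      using emeasure_finite_subset[OF _ _ fin(1), of "A \<inter> Q"]
        emeasure_finite_subset[OF _ _ fin(2), of "B \<inter> Q"] assms(2-5) by auto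
    then show "emeasure \<mu> (A \<inter> Q) \<le> ennreal c * emeasure \<nu> (B \<inter> Q)"
      using le[OF Q] assms(6)
      by (simp add: emeasure_eq_ennreal_measure less_top flip: ennreal_mult)
  qed
  then show ?thesis
    using fin assms(6) by (simp add: emeasure_eq_ennreal_measure less_top flip: ennreal_mult)
qed

text \<open>
  A Calderon-Zygmund stopping argument.  Let \<open>E = \<Union>\<Psi>\<close>.  Passing from \<open>E\<close> to the union of the maximal
  cells in which \<open>E\<close> has density above \<open>\<alpha> / D\<close> costs a factor \<open>D / \<alpha>\<close> in the measure \<open>\<mu>\<close>.  In each of
  these cells \<open>E\<close> has density at most \<open>\<alpha>\<close>, because the parent was not selected; this gains a factor
  \<open>\<beta>\<close> in the measure \<open>\<omega>\<close>.  The new union is again a union of cells, so the step can be repeated.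
\<close>
lemma geometric_decay:
  fixes \<alpha> \<beta> D :: real
  assumes sets: "sets \<mu> = sets M" "sets \<omega> = sets M"
    and fin: "\<And>Q. Q \<in> \<D> \<Longrightarrow> emeasure \<mu> Q < \<infinity>" "\<And>Q. Q \<in> \<D> \<Longrightarrow> emeasure \<omega> Q < \<infinity>"
    and pos: "\<And>Q. Q \<in> \<D> \<Longrightarrow> 0 < measure \<mu> Q"
    and D: "1 \<le> D" and \<alpha>: "0 < \<alpha>" "\<alpha> < 1" and \<beta>: "0 \<le> \<beta>"
    and parent: "\<And>Q R. Q \<in> \<D> \<Longrightarrow> R \<in> \<D> \<Longrightarrow> Q \<subset> R \<Longrightarrow>
      \<exists>P\<in>\<D>. Q \<subset> P \<and> P \<subseteq> R \<and> measure \<mu> P \<le> D * measure \<mu> Q"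
    and base: "\<And>Q E. Q \<in> \<D> \<Longrightarrow> E \<in> sets M \<Longrightarrow> E \<subseteq> Q \<Longrightarrow>
      measure \<mu> E \<le> \<alpha> * measure \<mu> Q \<Longrightarrow> measure \<omega> E \<le> \<beta> * measure \<omega> Q"
    and Q: "Q \<in> \<D>" and \<Psi>: "\<Psi> \<subseteq> \<D>" "\<Union>\<Psi> \<subseteq> Q"
    and small: "measure \<mu> (\<Union>\<Psi>) \<le> (\<alpha> / D) ^ N * measure \<mu> Q"
  shows "measure \<omega> (\<Union>\<Psi>) \<le> \<beta> ^ N * measure \<omega> Q"
  using \<Psi> small
proof (induction N arbitrary: \<Psi>)
  case 0
  have "Q \<in> fmeasurable \<omega>"
    using fin Q sets cells_measurable by (auto intro!: fmeasurableI)
  then have "measure \<omega> (\<Union>\<Psi>) \<le> measure \<omega> Q"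
    using 0 sets_Union_cells[of \<Psi>] sets by (intro measure_mono_fmeasurable) auto
  then show ?case by simp
next
  case (Suc N)
  define \<gamma> where "\<gamma> = \<alpha> / D"
  have \<gamma>: "0 < \<gamma>" "\<gamma> < 1" "\<gamma> * D = \<alpha>" using D \<alpha> by (auto simp: \<gamma>_def field_simps)
  define E where "E = \<Union>\<Psi>"
  have E: "E \<in> sets M" "E \<subseteq> Q" using Suc.prems sets_Union_cells unfolding E_def by auto
  define \<Phi> where "\<Phi> = {P \<in> \<D>. P \<subseteq> Q \<and> measure \<mu> (E \<inter> P) > \<gamma> * measure \<mu> P}"
  have \<Phi>: "\<Phi> \<subseteq> \<D>" "\<Union>\<Phi> \<subseteq> Q" by (auto simp: \<Phi>_def)
  have U: "\<Union>\<Phi> \<in> sets M" using sets_Union_cells \<Phi> by auto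
  have finsub: "emeasure \<mu> S < \<infinity>" "emeasure \<omega> S < \<infinity>" if "S \<subseteq> Q" for S
    using emeasure_finite_subset[OF that _ fin(1)] emeasure_finite_subset[OF that _ fin(2)]
      Q sets cells_measurable by auto
  have finU: "emeasure \<mu> (X \<inter> \<Union>\<Phi>) < \<infinity>" "emeasure \<omega> (X \<inter> \<Union>\<Phi>) < \<infinity>" for X
    using finsub[of "X \<inter> \<Union>\<Phi>"] \<Phi>(2) by auto
  have "E \<subseteq> \<Union>\<Phi>"
  proof
    fix x assume "x \<in> E"
    then obtain P where P: "x \<in> P" "P \<in> \<Psi>" by (auto simp: E_def)
    then have "E \<inter> P = P" by (auto simp: E_def)
    moreover have "\<gamma> * measure \<mu> P < measure \<mu> P" using \<gamma> pos[of P] P Suc.prems by auto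
    ultimately have "P \<in> \<Phi>" using P Suc.prems by (auto simp: \<Phi>_def)
    with P show "x \<in> \<Union>\<Phi>" by auto
  qed
  have "Q \<notin> \<Phi>"
  proof
    assume "Q \<in> \<Phi>"
    then have "\<gamma> * measure \<mu> Q < measure \<mu> E" using E by (auto simp: \<Phi>_def Int_absorb2)
    also have "\<dots> \<le> \<gamma> * (\<gamma> ^ N * measure \<mu> Q)" using Suc.prems by (simp add: E_def \<gamma>_def)
    also have "\<dots> \<le> \<gamma> * (1 * measure \<mu> Q)"
      using \<gamma> by (intro mult_left_mono mult_right_mono power_le_one) auto
    finally show False by simp
  qed
  have "measure \<omega> (E \<inter> \<Union>\<Phi>) \<le> \<beta> * measure \<omega> (space M \<inter> \<Union>\<Phi>)"
  proof (rule measure_Union_cells_le[OF \<Phi>(1) sets(2) sets(2) E(1) _ \<beta>])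
    fix P assume P: "P \<in> maximal_cells \<Phi>"
    then have P': "P \<in> \<D>" "P \<subseteq> Q" "P \<in> \<Phi>" "P \<noteq> Q"
      using maximal_cells_subset \<Phi> \<open>Q \<notin> \<Phi>\<close> by (auto simp: \<Phi>_def)
    then obtain S where S: "S \<in> \<D>" "P \<subset> S" "S \<subseteq> Q" "measure \<mu> S \<le> D * measure \<mu> P"
      using parent[of P Q] Q by blast
    then have "S \<notin> \<Phi>" using P unfolding maximal_cells_def by blast
    then have "measure \<mu> (E \<inter> S) \<le> \<gamma> * measure \<mu> S" using S by (auto simp: \<Phi>_def)
    also have "\<dots> \<le> \<gamma> * (D * measure \<mu> P)" using S \<gamma> by (intro mult_left_mono) auto
    finally have *: "measure \<mu> (E \<inter> S) \<le> \<alpha> * measure \<mu> P" using \<gamma> by (simp flip: mult.assoc)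
    have "measure \<mu> (E \<inter> P) \<le> measure \<mu> (E \<inter> S)"
      using S finsub(1)[of "E \<inter> S"] E P' cells_measurable sets
      by (intro measure_mono_fmeasurable fmeasurableI) auto
    with * have "measure \<omega> (E \<inter> P) \<le> \<beta> * measure \<omega> P"
      using base[of P "E \<inter> P"] P' E cells_measurable by auto
    moreover have "space M \<inter> P = P" using P' cells_measurable sets.sets_into_space by blast
    ultimately show "measure \<omega> (E \<inter> P) \<le> \<beta> * measure \<omega> (space M \<inter> P)" by simp
  qed (use E \<Phi> finU in auto)
  moreover have "E \<inter> \<Union>\<Phi> = E" using \<open>E \<subseteq> \<Union>\<Phi>\<close> by auto
  moreover have sp: "space M \<inter> \<Union>\<Phi> = \<Union>\<Phi>" using U sets.sets_into_space by blast
  ultimately have 1: "measure \<omega> E \<le> \<beta> * measure \<omega> (\<Union>\<Phi>)" by simp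
  have "measure \<mu> (space M \<inter> \<Union>\<Phi>) \<le> 1 / \<gamma> * measure \<mu> (E \<inter> \<Union>\<Phi>)"
  proof (rule measure_Union_cells_le[OF \<Phi>(1) sets(1) sets(1) _ E(1)])
    fix P assume P: "P \<in> maximal_cells \<Phi>"
    then have P': "P \<in> \<D>" "P \<in> \<Phi>" using maximal_cells_subset \<Phi> by auto
    then have "space M \<inter> P = P" using P' cells_measurable sets.sets_into_space by blast
    then show "measure \<mu> (space M \<inter> P) \<le> 1 / \<gamma> * measure \<mu> (E \<inter> P)"
      using P' \<gamma> by (auto simp: \<Phi>_def field_simps)
  qed (use E \<Phi> finU \<gamma> in auto)
  then have "\<gamma> * measure \<mu> (\<Union>\<Phi>) \<le> measure \<mu> E"
    using \<open>E \<inter> \<Union>\<Phi> = E\<close> sp \<gamma> by (auto simp: field_simps)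
  also have "\<dots> \<le> \<gamma> * (\<gamma> ^ N * measure \<mu> Q)" using Suc.prems by (simp add: E_def \<gamma>_def)
  finally have "measure \<mu> (\<Union>\<Phi>) \<le> \<gamma> ^ N * measure \<mu> Q" using \<gamma> by simp
  then have "measure \<omega> (\<Union>\<Phi>) \<le> \<beta> ^ N * measure \<omega> Q"
    using Suc.IH[OF \<Phi>] by (simp add: \<gamma>_def)
  then have "\<beta> * measure \<omega> (\<Union>\<Phi>) \<le> \<beta> * (\<beta> ^ N * measure \<omega> Q)"
    using \<beta> by (rule mult_left_mono)
  with 1 show ?case by (simp add: E_def)
qed


section \<open>The mixed weak-type estimate on a laminar family\<close>

text \<open>
  Write \<open>g Q\<close> for the quotient \<open>U Q / W Q\<close>, and call a point \<open>x\<close> of \<open>R\<close> bad if it lies in a cell \<open>Q \<subseteq> R\<close>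
  with \<open>V x < b * g Q\<close>.  Stop at the maximal cells \<open>P \<subseteq> R\<close> with
  \<open>a * g R < g P\<close>.  A bad point either has such a cell with \<open>g Q\<close> at most \<open>a * g R\<close>, and then the
  hypothesis \<open>low\<close> for \<open>R\<close> applies to it, or it is a bad point of a stopped cell.  The stopped cells
  carry at most the fraction \<open>\<theta>\<close> of the mass of \<open>R\<close>; hence the supremum \<open>\<kappa>\<close> of the ratios between the
  mass of the bad points and the mass of the cell satisfies \<open>\<kappa> \<le> \<epsilon> + \<theta> * \<kappa>\<close>.
\<close>
lemma local_level_bound:
  fixes V :: "'a \<Rightarrow> real" and a b \<epsilon> \<theta> :: real
  assumes sets: "sets W = sets M" "sets U = sets M"
    and V: "V \<in> borel_measurable M"
    and fin: "\<And>Q. Q \<in> \<D> \<Longrightarrow> emeasure W Q < \<infinity>" "\<And>Q. Q \<in> \<D> \<Longrightarrow> emeasure U Q < \<infinity>"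
    and pos: "\<And>Q. Q \<in> \<D> \<Longrightarrow> 0 < measure W Q" "\<And>Q. Q \<in> \<D> \<Longrightarrow> 0 < measure U Q"
    and ab: "0 < a" "0 < b" and \<theta>: "\<theta> < 1"
    and stop: "\<And>Q E. Q \<in> \<D> \<Longrightarrow> E \<in> sets M \<Longrightarrow> E \<subseteq> Q \<Longrightarrow>
      a * measure W E \<le> measure W Q \<Longrightarrow> measure U E \<le> \<theta> * measure U Q"
    and low: "\<And>Q. Q \<in> \<D> \<Longrightarrow>
      measure U {x \<in> Q. V x * measure W Q < a * b * measure U Q} \<le> \<epsilon> * measure U Q"
    and R: "R \<in> \<D>"
  shows "measure U {x \<in> R. \<exists>Q\<in>\<D>. x \<in> Q \<and> Q \<subseteq> R \<and> V x * measure W Q < b * measure U Q}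
    \<le> \<epsilon> / (1 - \<theta>) * measure U R"
proof -
  define T where "T R = {x \<in> R. \<exists>Q\<in>\<D>. x \<in> Q \<and> Q \<subseteq> R \<and> V x * measure W Q < b * measure U Q}" for R
  define L where "L R = {x \<in> R. V x * measure W R < a * b * measure U R}" for R
  have lev: "{x \<in> Q. V x * c < d} \<in> sets M" if "Q \<in> \<D>" for Q c d
  proof -
    have "{x \<in> space M. V x * c < d} \<in> sets M" using V by measurable
    moreover have "{x \<in> Q. V x * c < d} = {x \<in> space M. V x * c < d} \<inter> Q"
      using that cells_measurable sets.sets_into_space by blast
    ultimately show ?thesis using that cells_measurable by auto
  qed
  have T_meas: "T R \<in> sets M" for R
  proof -
    have "T R = (\<Union>Q\<in>{Q \<in> \<D>. Q \<subseteq> R}. {x \<in> Q. V x * measure W Q < b * measure U Q})"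
      by (auto simp: T_def)
    moreover have "countable {Q \<in> \<D>. Q \<subseteq> R}"
      using countable_cells by (rule countable_subset[rotated]) auto
    ultimately show ?thesis using lev by (auto intro!: sets.countable_UN')
  qed
  have T_sub: "T R \<subseteq> R" and L_sub: "L R \<subseteq> R" for R by (auto simp: T_def L_def)
  have Uf: "S \<in> fmeasurable U" if "S \<subseteq> Q" "Q \<in> \<D>" "S \<in> sets M" for S Q
    using that emeasure_finite_subset[OF that(1) _ fin(2)] cells_measurable sets
    by (auto intro!: fmeasurableI)
  have ratio1: "measure U (T R) / measure U R \<le> 1" if "R \<in> \<D>" for R
    using measure_mono_fmeasurable[OF T_sub, of R U] T_meas[of R] sets Uf[of R R] that
      cells_measurable pos by auto
  define \<kappa> where "\<kappa> = (SUP R\<in>\<D>. measure U (T R) / measure U R)"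
  have bdd: "bdd_above ((\<lambda>R. measure U (T R) / measure U R) ` \<D>)"
    using ratio1 by (auto simp: bdd_above_def)
  have \<kappa>: "measure U (T R) \<le> \<kappa> * measure U R" if "R \<in> \<D>" for R
    using cSUP_upper[OF that bdd] pos[OF that] by (simp add: \<kappa>_def pos_divide_le_eq)
  have "0 \<le> \<kappa>"
    using cSUP_upper[OF R bdd] pos[OF R] unfolding \<kappa>_def
    by (meson divide_nonneg_nonneg measure_nonneg order_trans)
  have step: "measure U (T R) \<le> (\<epsilon> + \<theta> * \<kappa>) * measure U R" if R: "R \<in> \<D>" for R
  proof -
    define \<Phi> where "\<Phi> = {Q \<in> \<D>. Q \<subseteq> R \<and> a * measure W Q * measure U R < measure U Q * measure W R}"
    have \<Phi>: "\<Phi> \<subseteq> \<D>" "\<Union>\<Phi> \<subseteq> R" by (auto simp: \<Phi>_def)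
    have Um: "\<Union>\<Phi> \<in> sets M" using sets_Union_cells \<Phi> by auto
    have sp: "space M \<inter> \<Union>\<Phi> = \<Union>\<Phi>" using Um sets.sets_into_space by blast
    have spQ: "space M \<inter> Q = Q" if "Q \<in> \<D>" for Q
      using that cells_measurable sets.sets_into_space by blast
    have finU: "emeasure U (X \<inter> \<Union>\<Phi>) < \<infinity>" "emeasure W (X \<inter> \<Union>\<Phi>) < \<infinity>" for X
      using emeasure_finite_subset[of "X \<inter> \<Union>\<Phi>" R U] emeasure_finite_subset[of "X \<inter> \<Union>\<Phi>" R W]
        le_infI2[OF \<Phi>(2), of X] fin[OF R] R cells_measurable[THEN subsetD] sets by simp_all
    have Rf: "R \<in> fmeasurable U" using Uf[of R R] R cells_measurable by auto
    have "measure W (space M \<inter> \<Union>\<Phi>)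
        \<le> measure W R / (a * measure U R) * measure U (space M \<inter> \<Union>\<Phi>)"
    proof (rule measure_Union_cells_le[OF \<Phi>(1) sets])
      fix P assume "P \<in> maximal_cells \<Phi>"
      then have "P \<in> \<Phi>" "P \<in> \<D>" using maximal_cells_subset \<Phi> by auto
      then show "measure W (space M \<inter> P)
          \<le> measure W R / (a * measure U R) * measure U (space M \<inter> P)"
        using spQ[of P] ab pos[OF R] by (auto simp: \<Phi>_def field_simps)
    qed (use finU ab in \<open>auto intro!: divide_nonneg_nonneg mult_nonneg_nonneg\<close>)
    also have "\<dots> \<le> measure W R / (a * measure U R) * measure U R"
      unfolding sp using \<Phi>(2) Um Rf sets ab
      by (intro mult_left_mono measure_mono_fmeasurable divide_nonneg_nonneg) auto
    finally have "a * measure W (\<Union>\<Phi>) \<le> measure W R"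
      using ab pos[OF R] by (simp add: sp field_simps)
    then have stopped: "measure U (\<Union>\<Phi>) \<le> \<theta> * measure U R"
      using stop[OF R Um \<Phi>(2)] by simp
    \<comment> \<open>A bad cell that is not stopped puts its points into the low level set of \<open>R\<close>.\<close>
    have escape: "x \<in> L R" if "x \<in> R" "Q \<in> \<D>" "Q \<subseteq> R" "Q \<notin> \<Phi>"
      "V x * measure W Q < b * measure U Q" for x Q
    proof -
      have "measure W Q * (V x * measure W R) = V x * measure W Q * measure W R" by simp
      also have "\<dots> < b * measure U Q * measure W R"
        using that pos[OF R] by (intro mult_strict_right_mono)
      also have "\<dots> = b * (measure U Q * measure W R)" by simp
      also have "\<dots> \<le> b * (a * measure W Q * measure U R)"
        using that ab by (intro mult_left_mono) (auto simp: \<Phi>_def)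
      finally have "measure W Q * (V x * measure W R) < measure W Q * (a * b * measure U R)"
        by (simp add: ac_simps)
      then show ?thesis using pos(1)[OF that(2)] that(1) by (simp add: L_def)
    qed
    define A where "A = T R - L R"
    have A: "A \<in> sets M" using T_meas lev[OF R] by (auto simp: A_def L_def)
    have "A \<subseteq> \<Union>\<Phi>"
    proof
      fix x assume x: "x \<in> A"
      then obtain Q where Q: "Q \<in> \<D>" "x \<in> Q" "Q \<subseteq> R" "V x * measure W Q < b * measure U Q"
        by (auto simp: A_def T_def)
      then have "Q \<in> \<Phi>" using escape[of x Q] x by (auto simp: A_def)
      with Q show "x \<in> \<Union>\<Phi>" by auto
    qed
    have "measure U (A \<inter> \<Union>\<Phi>) \<le> \<kappa> * measure U (space M \<inter> \<Union>\<Phi>)"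
    proof (rule measure_Union_cells_le[OF \<Phi>(1) sets(2) sets(2) A _ \<open>0 \<le> \<kappa>\<close>])
      fix P assume P: "P \<in> maximal_cells \<Phi>"
      then have P': "P \<in> \<Phi>" "P \<in> \<D>" using maximal_cells_subset \<Phi> by auto
      have "A \<inter> P \<subseteq> T P"
      proof
        fix x assume x: "x \<in> A \<inter> P"
        then obtain Q where Q: "Q \<in> \<D>" "x \<in> Q" "Q \<subseteq> R" "V x * measure W Q < b * measure U Q"
          by (auto simp: A_def T_def)
        then have "Q \<in> \<Phi>" using escape[of x Q] x by (auto simp: A_def)
        moreover have "Q \<subseteq> P \<or> P \<subseteq> Q" using nested_cells[of Q P] Q P' x by auto
        ultimately have "Q \<subseteq> P" using P unfolding maximal_cells_def by auto
        then show "x \<in> T P" using Q x by (auto simp: T_def)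
      qed
      then have "measure U (A \<inter> P) \<le> measure U (T P)"
        using A P' cells_measurable sets T_meas T_sub
        by (intro measure_mono_fmeasurable Uf[of _ P]) auto
      also have "\<dots> \<le> \<kappa> * measure U P" using \<kappa> P' by auto
      finally show "measure U (A \<inter> P) \<le> \<kappa> * measure U (space M \<inter> P)" using spQ P' by simp
    qed (use finU in auto)
    then have "measure U A \<le> \<kappa> * measure U (\<Union>\<Phi>)" using \<open>A \<subseteq> \<Union>\<Phi>\<close> sp by (simp add: Int_absorb2)
    also have "\<dots> \<le> \<kappa> * (\<theta> * measure U R)" using stopped \<open>0 \<le> \<kappa>\<close> by (rule mult_left_mono)
    finally have "measure U A \<le> \<theta> * \<kappa> * measure U R" by (simp add: ac_simps)
    moreover have "measure U (T R) \<le> measure U (L R \<union> A)"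
      using T_meas[of R] lev[OF R] A T_sub[of R] L_sub[of R] sets
      by (intro measure_mono_fmeasurable Uf[OF _ R]) (auto simp: A_def L_def)
    moreover have "measure U (L R \<union> A) \<le> measure U (L R) + measure U A"
      using lev[OF R] A sets by (intro measure_Un_le) (auto simp: L_def)
    moreover have "measure U (L R) \<le> \<epsilon> * measure U R" using low[OF R] by (simp add: L_def)
    ultimately show ?thesis by (simp add: distrib_right)
  qed
  have "\<kappa> \<le> \<epsilon> + \<theta> * \<kappa>"
    unfolding \<kappa>_def[of] using step pos R
    by (subst \<kappa>_def[symmetric], intro cSUP_least) (auto simp: pos_divide_le_eq)
  then have "\<kappa> \<le> \<epsilon> / (1 - \<theta>)" using \<theta> by (simp add: pos_le_divide_eq algebra_simps)
  then have "\<kappa> * measure U R \<le> \<epsilon> / (1 - \<theta>) * measure U R" by (rule mult_right_mono) simp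
  with \<kappa>[OF R] show ?thesis by (simp add: T_def)
qed

text \<open>
  Let \<open>b l = b * r ^ l\<close>.  The cells with \<open>b l * U Q < \<nu> Q\<close> cover a set \<open>S l\<close> of mass at most
  \<open>\<nu> (space M) / b l\<close>.  If a point \<open>x\<close> of the set in question is not in \<open>S 0\<close>, its cell satisfies
  \<open>b (l + 1) * U Q < \<nu> Q \<le> b l * U Q\<close> for some \<open>l\<close>, so that \<open>V x * W Q < b l * U Q\<close> and \<open>x\<close> is a bad
  point, at the level \<open>b l\<close>, of a maximal cell of \<open>S (l + 1)\<close>.  These points form only a fraction
  proportional to \<open>b l * q ^ l\<close> of \<open>S (l + 1)\<close>.  The factor \<open>b l\<close> compensates the bound on \<open>S (l + 1)\<close>,
  and \<open>q ^ l\<close> makes the sum over \<open>l\<close> converge.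
\<close>
theorem mixed_weak_type:
  fixes V :: "'a \<Rightarrow> real" and a b r q \<theta> :: real
  assumes sets: "sets W = sets M" "sets U = sets M" "sets \<nu> = sets M"
    and V: "V \<in> borel_measurable M" "\<And>x. 0 \<le> V x"
    and fin: "\<And>Q. Q \<in> \<D> \<Longrightarrow> emeasure W Q < \<infinity>" "\<And>Q. Q \<in> \<D> \<Longrightarrow> emeasure U Q < \<infinity>"
    and pos: "\<And>Q. Q \<in> \<D> \<Longrightarrow> 0 < measure W Q" "\<And>Q. Q \<in> \<D> \<Longrightarrow> 0 < measure U Q"
    and ab: "0 < a" "0 < b" and \<theta>: "\<theta> < 1" and rq: "0 < r" "r < 1" "0 \<le> q" "q < 1"
    and stop: "\<And>Q E. Q \<in> \<D> \<Longrightarrow> E \<in> sets M \<Longrightarrow> E \<subseteq> Q \<Longrightarrow>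
      a * measure W E \<le> measure W Q \<Longrightarrow> measure U E \<le> \<theta> * measure U Q"
    and low: "\<And>Q l. Q \<in> \<D> \<Longrightarrow>
      measure U {x \<in> Q. V x * measure W Q < a * (b * r ^ l) * measure U Q}
        \<le> a * (b * r ^ l) * q ^ l * measure U Q"
  shows "emeasure U {x. \<exists>Q\<in>\<D>. x \<in> Q \<and> ennreal (V x * measure W Q) < emeasure \<nu> Q}
    \<le> ennreal (1 / b + a / (r * (1 - \<theta>) * (1 - q))) * emeasure \<nu> (space M)"
proof -
  define F where "F = emeasure \<nu> (space M)"
  define S where "S l = {Q \<in> \<D>. ennreal (b * r ^ l * measure U Q) < emeasure \<nu> Q}" for l
  define A where "A l = (\<Union>Q\<in>S (Suc l). {x \<in> Q. V x * measure W Q < b * r ^ l * measure U Q})" for l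
  have S_sub: "S l \<subseteq> \<D>" for l by (auto simp: S_def)
  have b_pos: "0 < b * r ^ l" for l using ab rq by auto
  have spQ: "space M \<inter> Q = Q" if "Q \<in> \<D>" for Q
    using that cells_measurable sets.sets_into_space by blast
  have lev: "{x \<in> Q. V x * c < d} \<in> sets M" if "Q \<in> \<D>" for Q c d
  proof -
    have "{x \<in> space M. V x * c < d} \<in> sets M" using V by measurable
    moreover have "{x \<in> Q. V x * c < d} = {x \<in> space M. V x * c < d} \<inter> Q"
      using spQ[OF that] by blast
    ultimately show ?thesis using that cells_measurable by auto
  qed
  have A_meas: "A l \<in> sets M" for l
    using lev subsetD[OF S_sub] countable_subset[OF S_sub countable_cells] unfolding A_def
    by (intro sets.countable_UN') auto
  have US: "emeasure U (\<Union>(S l)) \<le> ennreal (1 / (b * r ^ l)) * F" for l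
  proof -
    have "emeasure U (space M \<inter> \<Union>(S l)) \<le> ennreal (1 / (b * r ^ l)) * emeasure \<nu> (space M \<inter> \<Union>(S l))"
    proof (rule emeasure_Union_cells_le[OF S_sub sets(2,3)])
      fix Q assume "Q \<in> maximal_cells (S l)"
      then have Q: "Q \<in> \<D>" "ennreal (b * r ^ l * measure U Q) \<le> emeasure \<nu> Q"
        using subsetD[OF maximal_cells_subset, of Q "S l"] by (auto simp: S_def)
      have "emeasure U Q = ennreal (1 / (b * r ^ l)) * ennreal (b * r ^ l * measure U Q)"
        using rq ab fin(2)[OF Q(1)]
        by (simp add: emeasure_eq_ennreal_measure less_top flip: ennreal_mult)
      also have "\<dots> \<le> ennreal (1 / (b * r ^ l)) * emeasure \<nu> Q"
        using Q by (intro mult_left_mono) auto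
      finally show "emeasure U (space M \<inter> Q) \<le> ennreal (1 / (b * r ^ l)) * emeasure \<nu> (space M \<inter> Q)"
        using spQ Q by simp
    qed auto
    also have "\<dots> \<le> ennreal (1 / (b * r ^ l)) * F"
      unfolding F_def using sets sets_eq_imp_space_eq[OF sets(3)]
      by (intro mult_left_mono emeasure_mono) auto
    moreover have "space M \<inter> \<Union>(S l) = \<Union>(S l)"
      using sets_Union_cells[OF S_sub] sets.sets_into_space by blast
    ultimately show ?thesis by simp
  qed
  define K where "K = a / (r * (1 - \<theta>))"
  have K: "0 \<le> K" using ab rq \<theta> by (auto simp: K_def)
  have UA: "emeasure U (A l) \<le> ennreal (K * q ^ l) * F" for l
  proof -
    define e where "e = a * (b * r ^ l) * q ^ l / (1 - \<theta>)"
    have e: "0 \<le> e" using ab rq \<theta> by (auto simp: e_def)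
    have "emeasure U (A l \<inter> \<Union>(S (Suc l))) \<le> ennreal e * emeasure U (space M \<inter> \<Union>(S (Suc l)))"
    proof (rule emeasure_Union_cells_le[OF S_sub sets(2,2) A_meas])
      fix P assume P: "P \<in> maximal_cells (S (Suc l))"
      then have P': "P \<in> \<D>" "P \<in> S (Suc l)" using maximal_cells_subset S_sub by auto
      let ?T = "{x \<in> P. \<exists>Q\<in>\<D>. x \<in> Q \<and> Q \<subseteq> P \<and> V x * measure W Q < b * r ^ l * measure U Q}"
      have "A l \<inter> P \<subseteq> ?T"
      proof
        fix x assume x: "x \<in> A l \<inter> P"
        then obtain Q where Q: "Q \<in> S (Suc l)" "x \<in> Q" "V x * measure W Q < b * r ^ l * measure U Q"
          by (auto simp: A_def)
        then have "Q \<subseteq> P \<or> P \<subseteq> Q" using nested_cells[of Q P] P' x S_sub by blast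
        then have "Q \<subseteq> P" using P Q unfolding maximal_cells_def by auto
        then show "x \<in> ?T" using Q x S_sub by auto
      qed
      moreover have fP: "P \<in> fmeasurable U"
        using fin P' sets cells_measurable by (auto intro!: fmeasurableI)
      moreover have T_meas: "?T \<in> sets U"
      proof -
        have "?T = (\<Union>Q\<in>{Q \<in> \<D>. Q \<subseteq> P}. {x \<in> Q. V x * measure W Q < b * r ^ l * measure U Q})"
          by auto
        moreover have "countable {Q \<in> \<D>. Q \<subseteq> P}"
          using countable_cells by (rule countable_subset[rotated]) auto
        ultimately show ?thesis using lev sets by (auto intro!: sets.countable_UN')
      qed
      moreover have fT: "?T \<in> fmeasurable U"
        by (rule fmeasurableI2[OF fP _ T_meas]) auto
      ultimately have "emeasure U (A l \<inter> P) \<le> ennreal (measure U ?T)"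
        unfolding emeasure_eq_measure2[OF fT, symmetric] by (intro emeasure_mono)
      also have "\<dots> \<le> ennreal (e * measure U P)"
        unfolding e_def
        by (intro ennreal_leI
            local_level_bound[OF sets(1,2) V(1) fin pos ab(1) b_pos[of l] \<theta> stop low P'(1)])
      also have "\<dots> = ennreal e * emeasure U P"
        using e fP by (simp add: ennreal_mult emeasure_eq_measure2)
      finally show "emeasure U (A l \<inter> P) \<le> ennreal e * emeasure U (space M \<inter> P)"
        using spQ P' by simp
    qed auto
    moreover have "A l \<inter> \<Union>(S (Suc l)) = A l" by (auto simp: A_def)
    moreover have "space M \<inter> \<Union>(S (Suc l)) = \<Union>(S (Suc l))"
      using sets_Union_cells[OF S_sub] sets.sets_into_space by blast
    ultimately have "emeasure U (A l) \<le> ennreal e * emeasure U (\<Union>(S (Suc l)))" by simp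
    also have "\<dots> \<le> ennreal e * (ennreal (1 / (b * r ^ Suc l)) * F)"
      by (intro mult_left_mono US) auto
    also have "\<dots> = ennreal (e * (1 / (b * r ^ Suc l))) * F"
      using e b_pos[of "Suc l"] by (subst ennreal_mult) (auto simp: mult.assoc)
    also have "e * (1 / (b * r ^ Suc l)) = K * q ^ l"
      using ab rq \<theta> by (simp add: e_def K_def field_simps)
    finally show ?thesis .
  qed
  have cover: "{x. \<exists>Q\<in>\<D>. x \<in> Q \<and> ennreal (V x * measure W Q) < emeasure \<nu> Q}
      \<subseteq> \<Union>(S 0) \<union> (\<Union>l. A l)"
  proof clarify
    fix x Q assume Q: "Q \<in> \<D>" "x \<in> Q" "ennreal (V x * measure W Q) < emeasure \<nu> Q"
      and no: "x \<notin> (\<Union>l. A l)"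
    show "x \<in> \<Union>(S 0)"
    proof (rule ccontr)
      assume "x \<notin> \<Union>(S 0)"
      then have "Q \<notin> S 0" using Q by auto
      have "(\<lambda>l. ennreal (b * r ^ l * measure U Q)) \<longlonglongrightarrow> ennreal (b * 0 * measure U Q)"
        using rq by (intro tendsto_intros LIMSEQ_power_zero) auto
      moreover have "ennreal (b * 0 * measure U Q) < emeasure \<nu> Q"
        using Q(3) by (simp add: order.strict_trans1[OF zero_le])
      ultimately obtain l where "ennreal (b * r ^ l * measure U Q) < emeasure \<nu> Q"
        using order_tendstoD(2) eventually_sequentially by (metis (no_types, lifting) order_refl)
      then have ex: "\<exists>l. Q \<in> S l" using Q by (auto simp: S_def)
      define l where "l = (LEAST l. Q \<in> S l)"
      have l: "Q \<in> S l" unfolding l_def using ex by (rule LeastI_ex)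
      then obtain l' where l': "l = Suc l'" using \<open>Q \<notin> S 0\<close> by (cases l) auto
      then have "Q \<notin> S l'" using not_less_Least[of l' "\<lambda>l. Q \<in> S l"] by (simp add: l_def)
      then have "emeasure \<nu> Q \<le> ennreal (b * r ^ l' * measure U Q)"
        using Q by (auto simp: S_def)
      with Q(3) have "ennreal (V x * measure W Q) < ennreal (b * r ^ l' * measure U Q)"
        by (rule order.strict_trans2)
      then have "V x * measure W Q < b * r ^ l' * measure U Q"
        using V(2) by (simp add: ennreal_less_iff)
      then have "x \<in> A l'" using l l' Q by (auto simp: A_def)
      with no show False by auto
    qed
  qed
  have "emeasure U {x. \<exists>Q\<in>\<D>. x \<in> Q \<and> ennreal (V x * measure W Q) < emeasure \<nu> Q}
      \<le> emeasure U (\<Union>(S 0) \<union> (\<Union>l. A l))"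
    using sets A_meas sets_Union_cells[OF S_sub] by (intro emeasure_mono[OF cover]) auto
  also have "\<dots> \<le> emeasure U (\<Union>(S 0)) + emeasure U (\<Union>l. A l)"
    using sets A_meas sets_Union_cells[OF S_sub] by (intro emeasure_subadditive) auto
  also have "\<dots> \<le> ennreal (1 / b) * F + (\<Sum>l. emeasure U (A l))"
    using US[of 0] sets A_meas
    by (intro add_mono emeasure_subadditive_countably) auto
  also have "(\<Sum>l. emeasure U (A l)) \<le> (\<Sum>l. ennreal (K * q ^ l) * F)"
    by (intro suminf_le UA) auto
  also have "\<dots> = (\<Sum>l. ennreal (K * q ^ l)) * F" by simp
  also have "(\<Sum>l. ennreal (K * q ^ l)) = ennreal (\<Sum>l. K * q ^ l)"
    using K rq by (intro suminf_ennreal2 summable_mult summable_geometric) auto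
  also have "(\<Sum>l. K * q ^ l) = K / (1 - q)"
    using rq by (subst suminf_mult) (auto simp: suminf_geometric summable_geometric)
  finally have "emeasure U {x. \<exists>Q\<in>\<D>. x \<in> Q \<and> ennreal (V x * measure W Q) < emeasure \<nu> Q}
      \<le> (ennreal (1 / b) + ennreal (K / (1 - q))) * F"
    by (simp add: distrib_right)
  also have "ennreal (1 / b) + ennreal (K / (1 - q)) = ennreal (1 / b + K / (1 - q))"
    using ab rq K by (intro ennreal_plus[symmetric]) auto
  finally show ?thesis by (simp add: F_def K_def mult.assoc)
qed

end

section \<open>Shifted dyadic grids\<close>

text \<open>
  For every set \<open>A\<close> of coordinates there is a grid that is shifted by a third of the side length in the
  coordinates of \<open>A\<close>.  The sign of the shift alternates with the level \<open>k\<close>, because the doubled shift of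
  level \<open>k\<close> and the shift of level \<open>k + 1\<close> then differ by an integer; so every level refines the
  previous one.
\<close>
definition grid_shift :: "'n set \<Rightarrow> int \<Rightarrow> 'n \<Rightarrow> real"
  where "grid_shift A k i = (if i \<in> A then (if even k then 1 / 3 else - (1 / 3)) else 0)"

abbreviation vol :: "'a :: euclidean_space set \<Rightarrow> real"
  where "vol \<equiv> measure lebesgue"

definition grid_index :: "'n set \<Rightarrow> int \<Rightarrow> real ^ 'n \<Rightarrow> 'n \<Rightarrow> int"
  where "grid_index A k x = (\<lambda>i. \<lfloor>2 powi k * x $ i + grid_shift A k i\<rfloor>)"

definition cell :: "'n set \<Rightarrow> int \<Rightarrow> ('n \<Rightarrow> int) \<Rightarrow> (real ^ 'n) set"
  where "cell A k j = {x. grid_index A k x = j}"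

text \<open>
  The truncation \<open>K \<le> k\<close> of the levels bounds the side lengths, so that a cell has finitely many
  ancestors.
\<close>
definition grid :: "'n set \<Rightarrow> int \<Rightarrow> (real ^ 'n) set set"
  where "grid A K = {cell A k j |k j. K \<le> k}"

lemma cubeE:
  assumes "Q \<in> cubes"
  obtains a s where "Q = cbox a (\<chi> i. a $ i + s)" "0 < s"
  using assms by (auto simp: cubes_def)

lemma measure_cube:
  fixes a :: "real ^ 'n"
  assumes "0 \<le> s"
  shows "vol (cbox a (\<chi> i. a $ i + s)) = s ^ CARD('n)"
    and "vol (box a (\<chi> i. a $ i + s)) = s ^ CARD('n)"
proof -
  have "a \<in> cbox a (\<chi> i. a $ i + s)"
    using assms by (simp add: mem_box_cart)
  then have "measure lborel (cbox a (\<chi> i. a $ i + s)) = s ^ CARD('n)"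
    by (subst content_cbox_cart) auto
  then show "vol (cbox a (\<chi> i. a $ i + s)) = s ^ CARD('n)"
    by (simp add: measure_completion)
  then show "vol (box a (\<chi> i. a $ i + s)) = s ^ CARD('n)"
    by (simp add: measure_completion measure_lborel_box_eq measure_lborel_cbox_eq)
qed

lemma grid_index_coarser:
  "grid_index A k x i
    = (grid_index A (k + 1) x i + (if i \<in> A then if even k then 1 else -1 else 0)) div 2"
proof -
  define z where "z = 2 powi (k + 1) * x $ i + grid_shift A (k + 1) i"
  define c :: int where "c = (if i \<in> A then if even k then 1 else -1 else 0)"
  have "2 powi k * x $ i + grid_shift A k i = (z + of_int c) / 2"
    by (auto simp: z_def c_def grid_shift_def power_int_add field_simps)
  then have "grid_index A k x i = \<lfloor>(z + of_int c) / 2\<rfloor>"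
    unfolding grid_index_def by (simp only:)
  also have "\<dots> = \<lfloor>z + of_int c\<rfloor> div 2"
    using floor_divide_real_eq_div[of 2 "z + of_int c"] by simp
  also have "\<dots> = (\<lfloor>z\<rfloor> + c) div 2" by simp
  finally show ?thesis by (simp add: z_def c_def grid_index_def)
qed

lemma grid_index_mono:
  assumes "k \<le> l" "grid_index A l x = grid_index A l y"
  shows "grid_index A k x = grid_index A k y"
  using assms
proof (induction rule: int_le_induct[where k = l])
  case base then show ?case by simp
next
  case (step i)
  show ?case
  proof
    fix n
    show "grid_index A (i - 1) x n = grid_index A (i - 1) y n"
      using grid_index_coarser[of A "i - 1" x n] grid_index_coarser[of A "i - 1" y n] step
      by simp
  qed
qed

lemma cell_sandwich:
  fixes j :: "'n::finite \<Rightarrow> int"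
  obtains a :: "real ^ 'n" where "cell A k j \<subseteq> cbox a (\<chi> i. a $ i + 2 powi - k)"
    "box a (\<chi> i. a $ i + 2 powi - k) \<subseteq> cell A k j" "a \<in> cell A k j"
proof
  define a :: "real ^ 'n" where "a = (\<chi> i. (of_int (j i) - grid_shift A k i) / 2 powi k)"
  have p: "(0::real) < 2 powi k" by simp
  have scale: "2 powi k * x $ i + grid_shift A k i = of_int (j i) + 2 powi k * (x $ i - a $ i)" for x i
    by (simp add: a_def field_simps)
  have idx: "grid_index A k x i = j i \<longleftrightarrow> 0 \<le> 2 powi k * (x $ i - a $ i) \<and> 2 powi k * (x $ i - a $ i) < 1" for x i
    unfolding grid_index_def scale floor_eq_iff by linarith
  have idx: "grid_index A k x i = j i \<longleftrightarrow> a $ i \<le> x $ i \<and> x $ i < a $ i + 2 powi - k" for x i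
    unfolding idx using p by (simp add: power_int_minus field_simps zero_le_mult_iff)
  have cell: "cell A k j = {x. \<forall>i. a $ i \<le> x $ i \<and> x $ i < a $ i + 2 powi - k}"
    unfolding cell_def fun_eq_iff idx ..
  show "cell A k j \<subseteq> cbox a (\<chi> i. a $ i + 2 powi - k)"
    unfolding cell by (clarsimp simp: mem_box_cart) (metis less_imp_le)
  show "box a (\<chi> i. a $ i + 2 powi - k) \<subseteq> cell A k j"
    unfolding cell by (auto simp: mem_box_cart intro: less_imp_le)
  show "a \<in> cell A k j" unfolding cell by simp
qed

lemma cell_cube:
  fixes j :: "'n::finite \<Rightarrow> int"
  obtains Q :: "(real ^ 'n) set" where "Q \<in> cubes" "cell A k j \<subseteq> Q" "negligible (Q - cell A k j)"
proof -
  obtain a where a: "cell A k j \<subseteq> cbox a (\<chi> i. a $ i + 2 powi - k)"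
    "box a (\<chi> i. a $ i + 2 powi - k) \<subseteq> cell A k j"
    by (rule cell_sandwich)
  let ?b = "\<chi> i. a $ i + 2 powi - k"
  have "negligible (cbox a ?b - cell A k j)"
    by (rule negligible_subset[OF negligible_frontier_interval]) (use a in auto)
  moreover have "cbox a ?b \<in> cubes" unfolding cubes_def 
    by (rule CollectI, rule exI[of _ a], rule exI[of _ "2 powi - k"]) simp
  ultimately show ?thesis using that[of "cbox a ?b"] a by simp
qed

lemma cell_measurable: "cell A k (j :: 'n::finite \<Rightarrow> int) \<in> lmeasurable"
proof -
  obtain Q where Q: "Q \<in> cubes" "cell A k j \<subseteq> Q" "negligible (Q - cell A k j)"
    by (rule cell_cube)
  then have "Q \<in> lmeasurable" by (elim cubeE) simp
  moreover have "Q - (Q - cell A k j) \<in> sets lebesgue"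
    using Q \<open>Q \<in> lmeasurable\<close> negligible_imp_sets[OF Q(3)] by (metis sets.Diff fmeasurableD)
  moreover have "Q - (Q - cell A k j) = cell A k j" using Q by auto
  ultimately show ?thesis using fmeasurableI2 Q by metis
qed

lemma measure_cell: "vol (cell A k (j :: 'n::finite \<Rightarrow> int)) = (2 powi - k) ^ CARD('n)"
proof -
  obtain a where a: "cell A k j \<subseteq> cbox a (\<chi> i. a $ i + 2 powi - k)"
    "box a (\<chi> i. a $ i + 2 powi - k) \<subseteq> cell A k j"
    by (rule cell_sandwich)
  let ?b = "\<chi> i. a $ i + 2 powi - k"
  have "vol (cell A k j) \<le> vol (cbox a ?b)"
    by (rule measure_mono_fmeasurable) (use a cell_measurable[of A k j] in auto)
  moreover have "vol (box a ?b) \<le> vol (cell A k j)"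
    by (rule measure_mono_fmeasurable) (use a cell_measurable[of A k j] in auto)
  moreover have "(0::real) \<le> 2 powi - k" by simp
  ultimately show ?thesis by (simp only: measure_cube)
qed

lemma cell_nonempty: "cell A k (j :: 'n::finite \<Rightarrow> int) \<noteq> {}"
  by (rule cell_sandwich[of A k j]) auto

lemma cell_eq: "x \<in> cell A k j \<Longrightarrow> cell A k j = cell A k (grid_index A k x)"
  by (simp add: cell_def)

lemma cell_subset:
  assumes "k \<le> l" "x \<in> cell A k j" "x \<in> cell A l j'"
  shows "cell A l j' \<subseteq> cell A k j"
proof
  fix y assume "y \<in> cell A l j'"
  then have "grid_index A l y = grid_index A l x" using assms(3) by (simp add: cell_def)
  from grid_index_mono[OF assms(1) this] assms(2) show "y \<in> cell A k j" by (simp add: cell_def)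
qed

lemma laminar_grid: "laminar_family lebesgue (grid A K :: (real ^ 'n) set set)"
proof
  have "grid A K \<subseteq> range (\<lambda>(k, j). cell A k j)" by (auto simp: grid_def)
  then show "countable (grid A K)"
    by (rule countable_subset) (intro countable_image countableI_type)
  show "grid A K \<subseteq> sets lebesgue"
    using cell_measurable by (auto simp: grid_def)
  show "Q \<subseteq> R \<or> R \<subseteq> Q" if QR: "Q \<in> grid A K" "R \<in> grid A K" "Q \<inter> R \<noteq> {}" for Q R
  proof -
    obtain k j l i where kl: "Q = cell A k j" "R = cell A l i"
      using QR(1,2) unfolding grid_def by blast
    obtain x where "x \<in> Q" "x \<in> R" using QR(3) by auto
    then show ?thesis
      using cell_subset[of k l x A j i] cell_subset[of l k x A i j] kl by (cases "k \<le> l") auto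
  qed
  show "finite {R \<in> grid A K. Q \<subseteq> R}" if Q: "Q \<in> grid A K" for Q
  proof -
    obtain k j where kj: "Q = cell A k j" using Q by (auto simp: grid_def)
    obtain x where x: "x \<in> Q" using cell_nonempty[of A k j] kj by auto
    have "{R \<in> grid A K. Q \<subseteq> R} \<subseteq> insert Q ((\<lambda>l. cell A l (grid_index A l x)) ` {K..k})"
    proof
      fix R assume R: "R \<in> {R \<in> grid A K. Q \<subseteq> R}"
      then obtain l i where l: "R = cell A l i" "K \<le> l" by (auto simp: grid_def)
      have xR: "x \<in> cell A l i" using R x l by auto
      show "R \<in> insert Q ((\<lambda>l. cell A l (grid_index A l x)) ` {K..k})"
      proof (cases "l \<le> k")
        case True
        then show ?thesis using l cell_eq[OF xR] by auto
      next
        case False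
        then have "R \<subseteq> Q" using cell_subset[of k l x A j i] x xR kj l by auto
        then show ?thesis using R by auto
      qed
    qed
    then show ?thesis by (rule finite_subset) auto
  qed
qed

lemma grid_parent:
  fixes Q R :: "(real ^ 'n) set"
  assumes "Q \<in> grid A K" "R \<in> grid A K" "Q \<subset> R"
  shows "\<exists>P\<in>grid A K. Q \<subset> P \<and> P \<subseteq> R \<and> vol P \<le> 2 ^ CARD('n) * vol Q"
proof -
  obtain k j l i where Q: "Q = cell A k j" and R: "R = cell A l i" and l: "K \<le> l"
    using assms by (auto simp: grid_def)
  obtain x where x: "x \<in> Q" using cell_nonempty[of A k j] Q by auto
  have "l < k"
  proof (rule ccontr)
    assume "\<not> l < k"
    then have "R \<subseteq> Q" using cell_subset[of k l x A j i] x assms Q R by auto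
    with assms show False by auto
  qed
  define P where "P = cell A (k - 1) (grid_index A (k - 1) x)"
  have xP: "x \<in> P" by (simp add: P_def cell_def)
  have "P \<in> grid A K" using l \<open>l < k\<close> by (auto simp: grid_def P_def)
  moreover have "Q \<subseteq> P" using cell_subset[of "k - 1" k x A _ j] x xP Q by (auto simp: P_def)
  moreover have "P \<subseteq> R" using cell_subset[of l "k - 1" x A i] x xP R assms \<open>l < k\<close> by (auto simp: P_def)
  moreover have "(2::real) powi - (k - 1) = 2 * 2 powi - k"
    by (simp add: power_int_diff power_int_minus divide_inverse)
  then have m: "vol P = 2 ^ CARD('n) * vol Q"
    by (simp only: P_def Q measure_cell power_mult_distrib)
  moreover have "Q \<noteq> P"
  proof
    assume "Q = P"
    with m have "vol Q = 2 ^ CARD('n) * vol Q" by metis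
    moreover have "0 < vol Q" unfolding Q measure_cell by simp
    moreover have "(1::real) < 2 ^ CARD('n)" by (rule one_less_power) auto
    ultimately show False by (metis mult_cancel_right1 less_irrefl)
  qed
  ultimately show ?thesis by (intro bexI[of _ P]) auto
qed

text \<open>
  The one-third trick.  Choose the level with side length between \<open>3 * s\<close> and \<open>6 * s\<close>, where \<open>s\<close> is the
  side of \<open>Q\<close>.  If a coordinate interval of \<open>Q\<close> contains a point of the unshifted grid, it lies within a
  third of a side length of that point, hence between two neighbouring points of the shifted grid.
  The coordinates for which this happens form the set \<open>A\<close>.
\<close>
lemma cube_in_cell:
  fixes Q :: "(real ^ 'n) set"
  assumes "Q \<in> cubes"
  obtains A k j where "Q \<subseteq> cell A k j"
    "vol (cell A k j) \<le> 6 ^ CARD('n) * vol Q"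
proof -
  obtain a s where Q: "Q = cbox a (\<chi> i. a $ i + s)" and s: "0 < s" using assms by (rule cubeE)
  define k where "k = - \<lfloor>log 2 (6 * s)\<rfloor>"
  have pk: "(2::real) powr real_of_int (- k) = 2 powi - k" by (rule powr_real_of_int') auto
  have "(2::real) powr real_of_int (- k) \<le> 2 powr (log 2 (6 * s))"
    unfolding k_def by (intro powr_mono) auto
  then have k1: "2 powi - k \<le> 6 * s" using s unfolding pk by simp
  have "(2::real) powr (log 2 (6 * s)) < 2 powr (real_of_int (- k) + 1)"
    unfolding k_def using floor_correct[of "log 2 (6 * s)"] by (intro powr_less_mono) simp_all
  also have "\<dots> = 2 * 2 powi - k"
    unfolding powr_add pk by simp
  finally have k2: "3 * s < 2 powi - k" using s by simp
  define t where "t i = 2 powi k * a $ i" for i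
  define L where "L = 2 powi k * s"
  have L: "0 < L" "3 * L < 1" using k2 s by (auto simp: L_def power_int_minus field_simps)
  define A where "A = {i. \<lfloor>t i\<rfloor> \<noteq> \<lfloor>t i + L\<rfloor>}"
  have ends: "\<lfloor>t i + grid_shift A k i\<rfloor> = \<lfloor>t i + L + grid_shift A k i\<rfloor>" for i
  proof (cases "i \<in> A")
    case False then show ?thesis by (simp add: grid_shift_def A_def)
  next
    case True
    define n where "n = \<lfloor>t i + L\<rfloor>"
    have "\<lfloor>t i\<rfloor> < n" using True L floor_mono[of "t i" "t i + L"] by (auto simp: A_def n_def)
    then have "t i < n" by linarith
    moreover have "n \<le> t i + L" by (simp add: n_def)
    ultimately have "\<lfloor>t i + 1/3\<rfloor> = n" "\<lfloor>t i + L + 1/3\<rfloor> = n"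
      "\<lfloor>t i - 1/3\<rfloor> = n - 1" "\<lfloor>t i + L - 1/3\<rfloor> = n - 1"
      using L by (simp_all add: floor_eq_iff)
    with True show ?thesis by (simp add: grid_shift_def)
  qed
  have "x \<in> cell A k (grid_index A k a)" if "x \<in> Q" for x
  proof -
    have "grid_index A k x i = grid_index A k a i" for i
    proof -
      have "a $ i \<le> x $ i" "x $ i \<le> a $ i + s" using that by (auto simp: Q mem_box_cart)
      then have "2 powi k * a $ i \<le> 2 powi k * x $ i" "2 powi k * x $ i \<le> 2 powi k * (a $ i + s)"
        by (intro mult_left_mono; simp)+
      then have "t i + grid_shift A k i \<le> 2 powi k * x $ i + grid_shift A k i"
        "2 powi k * x $ i + grid_shift A k i \<le> t i + L + grid_shift A k i"
        by (auto simp: t_def L_def distrib_left)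
      from floor_mono[OF this(1)] floor_mono[OF this(2)] ends[of i]
      show ?thesis by (simp add: grid_index_def t_def)
    qed
    then show ?thesis by (simp add: cell_def fun_eq_iff)
  qed
  moreover have "vol (cell A k (grid_index A k a)) \<le> 6 ^ CARD('n) * vol Q"
    unfolding measure_cell Q measure_cube[OF less_imp_le[OF s]] power_mult_distrib[symmetric]
    by (intro power_mono k1) simp
  ultimately show ?thesis using that by blast
qed

lemma grid_outer_approx:
  fixes Q :: "(real ^ 'n) set"
  assumes Q: "Q \<in> grid A K" and E: "E \<in> sets lebesgue" "E \<subseteq> Q" and c: "vol E < c"
  obtains \<Psi> where "\<Psi> \<subseteq> grid A K" "E \<subseteq> \<Union>\<Psi>" "\<Union>\<Psi> \<subseteq> Q" "vol (\<Union>\<Psi>) < c"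
proof -
  interpret laminar_family lebesgue "grid A K" by (rule laminar_grid)
  have Qm: "Q \<in> lmeasurable" using Q cell_measurable by (auto simp: grid_def)
  then have Em: "E \<in> lmeasurable" using E fmeasurableI2 by blast
  obtain T where T: "open T" "E \<subseteq> T" "T - E \<in> lmeasurable" "vol (T - E) < c - vol E"
    using sets_lebesgue_outer_open[OF E(1), of "c - vol E"] c
    by (metis diff_gt_0_iff_gt emeasure_eq_measure2 ennreal_less_iff measure_nonneg)
  define \<Psi> where "\<Psi> = {P \<in> grid A K. P \<subseteq> T \<inter> Q}"
  have "E \<subseteq> \<Union>\<Psi>"
  proof
    fix x assume x: "x \<in> E"
    then obtain e where e: "0 < e" "ball x e \<subseteq> T" using T open_contains_ball by blast
    obtain k j where k: "Q = cell A k j" "K \<le> k" using Q by (auto simp: grid_def)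
    obtain N :: nat where N: "(1/2) ^ N * real CARD('n) < e"
    proof -
      have "(\<lambda>N. (1/2::real) ^ N * real CARD('n)) \<longlonglongrightarrow> 0 * real CARD('n)"
        by (intro tendsto_intros LIMSEQ_power_zero) auto
      then have "eventually (\<lambda>N. (1/2::real) ^ N * real CARD('n) < e) sequentially"
        using e by (intro order_tendstoD(2)) auto
      then show ?thesis using that eventually_sequentially by (metis order_refl)
    qed
    define l where "l = max k (int N)"
    define P where "P = cell A l (grid_index A l x)"
    have xP: "x \<in> P" by (simp add: P_def cell_def)
    have "P \<in> grid A K" using k by (auto simp: P_def grid_def l_def)
    moreover have "P \<subseteq> Q" using cell_subset[of k l x A j] x E k xP by (auto simp: P_def l_def)
    moreover have "P \<subseteq> ball x e"
    proof
      fix y assume y: "y \<in> P"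
      have "\<bar>(y - x) $ i\<bar> \<le> (1/2) ^ N" for i
      proof -
        have "grid_index A l x i = grid_index A l y i" using y by (simp add: P_def cell_def)
        then have "\<bar>2 powi l * y $ i - 2 powi l * x $ i\<bar> < 1"
          unfolding grid_index_def by linarith
        then have "2 powi l * \<bar>(y - x) $ i\<bar> \<le> 1"
          by (simp add: abs_mult flip: right_diff_distrib)
        moreover have "(2::real) powi (int N) \<le> 2 powi l"
          by (intro power_int_increasing) (auto simp: l_def)
        then have "2 ^ N * \<bar>(y - x) $ i\<bar> \<le> 2 powi l * \<bar>(y - x) $ i\<bar>"
          by (intro mult_right_mono) auto
        ultimately show ?thesis by (simp add: power_one_over field_simps)
      qed
      then have "norm (y - x) \<le> (\<Sum>i\<in>(UNIV::'n set). (1/2) ^ N)"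
        using norm_le_l1_cart[of "y - x"] by (meson order_trans sum_mono)
      also have "\<dots> < e" using N by (simp add: mult.commute)
      finally show "y \<in> ball x e" by (simp add: dist_norm norm_minus_commute)
    qed
    ultimately have "P \<in> \<Psi>" using e by (auto simp: \<Psi>_def)
    with xP show "x \<in> \<Union>\<Psi>" by auto
  qed
  moreover have sub: "\<Psi> \<subseteq> grid A K" "\<Union>\<Psi> \<subseteq> Q" by (auto simp: \<Psi>_def)
  moreover have "vol (\<Union>\<Psi>) < c"
  proof -
    have "E \<union> (T - E) \<in> lmeasurable" using T Em by (intro fmeasurable.Un)
    then have "vol (\<Union>\<Psi>) \<le> vol (E \<union> (T - E))"
      using T Em sets_Union_cells[OF sub(1)]
      by (intro measure_mono_fmeasurable) (auto simp: \<Psi>_def)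
    also have "\<dots> \<le> vol E + vol (T - E)"
      using T Em by (intro measure_Un_le) auto
    finally show ?thesis using T by simp
  qed
  ultimately show ?thesis using that by blast
qed

section \<open>Weights with a quantitative \<open>A\<close>-infinity condition\<close>

lemma sets_weight_measure [simp]: "sets (weight_measure u) = sets lebesgue"
  by (simp add: weight_measure_def)

lemma space_weight_measure [simp]: "space (weight_measure u) = UNIV"
  by (simp add: weight_measure_def)

abbreviation mass :: "(real ^ 'n \<Rightarrow> real) \<Rightarrow> (real ^ 'n) set \<Rightarrow> real"
  where "mass u \<equiv> measure (weight_measure u)"

lemma sets_lebesgue_Collect: "Measurable.pred lebesgue P \<Longrightarrow> {x. P x} \<in> sets lebesgue"
  by (simp add: pred_def)

lemma emeasure_weight_measure:
  "u \<in> borel_measurable lebesgue \<Longrightarrow> E \<in> sets lebesgue \<Longrightarrow>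
    emeasure (weight_measure u) E = (\<integral>\<^sup>+x\<in>E. ennreal (u x) \<partial>lebesgue)"
  unfolding weight_measure_def by (rule emeasure_density) auto

lemma null_sets_weight_measure:
  fixes u :: "real ^ 'n \<Rightarrow> real"
  assumes "u \<in> borel_measurable lebesgue" "\<And>x. 0 < u x"
  shows "null_sets (weight_measure u) = null_sets lebesgue"
proof (rule set_eqI)
  fix A :: "(real ^ 'n) set"
  have "A \<in> null_sets (weight_measure u) \<longleftrightarrow> A \<in> sets lebesgue \<and> (AE x in lebesgue. x \<in> A \<longrightarrow> ennreal (u x) = 0)"
    unfolding weight_measure_def by (rule null_sets_density_iff) (use assms in auto)
  also have "\<dots> \<longleftrightarrow> A \<in> sets lebesgue \<and> (AE x in lebesgue. x \<notin> A)"
    using assms(2) by (simp add: ennreal_eq_0_iff flip: not_less)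
  also have "\<dots> \<longleftrightarrow> A \<in> null_sets lebesgue"
    using AE_iff_null_sets[of A lebesgue] by auto
  finally show "A \<in> null_sets (weight_measure u) \<longleftrightarrow> A \<in> null_sets lebesgue" .
qed

lemma mass_pos:
  assumes "u \<in> borel_measurable lebesgue" "\<And>x. 0 < u x" "Q \<in> sets lebesgue" "0 < vol Q"
    "emeasure (weight_measure u) Q < \<infinity>"
  shows "0 < mass u Q"
proof -
  have "Q \<notin> null_sets (weight_measure u)"
    unfolding null_sets_weight_measure[OF assms(1,2)] using assms(4) by (auto simp: null_sets_def measure_def)
  then have "emeasure (weight_measure u) Q \<noteq> 0" using assms(3) by (auto simp: null_sets_def)
  then show ?thesis
    using assms(5) by (simp add: measure_def enn2real_positive_iff less_top zero_less_iff_neq_zero)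
qed

lemma cube_lmeasurable: "Q \<in> cubes \<Longrightarrow> Q \<in> lmeasurable"
  by (elim cubeE) simp

lemma measure_cube_pos: "Q \<in> cubes \<Longrightarrow> 0 < vol Q"
  by (elim cubeE) (simp add: measure_cube del: measure_completion)

lemma cell_cube_measure:
  fixes u :: "real ^ 'n \<Rightarrow> real" and j :: "'n \<Rightarrow> int"
  assumes "u \<in> borel_measurable lebesgue" "\<And>x. 0 < u x"
  obtains Q :: "(real ^ 'n) set" where "Q \<in> cubes" "cell A k j \<subseteq> Q"
    "vol Q = vol (cell A k j)"
    "mass u Q = mass u (cell A k j)"
proof -
  let ?P = "cell A k j :: (real ^ 'n) set"
  obtain Q where Q: "Q \<in> cubes" "?P \<subseteq> Q" "negligible (Q - ?P)" by (rule cell_cube)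
  have P: "?P \<in> lmeasurable" by (rule cell_measurable)
  have null: "Q - ?P \<in> null_sets lebesgue" using Q(3) by (simp add: negligible_iff_null_sets)
  then have null': "Q - ?P \<in> null_sets (weight_measure u)"
    using null_sets_weight_measure[OF assms] by auto
  have Q_eq: "Q = ?P \<union> (Q - ?P)" using Q(2) by auto
  have "vol Q = vol ?P"
    "mass u Q = mass u ?P"
    using P emeasure_Un_null_set[OF _ null, of ?P] emeasure_Un_null_set[OF _ null', of ?P]
    unfolding measure_def by (subst Q_eq, simp)+
  with Q show ?thesis by (intro that)
qed

text \<open>
  A condition equivalent to membership in \<open>A\<close>-infinity.  It displays its constants because the proof
  applies one estimate to infinitely many weights at the same time, and only the uniformity of \<open>C\<close> and
  \<open>k\<close> keeps the resulting constant fixed.  A natural number suffices as exponent, since the ratio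
  of the volumes is at most one.
\<close>
definition quant_A_infinity :: "real \<Rightarrow> nat \<Rightarrow> (real ^ 'n \<Rightarrow> real) set"
  where "quant_A_infinity C k = {u. 1 \<le> C \<and> 0 < k \<and> u \<in> borel_measurable lebesgue \<and> (\<forall>x. 0 < u x) \<and>
    (\<forall>Q\<in>cubes. emeasure (weight_measure u) Q < \<infinity> \<and>
      (\<forall>E\<in>sets lebesgue. E \<subseteq> Q \<longrightarrow>
        vol E ^ k * mass u Q
          \<le> C * vol Q ^ k * mass u E))}"

context
  fixes u :: "real ^ 'n \<Rightarrow> real" and C :: real and k :: nat
  assumes u: "u \<in> quant_A_infinity C k"
begin

lemma quant_A_infinity_basic:
  shows "1 \<le> C" "0 < k" "u \<in> borel_measurable lebesgue" "\<And>x. 0 < u x"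
    "\<And>Q. Q \<in> cubes \<Longrightarrow> emeasure (weight_measure u) Q < \<infinity>"
  using u by (auto simp: quant_A_infinity_def)

lemma quant_A_infinity_cell:
  assumes "Q \<in> grid A K"
  shows "emeasure (weight_measure u) Q < \<infinity>" "0 < mass u Q"
    "\<And>E. E \<in> sets lebesgue \<Longrightarrow> E \<subseteq> Q \<Longrightarrow>
      vol E ^ k * mass u Q
        \<le> C * vol Q ^ k * mass u E"
proof -
  obtain l j where Q: "Q = cell A l j" using assms by (auto simp: grid_def)
  obtain R where R: "R \<in> cubes" "Q \<subseteq> R" "vol R = vol Q"
    "mass u R = mass u Q"
    using cell_cube_measure[OF quant_A_infinity_basic(3,4), of A l j] Q by metis
  have Rm: "R \<in> sets lebesgue" using cube_lmeasurable[OF R(1)] by auto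
  have Qm: "Q \<in> lmeasurable" using cell_measurable Q by auto
  show fin: "emeasure (weight_measure u) Q < \<infinity>"
    using emeasure_finite_subset[OF R(2)] Rm quant_A_infinity_basic(5)[OF R(1)] by auto
  show "0 < mass u Q"
    by (rule mass_pos[OF quant_A_infinity_basic(3,4) _ _ fin]) (use Qm in \<open>auto simp: Q measure_cell\<close>)
  fix E assume E: "E \<in> sets lebesgue" "E \<subseteq> Q"
  then show "vol E ^ k * mass u Q
        \<le> C * vol Q ^ k * mass u E"
    using u R(1,2) unfolding R(3,4)[symmetric] quant_A_infinity_def by auto
qed

text \<open>
  Applied to the complement, the defining inequality bounds the mass of a small subset of a cell
  away from the mass of the cell.
\<close>
lemma quant_A_infinity_half:
  assumes "Q \<in> grid A K" "E \<in> sets lebesgue" "E \<subseteq> Q"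
    and "vol E \<le> 1 / 2 * vol Q"
  shows "mass u E \<le> (1 - 1 / (C * 2 ^ k)) * mass u Q"
proof -
  note cl = quant_A_infinity_cell[OF assms(1)]
  have Qm: "Q \<in> lmeasurable" using assms(1) cell_measurable by (auto simp: grid_def)
  have Qu: "Q \<in> fmeasurable (weight_measure u)" using Qm cl(1) by (auto intro!: fmeasurableI)
  have pos: "0 < vol Q" using assms(1) by (auto simp: grid_def measure_cell simp del: measure_completion)
  have "1 / 2 * vol Q \<le> vol (Q - E)"
    using measurable_measure_Diff[OF Qm assms(2,3)] assms(4) by simp
  then have "(1 / 2 * vol Q) ^ k \<le> vol (Q - E) ^ k"
    by (rule power_mono) simp
  then have "(1 / 2 * vol Q) ^ k * mass u Q
      \<le> vol (Q - E) ^ k * mass u Q"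
    by (rule mult_right_mono) simp
  also have "\<dots> \<le> C * vol Q ^ k * mass u (Q - E)"
    using Qm assms(2) by (intro cl(3)) auto
  also have "mass u (Q - E) = mass u Q - mass u E"
    using Qu assms by (intro measurable_measure_Diff) auto
  finally have "vol Q ^ k * (mass u Q / 2 ^ k)
      \<le> vol Q ^ k * (C * (mass u Q - mass u E))"
    unfolding power_mult_distrib power_one_over by (simp add: ac_simps)
  then have "mass u Q / 2 ^ k
      \<le> C * (mass u Q - mass u E)"
    by (rule mult_left_le_imp_le) (use pos in simp)
  then show ?thesis
    using quant_A_infinity_basic(1) by (simp add: field_simps)
qed

end

lemma quant_A_infinity_half_of_measure:
  assumes w: "w \<in> quant_A_infinity C k" and Q: "Q \<in> grid A K" and E: "E \<in> sets lebesgue" "E \<subseteq> Q"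
    and le: "C * 2 ^ k * mass w E \<le> mass w Q"
  shows "vol E \<le> 1 / 2 * vol Q"
proof -
  note cl = quant_A_infinity_cell[OF w Q]
  have C: "1 \<le> C" "0 < k" using quant_A_infinity_basic[OF w] by auto
  have "(2 * vol E) ^ k * mass w Q
      = 2 ^ k * (vol E ^ k * mass w Q)"
    by (simp add: power_mult_distrib)
  also have "\<dots> \<le> 2 ^ k * (C * vol Q ^ k * mass w E)"
    by (intro mult_left_mono cl(3) E) simp
  also have "\<dots> = vol Q ^ k * (C * 2 ^ k * mass w E)" by simp
  also have "\<dots> \<le> vol Q ^ k * mass w Q"
    by (intro mult_left_mono le) simp
  finally have "(2 * vol E) ^ k \<le> vol Q ^ k" using cl(2) by simp
  then have "2 * vol E \<le> vol Q"
    using C by (subst (asm) power_mono_iff) auto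
  then show ?thesis by simp
qed

text \<open>
  A set that fills a small part of a cell is contained in a union of cells with almost the same
  volume, and for such unions the estimate for half of the volume can be iterated.
\<close>
lemma quant_A_infinity_decay:
  fixes w :: "real ^ 'n \<Rightarrow> real"
  assumes w: "w \<in> quant_A_infinity C k" and Q: "Q \<in> grid A K" and E: "E \<in> sets lebesgue" "E \<subseteq> Q"
    and small: "vol E < (1 / 2 / 2 ^ CARD('n)) ^ l * vol Q"
  shows "mass w E \<le> (1 - 1 / (C * 2 ^ k)) ^ l * mass w Q"
proof -
  interpret laminar_family lebesgue "grid A K" by (rule laminar_grid)
  note basic = quant_A_infinity_basic[OF w] and cl = quant_A_infinity_cell[OF w]
  have Qm: "R \<in> lmeasurable" "0 < vol R" if "R \<in> grid A K" for R
    using that cell_measurable by (auto simp: grid_def measure_cell simp del: measure_completion)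
  obtain \<Psi> where \<Psi>: "\<Psi> \<subseteq> grid A K" "E \<subseteq> \<Union>\<Psi>" "\<Union>\<Psi> \<subseteq> Q"
    "vol (\<Union>\<Psi>) < (1 / 2 / 2 ^ CARD('n)) ^ l * vol Q"
    using grid_outer_approx[OF Q E small] by auto
  have Qu: "Q \<in> fmeasurable (weight_measure w)" using Qm Q cl(1)[OF Q] by (auto intro!: fmeasurableI)
  have Um: "\<Union>\<Psi> \<in> sets lebesgue" using sets_Union_cells[OF \<Psi>(1)] .
  have "\<Union>\<Psi> \<in> fmeasurable (weight_measure w)"
    by (rule fmeasurableI2[OF Qu \<Psi>(3)]) (use Um in simp)
  then have "mass w E \<le> mass w (\<Union>\<Psi>)"
    using \<Psi>(2) E by (intro measure_mono_fmeasurable) auto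
  also have "\<dots> \<le> (1 - 1 / (C * 2 ^ k)) ^ l * mass w Q"
  proof (rule geometric_decay[where \<mu> = lebesgue and \<alpha> = "1 / 2" and D = "2 ^ CARD('n)"])
    show "sets (weight_measure w) = sets lebesgue" by simp
    show "emeasure lebesgue R < \<infinity>" "0 < vol R"
      "emeasure (weight_measure w) R < \<infinity>" if "R \<in> grid A K" for R
      using fmeasurableD2[OF Qm(1)[OF that]] Qm(2)[OF that] cl(1)[OF that]
      by (metis infinity_ennreal_def less_top)+
    have "1 \<le> C * 2 ^ k" using mult_mono[of 1 C 1 "2 ^ k"] basic by auto
    then have "1 / (C * 2 ^ k) \<le> 1" by (simp add: divide_le_eq_1)
    then show "0 \<le> 1 - 1 / (C * 2 ^ k)" by simp
    show "vol (\<Union>\<Psi>) \<le> (1 / 2 / 2 ^ CARD('n)) ^ l * vol Q"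
      using \<Psi>(4) by simp
    show "mass w S \<le> (1 - 1 / (C * 2 ^ k)) * mass w R"
      if "R \<in> grid A K" "S \<in> sets lebesgue" "S \<subseteq> R"
        "vol S \<le> 1 / 2 * vol R" for R S
      using that by (rule quant_A_infinity_half[OF w])
    show "\<exists>P\<in>grid A K. R \<subset> P \<and> P \<subseteq> S \<and> vol P \<le> 2 ^ CARD('n) * vol R"
      if "R \<in> grid A K" "S \<in> grid A K" "R \<subset> S" for R S
      using that by (rule grid_parent)
  qed (use \<Psi>(1,3) Q in simp_all)
  finally show ?thesis .
qed

text \<open>
  The hypotheses of the abstract theorem hold with constants that depend only on those of \<open>w\<close> and of
  \<open>u = w V\<close>.  If \<open>L\<close> is the part of \<open>Q\<close> where \<open>V x\<close> is below the fraction \<open>a * b * r ^ l\<close> of its average, then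
  the mass of \<open>L\<close> under \<open>u\<close> is at most this fraction of the mass of \<open>Q\<close>.  By the condition on \<open>u\<close> the
  volume of \<open>L\<close> is a small fraction of that of \<open>Q\<close>, so the mass of \<open>L\<close> under \<open>w\<close> decays like \<open>q ^ l\<close>;
  integrating the bound on \<open>V\<close> over \<open>L\<close> once more gives both factors.
\<close>
theorem dyadic_mixed_weak_type:
  fixes w :: "real ^ 'n \<Rightarrow> real"
  assumes w: "w \<in> quant_A_infinity C k"
  obtains B :: real where "0 < B"
    "\<And>V A K \<nu>. V \<in> borel_measurable lebesgue \<Longrightarrow> (\<And>x. 0 < V x) \<Longrightarrow>
      (\<lambda>x. w x * V x) \<in> quant_A_infinity D h \<Longrightarrow> sets \<nu> = sets lebesgue \<Longrightarrow>
      emeasure (weight_measure (\<lambda>x. w x * V x))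
        {x. \<exists>Q\<in>grid A K. x \<in> Q \<and> ennreal (V x * mass w Q) < emeasure \<nu> Q}
        \<le> ennreal B * emeasure \<nu> UNIV"
proof -
  define a where "a = C * 2 ^ k"
  define q where "q = 1 - 1 / (C * 2 ^ k)"
  define \<theta> where "\<theta> = 1 - 1 / (D * 2 ^ h)"
  define \<gamma> :: real where "\<gamma> = 1 / 2 / 2 ^ CARD('n)"
  define r where "r = \<gamma> ^ h"
  \<comment> \<open>With this \<open>b\<close> and \<open>r = \<gamma> ^ h\<close> the set \<open>L\<close> below satisfies \<open>(vol L / vol Q) ^ h \<le> (\<gamma> ^ l) ^ h / 2\<close>; the
    factor two makes the resulting inequality strict.\<close>
  define b where "b = 1 / (2 * D * a)"
  define B where "B = 1 / b + a / (r * (1 - \<theta>) * (1 - q))"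
  note basic = quant_A_infinity_basic[OF w]
  have "(1::real) \<le> 2 ^ CARD('n)" by simp
  then have "(1::real) < 2 * 2 ^ CARD('n)" by linarith
  then have \<gamma>: "0 < \<gamma>" "\<gamma> < 1" by (auto simp: \<gamma>_def divide_less_eq)
  have a: "1 \<le> a" unfolding a_def using mult_mono[of 1 C 1 "2 ^ k"] basic by auto
  have q: "0 \<le> q" "q < 1" using a by (auto simp: q_def a_def[symmetric])
  have key: "emeasure (weight_measure (\<lambda>x. w x * V x))
        {x. \<exists>Q\<in>grid A K. x \<in> Q \<and> ennreal (V x * mass w Q) < emeasure \<nu> Q}
        \<le> ennreal B * emeasure \<nu> UNIV"
    and "1 \<le> D" "0 < h"
    if V: "V \<in> borel_measurable lebesgue" "\<And>x. 0 < V x"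
      and u: "(\<lambda>x. w x * V x) \<in> quant_A_infinity D h" and \<nu>: "sets \<nu> = sets lebesgue" for V A K \<nu>
  proof -
    let ?W = "weight_measure w" and ?U = "weight_measure (\<lambda>x. w x * V x)"
    interpret laminar_family lebesgue "grid A K :: (real ^ 'n) set set" by (rule laminar_grid)
    show D: "1 \<le> D" "0 < h" using quant_A_infinity_basic[OF u] by auto
    have b: "0 < b" using D a by (simp add: b_def)
    have \<theta>: "\<theta> < 1" using D by (simp add: \<theta>_def)
    have r: "0 < r" "r < 1" using \<gamma> D by (auto simp: r_def power_less_one_iff)
    have U_eq: "?U = density ?W (\<lambda>x. ennreal (V x))"
      unfolding weight_measure_def using basic V
      by (subst density_density_eq) (auto intro!: density_cong simp: ennreal_mult' less_imp_le)
    have low: "measure ?U {x \<in> Q. V x * measure ?W Q < a * (b * r ^ l) * measure ?U Q}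
        \<le> a * (b * r ^ l) * q ^ l * measure ?U Q" if Q: "Q \<in> grid A K" for Q l
    proof -
      define L where "L = {x \<in> Q. V x * measure ?W Q < a * (b * r ^ l) * measure ?U Q}"
      define c where "c = a * (b * r ^ l) * measure ?U Q / measure ?W Q"
      note clW = quant_A_infinity_cell[OF w Q] and clU = quant_A_infinity_cell[OF u Q]
      have Qm: "Q \<in> lmeasurable" "0 < vol Q"
        using Q cell_measurable by (auto simp: grid_def measure_cell simp del: measure_completion)
      have c: "0 \<le> c" using a b r by (auto simp: c_def)
      have "L = {x \<in> space lebesgue. V x * measure ?W Q < a * (b * r ^ l) * measure ?U Q} \<inter> Q"
        by (auto simp: L_def)
      also have "\<dots> \<in> sets lebesgue"
        using V Qm by (intro sets.Int) (measurable, auto)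
      finally have L: "L \<in> sets lebesgue" "L \<subseteq> Q" by (auto simp: L_def)
      have WL: "emeasure ?W L < \<infinity>" "emeasure ?U L < \<infinity>"
        using emeasure_finite_subset[OF L(2), of ?W] emeasure_finite_subset[OF L(2), of ?U]
          Qm clW(1) clU(1) by auto
      have "emeasure ?U L = (\<integral>\<^sup>+x\<in>L. ennreal (V x) \<partial>?W)"
        unfolding U_eq using V L by (subst emeasure_density) (auto simp: weight_measure_def)
      also have "\<dots> \<le> (\<integral>\<^sup>+x\<in>L. ennreal c \<partial>?W)"
        using clW(2) by (intro nn_integral_mono)
          (auto simp: L_def c_def indicator_def pos_le_divide_eq intro!: ennreal_leI)
      also have "\<dots> = ennreal c * emeasure ?W L" using L by (subst nn_integral_cmult_indicator) auto
      finally have "measure ?U L \<le> c * measure ?W L"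
        using WL c by (simp add: emeasure_eq_ennreal_measure less_top flip: ennreal_mult)
      then have 1: "measure ?U L * measure ?W Q \<le> a * (b * r ^ l) * measure ?U Q * measure ?W L"
        using clW(2) by (simp add: c_def field_simps)
      have "measure ?W L \<le> measure ?W Q"
        using L Qm clW(1) by (intro measure_mono_fmeasurable) (auto intro!: fmeasurableI)
      then have "a * (b * r ^ l) * measure ?U Q * measure ?W L
          \<le> a * (b * r ^ l) * measure ?U Q * measure ?W Q"
        using a b r by (intro mult_left_mono) auto
      with 1 have "measure ?U L * measure ?W Q \<le> a * (b * r ^ l) * measure ?U Q * measure ?W Q"
        by simp
      then have 2: "measure ?U L \<le> a * (b * r ^ l) * measure ?U Q" using clW(2) by simp
      have "vol L ^ h * measure ?U Q \<le> D * vol Q ^ h * measure ?U L"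
        by (rule clU(3)[OF L])
      also have "\<dots> \<le> D * vol Q ^ h * (a * (b * r ^ l) * measure ?U Q)"
        using D by (intro mult_left_mono 2) auto
      also have "\<dots> = measure ?U Q * ((1 / 2) * (\<gamma> ^ l * vol Q) ^ h)"
        using D a by (simp add: b_def r_def power_mult_distrib power_mult[symmetric] mult.commute)
      finally have "vol L ^ h \<le> (1 / 2) * (\<gamma> ^ l * vol Q) ^ h"
        using clU(2) by (simp add: mult.commute)
      also have "\<dots> < (\<gamma> ^ l * vol Q) ^ h" using \<gamma> Qm by simp
      finally have "vol L < \<gamma> ^ l * vol Q"
        by (rule power_less_imp_less_base) (use \<gamma> Qm in auto)
      then have "measure ?W L \<le> q ^ l * measure ?W Q"
        unfolding q_def \<gamma>_def by (rule quant_A_infinity_decay[OF w Q L])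
      then have "a * (b * r ^ l) * measure ?U Q * measure ?W L
          \<le> a * (b * r ^ l) * measure ?U Q * (q ^ l * measure ?W Q)"
        using a b r by (intro mult_left_mono) auto
      with 1 have "measure ?U L * measure ?W Q
          \<le> (a * (b * r ^ l) * q ^ l * measure ?U Q) * measure ?W Q"
        by (simp add: ac_simps)
      then show ?thesis using clW(2) by (simp add: L_def)
    qed
    have "emeasure ?U {x. \<exists>Q\<in>grid A K. x \<in> Q \<and> ennreal (V x * measure ?W Q) < emeasure \<nu> Q}
        \<le> ennreal (1 / b + a / (r * (1 - \<theta>) * (1 - q))) * emeasure \<nu> (space lebesgue)"
    proof (rule mixed_weak_type[OF _ _ \<nu> V(1) less_imp_le[OF V(2)] quant_A_infinity_cell(1)[OF w]
          quant_A_infinity_cell(1)[OF u] quant_A_infinity_cell(2)[OF w] quant_A_infinity_cell(2)[OF u]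
          order_less_le_trans[OF zero_less_one a] b \<theta> r q _ low])
      fix Q E assume Q: "Q \<in> grid A K" and E: "E \<in> sets lebesgue" "E \<subseteq> Q"
        and le: "a * measure ?W E \<le> measure ?W Q"
      have "vol E \<le> 1 / 2 * vol Q"
        by (rule quant_A_infinity_half_of_measure[OF w Q E]) (use le in \<open>simp add: a_def\<close>)
      then show "measure ?U E \<le> \<theta> * measure ?U Q"
        unfolding \<theta>_def by (rule quant_A_infinity_half[OF u Q E])
    qed simp_all
    then show "emeasure ?U {x. \<exists>Q\<in>grid A K. x \<in> Q \<and> ennreal (V x * measure ?W Q) < emeasure \<nu> Q}
        \<le> ennreal B * emeasure \<nu> UNIV" by (simp add: B_def)
  qed
  show ?thesis
  proof (rule that[of "max 1 B"])
    fix V :: "real ^ 'n \<Rightarrow> real" and A :: "'n set" and K and \<nu> :: "(real ^ 'n) measure"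
    assume *: "V \<in> borel_measurable lebesgue" "\<And>x. 0 < V x"
      "(\<lambda>x. w x * V x) \<in> quant_A_infinity D h" "sets \<nu> = sets lebesgue"
    show "emeasure (weight_measure (\<lambda>x. w x * V x))
        {x. \<exists>Q\<in>grid A K. x \<in> Q \<and> ennreal (V x * mass w Q) < emeasure \<nu> Q}
        \<le> ennreal (max 1 B) * emeasure \<nu> UNIV"
      by (rule order_trans[OF key(1)[OF *]]) (intro mult_right_mono ennreal_leI, auto)
  qed simp
qed

section \<open>Muckenhoupt weights and restricted Muckenhoupt weights\<close>

lemma weight_measurable:
  fixes w :: "real ^ 'n \<Rightarrow> real"
  assumes "weight w" shows "w \<in> borel_measurable lebesgue"
proof (rule borel_measurable_LIMSEQ_real)
  let ?B = "\<lambda>k::nat. cbox (\<chi> i. - real k) (\<chi> i. real k) :: (real ^ 'n) set"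
  show "(\<lambda>x. indicator (?B k) x *\<^sub>R w x) \<in> borel_measurable lebesgue" for k
    using assms unfolding weight_def set_integrable_def
    by (intro borel_measurable_integrable) auto
  fix x :: "real ^ 'n"
  obtain k0 :: nat where k0: "norm x \<le> real k0" using real_arch_simple by blast
  have "x \<in> ?B k" if "k0 \<le> k" for k
  proof -
    have "\<bar>x $ i\<bar> \<le> real k" for i
      using component_le_norm_cart[of x i] k0 that by linarith
    then show ?thesis by (auto simp: mem_box_cart abs_le_iff minus_le_iff)
  qed
  then have "eventually (\<lambda>k. indicator (?B k) x *\<^sub>R w x = w x) sequentially"
    unfolding eventually_sequentially by (intro exI[of _ k0]) auto
  then show "(\<lambda>k. indicator (?B k) x *\<^sub>R w x) \<longlonglongrightarrow> w x"
    by (rule tendsto_eventually)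
qed

lemma weight_finite:
  assumes w: "weight w" and Q: "Q \<in> cubes"
  shows "emeasure (weight_measure w) Q < \<infinity>"
proof -
  have Qc: "compact Q" "Q \<in> sets lebesgue"
    using Q cube_lmeasurable by (auto elim: cubeE)
  then have "integrable lebesgue (\<lambda>x. indicator Q x *\<^sub>R w x)"
    using w by (auto simp: weight_def set_integrable_def)
  then have "(\<integral>\<^sup>+x. ennreal (norm (indicator Q x *\<^sub>R w x)) \<partial>lebesgue) < \<infinity>"
    by (simp add: integrable_iff_bounded)
  also have "(\<integral>\<^sup>+x. ennreal (norm (indicator Q x *\<^sub>R w x)) \<partial>lebesgue) = (\<integral>\<^sup>+x\<in>Q. ennreal (w x) \<partial>lebesgue)"
    using w by (intro nn_integral_cong) (auto simp: weight_def indicator_def less_imp_le)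
  finally show ?thesis using emeasure_weight_measure[OF weight_measurable[OF w] Qc(2)] by simp
qed

lemma weight_measure_cube_pos:
  assumes "u \<in> borel_measurable lebesgue" "\<And>x. 0 < u x" "Q \<in> cubes"
    "emeasure (weight_measure u) Q < \<infinity>"
  shows "0 < mass u Q"
  using cube_lmeasurable[OF assms(3)] by (intro mass_pos assms measure_cube_pos) auto

lemma weight_subset_finite:
  assumes "weight u" "Q \<in> cubes" "E \<in> sets lebesgue" "E \<subseteq> Q"
  shows "emeasure (weight_measure u) E = ennreal (mass u E)" "emeasure lebesgue E = ennreal (vol E)"
proof -
  have "emeasure (weight_measure u) E < \<infinity>"
    using emeasure_finite_subset[OF assms(4) _ weight_finite[OF assms(1,2)]]
      cube_lmeasurable[OF assms(2)] by auto
  then show "emeasure (weight_measure u) E = ennreal (mass u E)"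
    by (simp add: emeasure_eq_ennreal_measure less_top)
  show "emeasure lebesgue E = ennreal (vol E)"
    using fmeasurableI2[OF cube_lmeasurable[OF assms(2)] assms(4,3)] by (rule emeasure_eq_measure2)
qed

text \<open>
  Rounding a real exponent up is harmless, because the ratio of the volumes is at most one.
\<close>
lemma quant_A_infinityI_powr:
  assumes w: "weight w" and q: "1 \<le> q"
    and le: "\<And>Q E. Q \<in> cubes \<Longrightarrow> E \<in> sets lebesgue \<Longrightarrow> E \<subseteq> Q \<Longrightarrow> 0 < vol E \<Longrightarrow>
      (vol E / vol Q) powr q * mass w Q
        \<le> C * mass w E"
  shows "w \<in> quant_A_infinity (max 1 C) (nat \<lceil>q\<rceil>)"
proof -
  define k where "k = nat \<lceil>q\<rceil>"
  have k: "q \<le> real k" "0 < k" using q by (auto simp: k_def) 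
  have "vol E ^ k * mass w Q
      \<le> max 1 C * vol Q ^ k * mass w E"
    if Q: "Q \<in> cubes" and E: "E \<in> sets lebesgue" "E \<subseteq> Q" for Q E
  proof (cases "vol E = 0")
    case True
    then show ?thesis using k by (auto simp: zero_power intro!: mult_nonneg_nonneg)
  next
    case False
    then have pos: "0 < vol E" by (simp add: zero_less_measure_iff)
    define t where "t = vol E / vol Q"
    note Qp = measure_cube_pos[OF Q]
    have "vol E \<le> vol Q"
      using E cube_lmeasurable[OF Q] by (intro measure_mono_fmeasurable) auto
    then have t: "0 < t" "t \<le> 1" using pos Qp by (auto simp: t_def)
    have "t ^ k = t powr real k" using t by (simp add: powr_realpow)
    also have "\<dots> \<le> t powr q" using t k by (intro powr_mono') auto
    finally have "t ^ k * mass w Q \<le> t powr q * mass w Q"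
      by (rule mult_right_mono) simp
    also have "\<dots> \<le> C * mass w E" unfolding t_def by (rule le[OF Q E pos])
    also have "\<dots> \<le> max 1 C * mass w E" by (intro mult_right_mono) auto
    finally show ?thesis using Qp by (simp add: t_def power_divide field_simps)
  qed
  then show ?thesis
    using weight_measurable[OF w] weight_finite[OF w] w k
    by (auto simp: quant_A_infinity_def weight_def k_def)
qed

lemma ennreal_dyadic_layers:
  fixes g y0 :: real
  assumes "0 < y0"
  shows "ennreal g \<le> ennreal y0 + (\<Sum>k. ennreal (2 ^ Suc k * y0) * indicator {2 ^ k * y0 <..} g)"
proof (cases "g \<le> y0")
  case True
  then show ?thesis by (intro order_trans[OF ennreal_leI add_increasing2]) auto
next
  case False
  have "\<exists>n. g \<le> 2 ^ n * y0"
    using real_arch_pow[of 2 "g / y0"] assms by (auto simp: divide_less_eq intro: less_imp_le)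
  define n where "n = (LEAST n. g \<le> 2 ^ n * y0)"
  have n: "g \<le> 2 ^ n * y0" unfolding n_def by (rule LeastI_ex) fact
  have "n \<noteq> 0" using n False by (intro notI) auto
  then obtain k where k: "n = Suc k" by (cases n) auto
  have "\<not> g \<le> 2 ^ k * y0" using not_less_Least[of k "\<lambda>n. g \<le> 2 ^ n * y0"] k by (simp add: n_def)
  define f where "f k = ennreal (2 ^ Suc k * y0) * indicator {2 ^ k * y0 <..} g" for k
  have "ennreal g \<le> f k"
    using n k \<open>\<not> g \<le> 2 ^ k * y0\<close> by (auto simp: f_def intro!: ennreal_leI)
  also have "\<dots> \<le> (\<Sum>k. f k)"
    using sum_le_suminf[OF summableI, of "{k}" f] by simp
  finally show ?thesis unfolding f_def by (rule add_increasing[OF zero_le])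
qed

definition kolmogorov_const :: "real \<Rightarrow> real"
  where "kolmogorov_const q = 1 + 2 / (1 - 2 powr (1 - q))"

lemma kolmogorov_const_pos: "1 < q \<Longrightarrow> 0 < kolmogorov_const q"
  using powr_less_mono[of "1 - q" 0 "2::real"] by (simp add: kolmogorov_const_def add_pos_nonneg)

text \<open>
  Kolmogorov's inequality.  Below the height \<open>N (\<mu> F) powr (- 1 / q)\<close> the function is bounded
  trivially; above it, the weak-type bound on the dyadic layers sums to a geometric series.
\<close>
lemma kolmogorov_inequality:
  fixes g :: "'a \<Rightarrow> real"
  assumes g: "g \<in> borel_measurable \<mu>" and F: "F \<in> sets \<mu>" "emeasure \<mu> F < \<infinity>"
    and q: "1 < q" and N: "0 < N"
    and weak: "\<And>y. 0 < y \<Longrightarrow> emeasure \<mu> {x \<in> space \<mu>. y < g x} \<le> ennreal ((N / y) powr q)"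
  shows "(\<integral>\<^sup>+x\<in>F. ennreal (g x) \<partial>\<mu>) \<le> ennreal (kolmogorov_const q * N * measure \<mu> F powr (1 - 1 / q))"
proof (cases "measure \<mu> F = 0")
  case True
  then have "F \<in> null_sets \<mu>" using F by (auto simp: null_sets_def emeasure_eq_ennreal_measure less_top)
  then have "(\<integral>\<^sup>+x\<in>F. ennreal (g x) \<partial>\<mu>) = 0" by (rule nn_integral_null_set)
  then show ?thesis by simp
next
  case False
  define m where "m = measure \<mu> F"
  have m: "0 < m" using False by (simp add: m_def zero_less_measure_iff)
  have Fm: "emeasure \<mu> F = ennreal m" using F by (simp add: m_def emeasure_eq_ennreal_measure less_top)
  define y0 where "y0 = N * m powr (- (1 / q))"
  have y0: "0 < y0" using N m by (simp add: y0_def)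
  define r where "r = (2::real) powr (1 - q)"
  have r: "0 < r" "r < 1" using q powr_less_mono[of "1 - q" 0 "2::real"] by (auto simp: r_def)
  define L where "L k = {x \<in> space \<mu>. 2 ^ k * y0 < g x}" for k :: nat
  have L: "L k \<in> sets \<mu>" for k unfolding L_def using g by measurable
  define c where "c k = 2 * (2 ^ k * y0)" for k :: nat
  have "(\<integral>\<^sup>+x\<in>F. ennreal (g x) \<partial>\<mu>)
      \<le> (\<integral>\<^sup>+x. ennreal y0 * indicator F x + (\<Sum>k. ennreal (c k) * indicator (L k) x) \<partial>\<mu>)"
  proof (rule nn_integral_mono)
    fix x assume x: "x \<in> space \<mu>"
    have ind: "indicator {2 ^ k * y0 <..} (g x) = (indicator (L k) x :: ennreal)" for k
      using x by (auto simp: L_def indicator_def)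
    show "ennreal (g x) * indicator F x \<le> ennreal y0 * indicator F x + (\<Sum>k. ennreal (c k) * indicator (L k) x)"
      using ennreal_dyadic_layers[OF y0, of "g x"] unfolding ind
      by (auto simp: indicator_def c_def mult.assoc split: if_splits)
  qed
  also have "\<dots> = ennreal y0 * emeasure \<mu> F + (\<Sum>k. ennreal (c k) * emeasure \<mu> (L k))"
    using F L by (subst nn_integral_add) (auto simp: nn_integral_suminf nn_integral_cmult_indicator)
  also have "(\<Sum>k. ennreal (c k) * emeasure \<mu> (L k)) \<le> (\<Sum>k. ennreal (2 * y0 * (N / y0) powr q * r ^ k))"
  proof (intro suminf_le)
    fix k :: nat
    have p: "0 < 2 ^ k * y0" using y0 by simp
    have "ennreal (c k) * emeasure \<mu> (L k) \<le> ennreal (c k) * ennreal ((N / (2 ^ k * y0)) powr q)"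
      unfolding L_def by (intro mult_left_mono weak p) auto
    also have "\<dots> = ennreal (c k * (N / (2 ^ k * y0)) powr q)"
      using p by (simp add: c_def flip: ennreal_mult)
    also have "(N / (2 ^ k * y0)) powr q = (N / y0) powr q / (2 ^ k) powr q"
      using N y0 by (simp add: powr_divide powr_mult field_simps)
    also have "c k * ((N / y0) powr q / (2 ^ k) powr q) = 2 * y0 * (N / y0) powr q * r ^ k"
    proof -
      have "r ^ k = 2 powr (real k * (1 - q))" by (simp add: r_def powr_power mult.commute)
      also have "\<dots> = 2 ^ k / (2 ^ k) powr q"
        by (simp add: right_diff_distrib powr_diff powr_powr flip: powr_realpow)
      finally show ?thesis by (simp add: c_def)
    qed
    finally show "ennreal (c k) * emeasure \<mu> (L k) \<le> ennreal (2 * y0 * (N / y0) powr q * r ^ k)" .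
  qed auto
  also have "\<dots> = ennreal (\<Sum>k. 2 * y0 * (N / y0) powr q * r ^ k)"
    using r y0 by (intro suminf_ennreal2 summable_mult summable_geometric) auto
  also have "(\<Sum>k. 2 * y0 * (N / y0) powr q * r ^ k) = 2 * y0 * (N / y0) powr q / (1 - r)"
    using r by (subst suminf_mult) (auto simp: suminf_geometric summable_geometric)
  also have "N / y0 = m powr (1 / q)"
    using N m by (simp add: y0_def powr_minus divide_inverse)
  also have "(m powr (1 / q)) powr q = m" using m q by (simp add: powr_powr)
  also have "ennreal y0 * emeasure \<mu> F + ennreal (2 * y0 * m / (1 - r))
      = ennreal (y0 * m + 2 * y0 * m / (1 - r))"
    using y0 m r by (simp add: Fm flip: ennreal_mult ennreal_plus)
  also have "y0 * m + 2 * y0 * m / (1 - r) = kolmogorov_const q * (y0 * m)"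
    by (simp add: kolmogorov_const_def r_def algebra_simps)
  also have "y0 * m = N * m powr (1 - 1 / q)"
    using m by (simp add: y0_def powr_diff powr_minus divide_inverse)
  finally show ?thesis by (simp add: m_def mult.assoc add_left_mono)
qed

lemma weak_type_of_ennreal_power:
  assumes "0 < y" "0 < q" "0 \<le> N" "ennreal y * ennreal_power D (1 / q) \<le> ennreal N"
  shows "D \<le> ennreal ((N / y) powr q)"
proof (cases "D = \<infinity>")
  case True
  then have "ennreal y * ennreal_power D (1 / q) = \<infinity>"
    using assms by (simp add: ennreal_power_def ennreal_mult_top)
  with assms(4) show ?thesis by (simp add: top_unique)
next
  case False
  then obtain d where d: "D = ennreal d" "0 \<le> d" by (cases D) auto
  then have "ennreal (y * d powr (1 / q)) \<le> ennreal N"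
    using assms False by (simp add: ennreal_power_def ennreal_mult)
  then have "d powr (1 / q) \<le> N / y" using assms by (simp add: field_simps)
  then have "(d powr (1 / q)) powr q \<le> (N / y) powr q"
    using assms by (intro powr_mono2) auto
  then show ?thesis using assms d by (simp add: powr_powr ennreal_leI)
qed

lemma A_R_weak_norm:
  fixes w :: "real ^ 'n \<Rightarrow> real"
  assumes w: "w \<in> A_R_class p" and p: "1 \<le> p"
  obtains A :: real where "0 < A" "\<And>Q. Q \<in> cubes \<Longrightarrow>
    weak_norm (conjugate_exponent p) (weight_measure w) (\<lambda>x. indicator Q x * ennreal (inverse (w x)))
      \<le> ennreal (A * vol Q / mass w Q powr (1 / p))"
proof -
  have wt: "weight w" and fin: "A_R_constant p w < \<infinity>" using w by (auto simp: A_R_class_def)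
  define A where "A = max 1 (enn2real (A_R_constant p w))"
  have A: "0 < A" "A_R_constant p w \<le> ennreal A"
  proof -
    have "A_R_constant p w = ennreal (enn2real (A_R_constant p w))" using fin by (simp add: less_top)
    also have "\<dots> \<le> ennreal A" unfolding A_def by (intro ennreal_leI) simp
    finally show "A_R_constant p w \<le> ennreal A" .
  qed (simp add: A_def)
  show ?thesis
  proof (rule that[OF A(1)])
    fix Q :: "(real ^ 'n) set" assume Q: "Q \<in> cubes"
    define N where "N = weak_norm (conjugate_exponent p) (weight_measure w)
      (\<lambda>x. indicator Q x * ennreal (inverse (w x)))"
    have Wf: "emeasure (weight_measure w) Q < \<infinity>" by (rule weight_finite[OF wt Q])
    define m where "m = mass w Q"
    have m: "0 < m" unfolding m_def using wt weight_measurable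
      by (intro weight_measure_cube_pos Q Wf) (auto simp: weight_def)
    note Qp = measure_cube_pos[OF Q]
    have leb: "emeasure lebesgue Q = ennreal (vol Q)"
      by (rule emeasure_eq_measure2[OF cube_lmeasurable[OF Q]])
    have "ennreal_power (emeasure (weight_measure w) Q) (1 / p) * N / emeasure lebesgue Q \<le> A_R_constant p w"
      unfolding A_R_constant_def N_def by (rule SUP_upper[OF Q])
    moreover have "ennreal_power (emeasure (weight_measure w) Q) (1 / p) = ennreal (m powr (1 / p))"
      using Wf by (auto simp: ennreal_power_def m_def measure_def)
    ultimately have "ennreal (m powr (1 / p)) * N / ennreal (vol Q) \<le> ennreal A"
      unfolding leb using A(2) by (metis order_trans)
    then have "ennreal (m powr (1 / p)) * N / ennreal (vol Q) * ennreal (vol Q)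
        \<le> ennreal A * ennreal (vol Q)"
      by (rule mult_right_mono) simp
    also have "ennreal (m powr (1 / p)) * N / ennreal (vol Q) * ennreal (vol Q)
        = ennreal (m powr (1 / p)) * N"
      using Qp by (simp add: ennreal_divide_times ennreal_divide_self del: measure_completion)
    also have "ennreal A * ennreal (vol Q)
        = ennreal (m powr (1 / p)) * ennreal (A * vol Q / m powr (1 / p))"
      using A m by (simp flip: ennreal_mult)
    finally show "N \<le> ennreal (A * vol Q / m powr (1 / p))"
      using m by (subst (asm) ennreal_mult_le_mult_iff) auto
  qed
qed

lemma nn_integral_weight_measure:
  assumes "u \<in> borel_measurable lebesgue" "g \<in> borel_measurable lebesgue"
  shows "(\<integral>\<^sup>+x. g x \<partial>weight_measure u) = (\<integral>\<^sup>+x. ennreal (u x) * g x \<partial>lebesgue)"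
  unfolding weight_measure_def using assms by (intro nn_integral_density) auto

text \<open>
  For the exponent one the weak norm is an essential supremum, so \<open>inverse (w x)\<close> is bounded almost
  everywhere on \<open>Q\<close> and can be inserted under the integral.
\<close>
lemma A_R_1_average:
  fixes w :: "real ^ 'n \<Rightarrow> real"
  assumes w: "w \<in> A_R_class 1"
  obtains A :: real where "0 < A" "\<And>Q g. Q \<in> cubes \<Longrightarrow> g \<in> borel_measurable lebesgue \<Longrightarrow>
    (\<integral>\<^sup>+x\<in>Q. g x \<partial>lebesgue)
      \<le> ennreal (A * vol Q / mass w Q) * (\<integral>\<^sup>+x\<in>Q. g x \<partial>weight_measure w)"
proof -
  obtain A where A: "0 < A" "\<And>Q. Q \<in> cubes \<Longrightarrow>
    weak_norm (conjugate_exponent 1) (weight_measure w) (\<lambda>x. indicator Q x * ennreal (inverse (w x)))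
      \<le> ennreal (A * vol Q / mass w Q powr (1 / 1))"
    by (rule A_R_weak_norm[OF w order_refl]) blast
  have wt: "weight w" using w by (auto simp: A_R_class_def)
  have wp: "0 < w x" for x using wt by (auto simp: weight_def)
  have wm [measurable]: "w \<in> borel_measurable lebesgue" by (rule weight_measurable[OF wt])
  show ?thesis
  proof (rule that[OF A(1)])
    fix Q :: "(real ^ 'n) set" and g :: "real ^ 'n \<Rightarrow> ennreal"
    assume Q: "Q \<in> cubes" and g [measurable]: "g \<in> borel_measurable lebesgue"
    define c where "c = A * vol Q / mass w Q"
    have Qm [measurable]: "Q \<in> sets lebesgue" using cube_lmeasurable[OF Q] by auto
    have le: "esssup (weight_measure w) (\<lambda>x. indicator Q x * ennreal (inverse (w x))) \<le> ennreal c"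
      using A(2)[OF Q] by (simp add: weak_norm_def conjugate_exponent_def c_def)
    have "AE x in weight_measure w. indicator Q x * ennreal (inverse (w x))
        \<le> esssup (weight_measure w) (\<lambda>x. indicator Q x * ennreal (inverse (w x)))"
      by (rule esssup_AE)
    then have "AE x in weight_measure w. indicator Q x * ennreal (inverse (w x)) \<le> ennreal c"
    proof eventually_elim
      case (elim x)
      then show ?case using le by (rule order_trans)
    qed
    then have "AE x in lebesgue. indicator Q x * ennreal (inverse (w x)) \<le> ennreal c"
      unfolding weight_measure_def using wp by (subst (asm) AE_density) auto
    then have "(\<integral>\<^sup>+x\<in>Q. g x \<partial>lebesgue) \<le> (\<integral>\<^sup>+x. ennreal c * (ennreal (w x) * (g x * indicator Q x)) \<partial>lebesgue)"
    proof (intro nn_integral_mono_AE, elim AE_mp, intro AE_I2 impI)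
      fix x assume le: "indicator Q x * ennreal (inverse (w x)) \<le> ennreal c"
      show "g x * indicator Q x \<le> ennreal c * (ennreal (w x) * (g x * indicator Q x))"
      proof (cases "x \<in> Q")
        case True
        have "1 = ennreal (inverse (w x)) * ennreal (w x)"
          using wp[of x] by (simp flip: ennreal_mult)
        also have "\<dots> \<le> ennreal c * ennreal (w x)"
          using le True by (intro mult_right_mono) auto
        finally have "1 * g x \<le> (ennreal c * ennreal (w x)) * g x" by (rule mult_right_mono) simp
        then show ?thesis using True by (simp add: mult.assoc)
      qed simp
    qed
    also have "\<dots> = ennreal c * (\<integral>\<^sup>+x. ennreal (w x) * (g x * indicator Q x) \<partial>lebesgue)"
      by (rule nn_integral_cmult) measurable
    also have "(\<integral>\<^sup>+x. ennreal (w x) * (g x * indicator Q x) \<partial>lebesgue) = (\<integral>\<^sup>+x\<in>Q. g x \<partial>weight_measure w)"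
      by (rule nn_integral_weight_measure[symmetric]) measurable
    finally show "(\<integral>\<^sup>+x\<in>Q. g x \<partial>lebesgue)
      \<le> ennreal (A * vol Q / mass w Q) * (\<integral>\<^sup>+x\<in>Q. g x \<partial>weight_measure w)"
      by (simp add: c_def)
  qed
qed

text \<open>
  The volume of \<open>E\<close> is the integral of \<open>inverse (w x)\<close> over \<open>E\<close> with respect to the measure \<open>w\<close>.
  For \<open>1 < p\<close> Kolmogorov's inequality bounds it by the weak norm in the definition of the class.
\<close>
lemma A_R_restricted:
  fixes w :: "real ^ 'n \<Rightarrow> real"
  assumes w: "w \<in> A_R_class p" and p: "1 \<le> p"
  obtains B :: real where "0 < B" "\<And>Q E. Q \<in> cubes \<Longrightarrow> E \<in> sets lebesgue \<Longrightarrow> E \<subseteq> Q \<Longrightarrow>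
    vol E * mass w Q powr (1 / p)
      \<le> B * vol Q * mass w E powr (1 / p)"
proof -
  have wt: "weight w" using w by (auto simp: A_R_class_def)
  have wp: "0 < w x" for x using wt by (auto simp: weight_def)
  have wm [measurable]: "w \<in> borel_measurable lebesgue" by (rule weight_measurable[OF wt])
  note fin = weight_subset_finite[OF wt]
  have Wpos: "0 < mass w Q" if "Q \<in> cubes" for Q
    by (rule weight_measure_cube_pos[OF wm wp that weight_finite[OF wt that]])
  show ?thesis
  proof (cases "p = 1")
    case True
    obtain A where A: "0 < A" "\<And>Q g. Q \<in> cubes \<Longrightarrow> g \<in> borel_measurable lebesgue \<Longrightarrow>
      (\<integral>\<^sup>+x\<in>Q. g x \<partial>lebesgue) \<le> ennreal (A * vol Q / mass w Q)
        * (\<integral>\<^sup>+x\<in>Q. g x \<partial>weight_measure w)"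
      using A_R_1_average w True by blast
    show ?thesis
    proof (rule that[OF A(1)])
      fix Q E :: "(real ^ 'n) set" assume QE: "Q \<in> cubes" "E \<in> sets lebesgue" "E \<subseteq> Q"
      have ind: "indicator E x * indicator Q x = (indicator E x :: ennreal)" for x
        using QE(3) by (auto simp: indicator_def)
      have "emeasure lebesgue E \<le> ennreal (A * vol Q / mass w Q)
          * emeasure (weight_measure w) E"
        using A(2)[OF QE(1), of "indicator E"] QE(2) by (simp add: ind)
      then have "vol E \<le> A * vol Q / mass w Q * mass w E"
        unfolding fin[OF QE] using A Wpos[OF QE(1)] by (simp flip: ennreal_mult)
      then show "vol E * mass w Q powr (1 / p)
          \<le> A * vol Q * mass w E powr (1 / p)"
        using Wpos[OF QE(1)] True by (simp add: field_simps)
    qed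
  next
    case False
    define q where "q = p / (p - 1)"
    have p1: "1 < p" using p False by simp
    then have q: "1 < q" "1 - 1 / q = 1 / p" by (auto simp: q_def field_simps)
    obtain A where A: "0 < A" "\<And>Q. Q \<in> cubes \<Longrightarrow>
      weak_norm (conjugate_exponent p) (weight_measure w) (\<lambda>x. indicator Q x * ennreal (inverse (w x)))
        \<le> ennreal (A * vol Q / mass w Q powr (1 / p))"
      by (rule A_R_weak_norm[OF w p]) blast
    show ?thesis
    proof (rule that[of "kolmogorov_const q * A"])
      show "0 < kolmogorov_const q * A" using A kolmogorov_const_pos q by auto
      fix Q E :: "(real ^ 'n) set" assume QE: "Q \<in> cubes" "E \<in> sets lebesgue" "E \<subseteq> Q"
      define N where "N = A * vol Q / mass w Q powr (1 / p)"
      have N: "0 < N" using A Wpos[OF QE(1)] measure_cube_pos[OF QE(1)] by (simp add: N_def)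
      have Qm [measurable]: "Q \<in> sets lebesgue" using cube_lmeasurable[OF QE(1)] by auto
      note Em [measurable] = QE(2)
      define g where "g x = indicator Q x * inverse (w x)" for x
      have g_enn: "indicator Q x * ennreal (inverse (w x)) = ennreal (g x)" for x
        by (auto simp: g_def indicator_def)
      have "(\<integral>\<^sup>+x\<in>E. ennreal (g x) \<partial>weight_measure w)
          \<le> ennreal (kolmogorov_const q * N * mass w E powr (1 - 1 / q))"
      proof (rule kolmogorov_inequality[OF _ _ _ q(1) N])
        show "g \<in> borel_measurable (weight_measure w)"
          unfolding g_def weight_measure_def by measurable
        show "emeasure (weight_measure w) E < \<infinity>" unfolding fin[OF QE] by simp
        fix y :: real assume y: "0 < y"
        have set_eq: "{x. ennreal y < ennreal (g x)} = {x. y < g x}"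
          using y by (auto simp: ennreal_less_iff)
        have "ennreal y * ennreal_power (emeasure (weight_measure w) {x. y < g x}) (1 / q)
            \<le> weak_norm (conjugate_exponent p) (weight_measure w) (\<lambda>x. indicator Q x * ennreal (inverse (w x)))"
          unfolding g_enn using p1 q y
          by (auto simp: weak_norm_def conjugate_exponent_def distribution_function_def set_eq
              q_def[symmetric] intro!: SUP_upper2[of y])
        also have "\<dots> \<le> ennreal N" unfolding N_def by (rule A(2)[OF QE(1)])
        finally show "emeasure (weight_measure w) {x \<in> space (weight_measure w). y < g x}
            \<le> ennreal ((N / y) powr q)"
          using weak_type_of_ennreal_power[of y q N] y q N by simp
      qed simp
      also have "(\<integral>\<^sup>+x\<in>E. ennreal (g x) \<partial>weight_measure w)
          = (\<integral>\<^sup>+x. ennreal (w x) * (ennreal (g x) * indicator E x) \<partial>lebesgue)"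
        by (rule nn_integral_weight_measure) (unfold g_def, measurable)
      also have "\<dots> = (\<integral>\<^sup>+x. indicator E x \<partial>lebesgue)"
      proof (rule nn_integral_cong)
        fix x
        have "ennreal (w x) * ennreal (inverse (w x)) = 1"
          using wp[of x] by (simp flip: ennreal_mult)
        then show "ennreal (w x) * (ennreal (g x) * indicator E x) = indicator E x"
          using QE(3) by (auto simp: g_def indicator_def)
      qed
      finally have "vol E \<le> kolmogorov_const q * N * mass w E powr (1 / p)"
        using N kolmogorov_const_pos[OF q(1)] by (simp add: fin[OF QE] q)
      then show "vol E * mass w Q powr (1 / p)
          \<le> kolmogorov_const q * A * vol Q * mass w E powr (1 / p)"
        using Wpos[OF QE(1)] by (simp add: N_def field_simps)
    qed
  qed
qed

lemma A_R_quant_A_infinity: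
  fixes w :: "real ^ 'n \<Rightarrow> real"
  assumes w: "w \<in> A_R_class p" and p: "1 \<le> p"
  obtains C k where "w \<in> quant_A_infinity C k"
proof -
  obtain B :: real where B: "0 < B" "\<And>Q E. Q \<in> cubes \<Longrightarrow> E \<in> sets lebesgue \<Longrightarrow> E \<subseteq> Q \<Longrightarrow>
    vol E * mass w Q powr (1 / p)
      \<le> B * vol Q * mass w E powr (1 / p)"
    by (rule A_R_restricted[OF w p]) blast
  have "w \<in> quant_A_infinity (max 1 (B powr p)) (nat \<lceil>p\<rceil>)"
  proof (rule quant_A_infinityI_powr[OF _ p])
    show "weight w" using w by (simp add: A_R_class_def)
    fix Q E :: "(real ^ 'n) set" assume QE: "Q \<in> cubes" "E \<in> sets lebesgue" "E \<subseteq> Q"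
    have "vol E / vol Q * mass w Q powr (1 / p)
        \<le> B * mass w E powr (1 / p)"
      using B(2)[OF QE] measure_cube_pos[OF QE(1)] by (simp add: field_simps)
    then have "(vol E / vol Q * mass w Q powr (1 / p)) powr p
        \<le> (B * mass w E powr (1 / p)) powr p"
      using p by (intro powr_mono2) auto
    moreover have "(vol E / vol Q * mass w Q powr (1 / p)) powr p
        = (vol E / vol Q) powr p * mass w Q"
      using p by (subst powr_mult) (auto simp: powr_powr)
    ultimately show "(vol E / vol Q) powr p * mass w Q
        \<le> B powr p * mass w E"
      using p B by (simp add: powr_mult powr_powr)
  qed
  then show ?thesis by (rule that)
qed

text \<open>
  For \<open>q = 1\<close> integrate the defining inequality over \<open>E\<close>.  For \<open>1 < q\<close>, on the part of \<open>E\<close> where \<open>u\<close> is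
  below a height \<open>\<tau>\<close>, the dual weight \<open>\<sigma>\<close> is at least \<open>\<tau> powr (- 1 / (q - 1))\<close>.  By Chebyshev's inequality this part has at most half of the volume of \<open>E\<close> if \<open>\<tau>\<close> is chosen
  suitably, and on the other half \<open>u\<close> is at least \<open>\<tau>\<close>.
\<close>
lemma A_class_quant_A_infinity:
  fixes u :: "real ^ 'n \<Rightarrow> real"
  assumes u: "u \<in> A_class q" and q: "1 \<le> q"
  obtains C k where "u \<in> quant_A_infinity C k"
proof -
  have wt: "weight u" using u by (auto simp: A_class_def)
  have up: "0 < u x" for x using wt by (auto simp: weight_def)
  have um [measurable]: "u \<in> borel_measurable lebesgue" by (rule weight_measurable[OF wt])
  note fin = weight_subset_finite[OF wt]
  have Upos: "0 < mass u Q" if "Q \<in> cubes" for Q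
    by (rule weight_measure_cube_pos[OF um up that weight_finite[OF wt that]])
  have avg: "average Q (\<lambda>y. ennreal (u y)) = ennreal (mass u Q / vol Q)"
    if "Q \<in> cubes" for Q
  proof -
    have Qm: "Q \<in> sets lebesgue" using cube_lmeasurable[OF that] by auto
    show ?thesis
      unfolding average_def emeasure_weight_measure[OF um Qm, symmetric] fin[OF that Qm order_refl]
      using measure_cube_pos[OF that] by (simp add: divide_ennreal)
  qed
  show ?thesis
  proof (cases "q = 1")
    case True
    then obtain C :: real where C: "\<And>Q. Q \<in> cubes \<Longrightarrow> AE x in lebesgue. x \<in> Q \<longrightarrow>
        average Q (\<lambda>y. ennreal (u y)) \<le> ennreal (C * u x)"
      using u by (auto simp: A_class_def)
    have "u \<in> quant_A_infinity (max 1 (max 0 C)) (nat \<lceil>1::real\<rceil>)"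
    proof (rule quant_A_infinityI_powr[OF wt order_refl])
      fix Q E :: "(real ^ 'n) set" assume QE: "Q \<in> cubes" "E \<in> sets lebesgue" "E \<subseteq> Q"
      note Em [measurable] = QE(2)
      define a where "a = mass u Q / vol Q"
      have a: "0 \<le> a" by (simp add: a_def)
      have "ennreal a * emeasure lebesgue E = (\<integral>\<^sup>+x\<in>E. ennreal a \<partial>lebesgue)"
        using QE by (simp add: nn_integral_cmult_indicator)
      also have "\<dots> \<le> (\<integral>\<^sup>+x. ennreal (max 0 C) * (ennreal (u x) * indicator E x) \<partial>lebesgue)"
      proof (rule nn_integral_mono_AE)
        show "AE x in lebesgue. ennreal a * indicator E x \<le> ennreal (max 0 C) * (ennreal (u x) * indicator E x)"
          using C[OF QE(1)]
        proof eventually_elim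
          case (elim x)
          show ?case
          proof (cases "x \<in> E")
            case True
            then have "ennreal a \<le> ennreal (C * u x)"
              using elim QE(3) avg[OF QE(1)] by (auto simp: a_def)
            also have "\<dots> \<le> ennreal (max 0 C * u x)"
              using up[of x] by (intro ennreal_leI mult_right_mono) auto
            also have "\<dots> = ennreal (max 0 C) * ennreal (u x)" using up[of x] by (simp add: ennreal_mult)
            finally show ?thesis using True by simp
          qed simp
        qed
      qed
      also have "\<dots> = ennreal (max 0 C) * emeasure (weight_measure u) E"
        unfolding emeasure_weight_measure[OF um QE(2)] by (intro nn_integral_cmult) measurable
      finally have "a * vol E \<le> max 0 C * mass u E"
        unfolding fin[OF QE] using a by (simp flip: ennreal_mult)
      then show "(vol E / vol Q) powr 1 * mass u Q
          \<le> max 0 C * mass u E"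
        by (simp add: a_def mult.commute)
    qed
    then show ?thesis by (rule that)
  next
    case False
    then have q1: "1 < q" using q by simp
    define s where "s = q - 1"
    have s: "0 < s" using q1 by (simp add: s_def)
    define \<sigma> where "\<sigma> x = u x powr (- (1 / s))" for x
    have \<sigma>_meas [measurable]: "\<sigma> \<in> borel_measurable lebesgue" unfolding \<sigma>_def by measurable
    have \<sigma>p: "0 < \<sigma> x" for x using up[of x] by (simp add: \<sigma>_def)
    have \<sigma>_eq: "u y powr (1 - q / (q - 1)) = \<sigma> y" for y
      using q1 by (simp add: \<sigma>_def s_def field_simps)
    define S where "S = (SUP Q\<in>cubes. average Q (\<lambda>y. ennreal (u y))
        * ennreal_power (average Q (\<lambda>y. ennreal (\<sigma> y))) s)"
    have "S < \<infinity>" using u False unfolding A_class_def S_def s_def \<sigma>_eq[symmetric] by auto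
    define K where "K = enn2real S"
    have S: "S = ennreal K" "0 \<le> K" using \<open>S < \<infinity>\<close> by (auto simp: K_def less_top)
    have "u \<in> quant_A_infinity (max 1 (K * 2 powr q)) (nat \<lceil>q\<rceil>)"
    proof (rule quant_A_infinityI_powr[OF wt q])
      fix Q E :: "(real ^ 'n) set"
      assume QE: "Q \<in> cubes" "E \<in> sets lebesgue" "E \<subseteq> Q" and Epos: "0 < vol E"
      have Qm [measurable]: "Q \<in> sets lebesgue" using cube_lmeasurable[OF QE(1)] by auto
      note Em [measurable] = QE(2)
      note Qp = measure_cube_pos[OF QE(1)]
      define a where "a = mass u Q / vol Q"
      have a: "0 < a" using Upos[OF QE(1)] Qp by (simp add: a_def)
      have bound: "ennreal a * ennreal_power (average Q (\<lambda>y. ennreal (\<sigma> y))) s \<le> ennreal K"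
        unfolding S(1)[symmetric] S_def a_def avg[OF QE(1), symmetric] by (rule SUP_upper[OF QE(1)])
      have "average Q (\<lambda>y. ennreal (\<sigma> y)) \<noteq> \<infinity>"
      proof
        assume "average Q (\<lambda>y. ennreal (\<sigma> y)) = \<infinity>"
        then have "ennreal a * ennreal_power (average Q (\<lambda>y. ennreal (\<sigma> y))) s = \<infinity>"
          using a by (simp add: ennreal_power_def ennreal_mult_top)
        with bound show False by (simp add: top_unique)
      qed
      then have \<sigma>f: "emeasure (weight_measure \<sigma>) Q < \<infinity>"
        unfolding average_def emeasure_weight_measure[OF \<sigma>_meas Qm, symmetric]
        using Qp fin(2)[OF QE(1) Qm order_refl] 
        by (auto simp: ennreal_divide_eq_top_iff less_top)
      define m where "m = measure (weight_measure \<sigma>) Q"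
      have m: "0 < m" "emeasure (weight_measure \<sigma>) Q = ennreal m"
        using weight_measure_cube_pos[OF \<sigma>_meas \<sigma>p QE(1) \<sigma>f] \<sigma>f
        by (auto simp: m_def emeasure_eq_ennreal_measure less_top)
      have "average Q (\<lambda>y. ennreal (\<sigma> y)) = ennreal (m / vol Q)"
        unfolding average_def emeasure_weight_measure[OF \<sigma>_meas Qm, symmetric] m
          fin(2)[OF QE(1) Qm order_refl] using Qp m by (simp add: divide_ennreal)
      with bound have Aq: "a * (m / vol Q) powr s \<le> K"
        using a S m Qp by (simp add: ennreal_power_def flip: ennreal_mult)
      define e where "e = vol E"
      define \<tau> where "\<tau> = (e / (2 * m)) powr s"
      have \<tau>: "0 < \<tau>" using Epos m by (simp add: \<tau>_def e_def)
      define L where "L = {x \<in> E. u x < \<tau>}"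
      have "L = {x \<in> space lebesgue. u x < \<tau>} \<inter> E" by (auto simp: L_def)
      also have "\<dots> \<in> sets lebesgue" by measurable
      finally have L: "L \<in> sets lebesgue" "L \<subseteq> E" by (auto simp: L_def)
      have Ef: "E \<in> lmeasurable" using fmeasurableI2[OF cube_lmeasurable[OF QE(1)] QE(3,2)] .
      have Lf: "L \<in> lmeasurable" using fmeasurableI2[OF Ef L(2,1)] .
      have "ennreal (2 * m / e) * emeasure lebesgue L = (\<integral>\<^sup>+x\<in>L. ennreal (2 * m / e) \<partial>lebesgue)"
        using L by (simp add: nn_integral_cmult_indicator)
      also have "\<dots> \<le> (\<integral>\<^sup>+x\<in>Q. ennreal (\<sigma> x) \<partial>lebesgue)"
      proof (rule nn_integral_mono)
        fix x
        have "2 * m / e \<le> \<sigma> x" if "x \<in> L"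
        proof -
          have "u x powr (1 / s) \<le> \<tau> powr (1 / s)"
            using that up[of x] s by (intro powr_mono2) (auto simp: L_def)
          also have "\<dots> = e / (2 * m)" using s m Epos by (simp add: \<tau>_def powr_powr e_def)
          finally show ?thesis
            using up[of x] m Epos by (simp add: \<sigma>_def powr_minus e_def field_simps)
        qed
        then show "ennreal (2 * m / e) * indicator L x \<le> ennreal (\<sigma> x) * indicator Q x"
          using L QE by (auto simp: indicator_def intro!: ennreal_leI)
      qed
      also have "\<dots> = ennreal m" using emeasure_weight_measure[OF \<sigma>_meas Qm] m by simp
      finally have "2 * m / e * vol L \<le> m"
        using m Epos by (simp add: emeasure_eq_measure2[OF Lf] e_def flip: ennreal_mult)
      then have "vol L \<le> e / 2" using m Epos by (simp add: e_def field_simps)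
      then have big: "e / 2 \<le> vol (E - L)"
        using measurable_measure_Diff[OF Ef L] by (simp add: e_def)
      have EL: "E - L \<in> sets lebesgue" "E - L \<subseteq> Q" "E - L \<in> lmeasurable"
        using L QE fmeasurable.Diff[OF Ef Lf] by auto
      have "ennreal \<tau> * emeasure lebesgue (E - L) = (\<integral>\<^sup>+x\<in>E - L. ennreal \<tau> \<partial>lebesgue)"
        using EL by (simp add: nn_integral_cmult_indicator)
      also have "\<dots> \<le> (\<integral>\<^sup>+x\<in>E. ennreal (u x) \<partial>lebesgue)"
        by (intro nn_integral_mono) (auto simp: L_def indicator_def intro!: ennreal_leI)
      also have "\<dots> = emeasure (weight_measure u) E" using emeasure_weight_measure[OF um QE(2)] by simp
      finally have "\<tau> * vol (E - L) \<le> mass u E"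
        unfolding fin[OF QE] emeasure_eq_measure2[OF EL(3)] using \<tau> by (simp flip: ennreal_mult)
      moreover have "\<tau> * (e / 2) \<le> \<tau> * vol (E - L)" using \<tau> by (intro mult_left_mono big) auto
      ultimately have low: "\<tau> * (e / 2) \<le> mass u E" by simp
      have e: "0 < e" using Epos by (simp add: e_def)
      define Z where "Z = vol Q"
      have Z: "0 < Z" using Qp by (simp add: Z_def)
      have "(e / Z) powr q * mass u Q = (e / Z) powr s * e * a"
        using e Z q1 by (simp add: s_def powr_diff a_def Z_def)
      also have "\<dots> = (e / m) powr s * e * (a * (m / Z) powr s)"
        using e Z m by (simp add: powr_divide field_simps)
      also have "\<dots> \<le> (e / m) powr s * e * K"
        using e Aq by (intro mult_left_mono) (auto simp: Z_def)
      also have "(e / m) powr s * e * K = K * 2 powr q * (\<tau> * (e / 2))"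
        using e m q1 by (simp add: \<tau>_def s_def powr_divide powr_mult powr_diff field_simps)
      also have "\<dots> \<le> K * 2 powr q * mass u E"
        using S low by (intro mult_left_mono) auto
      finally show "(vol E / vol Q) powr q * mass u Q
          \<le> K * 2 powr q * mass u E"
        by (simp add: e_def Z_def)
    qed
    then show ?thesis by (rule that)
  qed
qed

lemma A_infinity_quant_A_infinity:
  assumes "u \<in> A_infinity"
  obtains C k where "u \<in> quant_A_infinity C k"
proof -
  obtain q where "1 \<le> q" "u \<in> A_class q" using assms by (auto simp: A_infinity_def)
  with A_class_quant_A_infinity that show ?thesis by metis
qed

section \<open>The maximal function\<close>

lemma cubeI: "0 < s \<Longrightarrow> cbox a (\<chi> i. a $ i + s) \<in> cubes"
  unfolding cubes_def by blast

lemma average_cube: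
  assumes "Q \<in> cubes"
  shows "average Q g = (\<integral>\<^sup>+x\<in>Q. g x \<partial>lebesgue) / ennreal (vol Q)"
  unfolding average_def using emeasure_eq_measure2[OF cube_lmeasurable[OF assms]] by simp

lemma average_le_HL_maximal:
  "Q \<in> cubes \<Longrightarrow> x \<in> Q \<Longrightarrow> average Q (\<lambda>y. ennreal \<bar>f y\<bar>) \<le> HL_maximal f x"
  unfolding HL_maximal_def by (rule SUP_upper) auto

lemma less_HL_maximalE:
  assumes "t < HL_maximal f x"
  obtains Q where "Q \<in> cubes" "x \<in> Q" "t < average Q (\<lambda>y. ennreal \<bar>f y\<bar>)"
  using assms unfolding HL_maximal_def less_SUP_iff by auto

lemma less_average_iff:
  assumes "Q \<in> cubes"
  shows "c < average Q g \<longleftrightarrow> c * ennreal (vol Q) < (\<integral>\<^sup>+x\<in>Q. g x \<partial>lebesgue)"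
proof -
  have p: "0 < ennreal (vol Q)" using measure_cube_pos[OF assms] by simp
  have "average Q g \<le> c \<longleftrightarrow> (\<integral>\<^sup>+x\<in>Q. g x \<partial>lebesgue) \<le> c * ennreal (vol Q)"
  proof
    assume "average Q g \<le> c"
    then have "average Q g * ennreal (vol Q) \<le> c * ennreal (vol Q)"
      by (rule mult_right_mono) simp
    then show "(\<integral>\<^sup>+x\<in>Q. g x \<partial>lebesgue) \<le> c * ennreal (vol Q)"
      unfolding average_cube[OF assms] ennreal_divide_times using p by simp
  next
    assume "(\<integral>\<^sup>+x\<in>Q. g x \<partial>lebesgue) \<le> c * ennreal (vol Q)"
    then show "average Q g \<le> c"
      unfolding average_cube[OF assms] using divide_le_posI_ennreal[OF p] by (simp add: mult.commute)
  qed
  then show ?thesis by (simp add: not_le[symmetric])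
qed

lemma cube_enlarge:
  fixes a :: "real ^ 'n"
  assumes "0 < s" "0 \<le> e"
  shows "cbox (\<chi> i. a $ i - e) (\<chi> i. a $ i + s + e) \<in> cubes"
    "vol (cbox (\<chi> i. a $ i - e) (\<chi> i. a $ i + s + e)) = (s + 2 * e) ^ CARD('n)"
proof -
  have eq: "(\<chi> i. a $ i + s + e) = (\<chi> i. (\<chi> i. a $ i - e) $ i + (s + 2 * e))"
    by (simp add: vec_eq_iff)
  show "cbox (\<chi> i. a $ i - e) (\<chi> i. a $ i + s + e) \<in> cubes"
    unfolding eq by (rule cubeI) (use assms in simp)
  show "vol (cbox (\<chi> i. a $ i - e) (\<chi> i. a $ i + s + e)) = (s + 2 * e) ^ CARD('n)"
    unfolding eq by (rule measure_cube) (use assms in simp)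
qed

text \<open>
  The average over a slightly enlarged cube is almost as large, since the integral can only grow and
  the volume depends continuously on the side.
\<close>
lemma open_HL_maximal_greater:
  fixes f :: "real ^ 'n \<Rightarrow> real"
  shows "open {x. t < HL_maximal f x}"
proof (rule openI)
  fix x assume "x \<in> {x. t < HL_maximal f x}"
  then obtain Q where Q: "Q \<in> cubes" "x \<in> Q" "t < average Q (\<lambda>y. ennreal \<bar>f y\<bar>)"
    by (auto elim: less_HL_maximalE)
  obtain a s where as: "Q = cbox a (\<chi> i. a $ i + s)" "0 < s" using Q(1) by (rule cubeE)
  let ?I = "\<integral>\<^sup>+x\<in>Q. ennreal \<bar>f x\<bar> \<partial>lebesgue"
  have tf: "t \<noteq> \<infinity>" using Q(3) by auto
  have I: "t * ennreal (s ^ CARD('n)) < ?I"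
    using Q(3) less_average_iff[OF Q(1)] measure_cube[of s a] as by (simp del: measure_completion)
  have "((\<lambda>e. t * ennreal ((s + 2 * e) ^ CARD('n))) \<longlongrightarrow> t * ennreal ((s + 2 * 0) ^ CARD('n))) (at_right 0)"
    using tf by (intro ennreal_tendsto_cmult tendsto_ennrealI tendsto_intros) (auto simp: less_top)
  then have "eventually (\<lambda>e. t * ennreal ((s + 2 * e) ^ CARD('n)) < ?I) (at_right 0)"
    using I by (intro order_tendstoD(2)) auto
  then obtain e where e: "0 < e" "t * ennreal ((s + 2 * e) ^ CARD('n)) < ?I"
    unfolding eventually_at_right_field by (metis dense)
  define R where "R = cbox (\<chi> i. a $ i - e) (\<chi> i. a $ i + s + e)"
  have R: "R \<in> cubes" "vol R = (s + 2 * e) ^ CARD('n)"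
    using cube_enlarge[OF as(2) less_imp_le[OF e(1)], of a] by (auto simp: R_def)
  have "Q \<subseteq> R"
  proof
    fix y assume "y \<in> Q"
    then have "a $ i \<le> y $ i \<and> y $ i \<le> a $ i + s" for i by (auto simp: as(1) mem_box_cart)
    then have "a $ i - e \<le> y $ i \<and> y $ i \<le> a $ i + s + e" for i
      using e(1) by (smt (verit))
    then show "y \<in> R" by (auto simp: R_def mem_box_cart)
  qed
  then have "?I \<le> (\<integral>\<^sup>+x\<in>R. ennreal \<bar>f x\<bar> \<partial>lebesgue)"
    by (intro nn_integral_mono mult_left_mono) (auto simp: indicator_def)
  with e(2) have "t < average R (\<lambda>y. ennreal \<bar>f y\<bar>)"
    using less_average_iff[OF R(1)] R(2) by (simp del: measure_completion)
  then have sub: "R \<subseteq> {x. t < HL_maximal f x}"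
    using average_le_HL_maximal[OF R(1)] by (auto intro: less_le_trans)
  have "ball x e \<subseteq> R"
  proof
    fix y assume "y \<in> ball x e"
    then have "\<bar>y $ i - x $ i\<bar> < e" for i
      using component_le_norm_cart[of "y - x" i] by (auto simp: dist_norm norm_minus_commute)
    moreover have "a $ i \<le> x $ i \<and> x $ i \<le> a $ i + s" for i
      using Q(2) by (auto simp: as(1) mem_box_cart)
    ultimately have "a $ i - e \<le> y $ i \<and> y $ i \<le> a $ i + s + e" for i by (smt (verit))
    then show "y \<in> R" by (auto simp: R_def mem_box_cart)
  qed
  with sub e(1) show "\<exists>e>0. ball x e \<subseteq> {x. t < HL_maximal f x}" by auto
qed

lemma borel_measurable_HL_maximal [measurable]: "HL_maximal f \<in> borel_measurable lebesgue"
  by (rule borel_measurableI_greater)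
    (simp add: sets_completionI_sets borel_open[OF open_HL_maximal_greater])

text \<open>
  Every cube lies in a comparable cell of one of finitely many grids, and each grid is an increasing
  union of truncated grids.  Hence it suffices to have estimates on one truncated grid.
\<close>
lemma emeasure_grids_le:
  fixes T :: "'n::finite set \<Rightarrow> nat \<Rightarrow> 'a set"
  assumes "\<And>A N. T A N \<in> sets \<mu>" "\<And>A. incseq (T A)" "\<And>A N. emeasure \<mu> (T A N) \<le> B"
  shows "emeasure \<mu> (\<Union>A. \<Union>N. T A N) \<le> ennreal (2 ^ CARD('n)) * B"
proof -
  have le: "emeasure \<mu> (\<Union>N. T A N) \<le> B" for A
  proof -
    have "(SUP N. emeasure \<mu> (T A N)) = emeasure \<mu> (\<Union>N. T A N)"
      using assms(1,2) by (intro SUP_emeasure_incseq) auto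
    moreover have "(SUP N. emeasure \<mu> (T A N)) \<le> B" by (intro SUP_least assms(3))
    ultimately show ?thesis by simp
  qed
  have "emeasure \<mu> (\<Union>A\<in>UNIV. \<Union>N. T A N) \<le> (\<Sum>A\<in>UNIV. emeasure \<mu> (\<Union>N. T A N))"
    using assms(1) by (intro emeasure_subadditive_finite) auto
  also have "\<dots> \<le> (\<Sum>A\<in>(UNIV::'n set set). B)" by (intro sum_mono le)
  also have "\<dots> = ennreal (2 ^ CARD('n)) * B"
    by (simp add: card_UNIV_set ennreal_of_nat_eq_real_of_nat)
  finally show ?thesis by simp
qed

lemma grid_mono: "grid A (- int N) \<subseteq> grid A (- int (Suc N))"
proof
  fix P assume "P \<in> grid A (- int N)"
  then obtain k j where "P = cell A k j" "- int N \<le> k" by (auto simp: grid_def)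
  then have "P = cell A k j \<and> - int (Suc N) \<le> k" by simp
  then show "P \<in> grid A (- int (Suc N))" unfolding grid_def by blast
qed

text \<open>
  The cell that contains a given cube has at most \<open>6 ^ CARD('n)\<close> times its volume.
\<close>
lemma HL_maximal_cell:
  fixes f :: "real ^ 'n \<Rightarrow> real"
  assumes "c < HL_maximal f x"
  obtains A N P where "P \<in> grid A (- int N)" "x \<in> P"
    "c * ennreal (vol P) < ennreal (6 ^ CARD('n)) * (\<integral>\<^sup>+x\<in>P. ennreal \<bar>f x\<bar> \<partial>lebesgue)"
proof -
  obtain Q where Q: "Q \<in> cubes" "x \<in> Q" "c < average Q (\<lambda>y. ennreal \<bar>f y\<bar>)"
    using assms by (rule less_HL_maximalE)
  obtain A k j where P: "Q \<subseteq> cell A k j"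
    "vol (cell A k j) \<le> 6 ^ CARD('n) * vol Q"
    using Q(1) by (rule cube_in_cell)
  have "c * ennreal (vol (cell A k j))
      \<le> c * ennreal (6 ^ CARD('n) * vol Q)"
    by (intro mult_left_mono ennreal_leI P(2)) simp
  also have "\<dots> = ennreal (6 ^ CARD('n)) * (c * ennreal (vol Q))"
    by (subst ennreal_mult) (auto simp: ac_simps)
  also have "\<dots> < ennreal (6 ^ CARD('n)) * (\<integral>\<^sup>+x\<in>Q. ennreal \<bar>f x\<bar> \<partial>lebesgue)"
    using Q(3) unfolding less_average_iff[OF Q(1)] by (intro ennreal_mult_strict_left_mono) auto
  also have "\<dots> \<le> ennreal (6 ^ CARD('n)) * (\<integral>\<^sup>+x\<in>cell A k j. ennreal \<bar>f x\<bar> \<partial>lebesgue)"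
    using P(1) by (intro mult_left_mono nn_integral_mono) (auto simp: indicator_def)
  finally have lt: "c * ennreal (vol (cell A k j))
    < ennreal (6 ^ CARD('n)) * (\<integral>\<^sup>+x\<in>cell A k j. ennreal \<bar>f x\<bar> \<partial>lebesgue)" .
  have "cell A k j \<in> grid A (- int (nat (- k)))" unfolding grid_def by (intro CollectI exI conjI) auto
  from that[OF this _ lt] Q(2) P(1) show ?thesis by auto
qed

text \<open>
  The constant is the product of the number \<open>2 ^ CARD('n)\<close> of grids and the ratio of the volumes of a
  cell and of the cube that it contains.
\<close>
lemma HL_maximal_weak_type:
  fixes f :: "real ^ 'n \<Rightarrow> real"
  assumes f [measurable]: "f \<in> borel_measurable lebesgue" and t: "0 < t"
  shows "emeasure lebesgue {x. ennreal t < HL_maximal f x}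
    \<le> ennreal (12 ^ CARD('n) / t) * (\<integral>\<^sup>+x. ennreal \<bar>f x\<bar> \<partial>lebesgue)"
proof -
  define \<nu> where "\<nu> = density lebesgue (\<lambda>x. ennreal \<bar>f x\<bar>)"
  have \<nu>: "sets \<nu> = sets lebesgue" by (simp add: \<nu>_def)
  have \<nu>_eq: "emeasure \<nu> E = (\<integral>\<^sup>+x\<in>E. ennreal \<bar>f x\<bar> \<partial>lebesgue)" if "E \<in> sets lebesgue" for E
    unfolding \<nu>_def using that by (intro emeasure_density) auto
  define \<Phi> where "\<Phi> A N = {P \<in> grid A (- int N).
    ennreal t * ennreal (vol P) < ennreal (6 ^ CARD('n)) * emeasure \<nu> P}" for A N
  define B where "B = ennreal (6 ^ CARD('n) / t) * (\<integral>\<^sup>+x. ennreal \<bar>f x\<bar> \<partial>lebesgue)"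
  have sub: "\<Phi> A N \<subseteq> grid A (- int N)" for A N by (auto simp: \<Phi>_def)
  have cellm: "P \<in> lmeasurable" if "P \<in> grid A K" for P A K
    using that cell_measurable by (auto simp: grid_def)
  have "{x. ennreal t < HL_maximal f x} \<subseteq> (\<Union>A. \<Union>N. \<Union>(\<Phi> A N))"
  proof
    fix x assume "x \<in> {x. ennreal t < HL_maximal f x}"
    then obtain A N P where P: "P \<in> grid A (- int N)" "x \<in> P" "ennreal t * ennreal (vol P)
        < ennreal (6 ^ CARD('n)) * (\<integral>\<^sup>+x\<in>P. ennreal \<bar>f x\<bar> \<partial>lebesgue)"
      by (auto elim: HL_maximal_cell)
    then have "P \<in> \<Phi> A N" using cellm[OF P(1)] by (simp add: \<Phi>_def \<nu>_eq del: measure_completion)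
    with P(2) show "x \<in> (\<Union>A. \<Union>N. \<Union>(\<Phi> A N))" by auto
  qed
  moreover have meas: "\<Union>(\<Phi> A N) \<in> sets lebesgue" for A N
    using laminar_family.sets_Union_cells[OF laminar_grid sub] .
  ultimately have "emeasure lebesgue {x. ennreal t < HL_maximal f x}
      \<le> emeasure lebesgue (\<Union>A. \<Union>N. \<Union>(\<Phi> A N))"
    by (intro emeasure_mono) auto
  also have "\<dots> \<le> ennreal (2 ^ CARD('n)) * B"
  proof (rule emeasure_grids_le[OF meas])
    show "incseq (\<lambda>N. \<Union>(\<Phi> A N))" for A
      by (rule incseq_SucI) (use grid_mono in \<open>unfold \<Phi>_def, blast\<close>)
    fix A N
    interpret laminar_family lebesgue "grid A (- int N) :: (real ^ 'n) set set" by (rule laminar_grid)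
    have "emeasure lebesgue (UNIV \<inter> \<Union>(\<Phi> A N))
        \<le> ennreal (6 ^ CARD('n) / t) * emeasure \<nu> (UNIV \<inter> \<Union>(\<Phi> A N))"
    proof (rule emeasure_Union_cells_le[OF sub refl \<nu>])
      fix P assume "P \<in> maximal_cells (\<Phi> A N)"
      then have P: "P \<in> \<Phi> A N" using maximal_cells_subset by auto
      then have "ennreal t * ennreal (vol P) \<le> ennreal (6 ^ CARD('n)) * emeasure \<nu> P"
        by (auto simp: \<Phi>_def less_imp_le simp del: measure_completion)
      also have "\<dots> = ennreal t * (ennreal (6 ^ CARD('n) / t) * emeasure \<nu> P)"
        using t by (simp add: mult.assoc[symmetric] flip: ennreal_mult)
      finally have "ennreal (vol P) \<le> ennreal (6 ^ CARD('n) / t) * emeasure \<nu> P"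
        using t by (subst (asm) ennreal_mult_le_mult_iff) auto
      moreover have "P \<in> lmeasurable" using P sub cellm by blast
      ultimately show "emeasure lebesgue (UNIV \<inter> P) \<le> ennreal (6 ^ CARD('n) / t) * emeasure \<nu> (UNIV \<inter> P)"
        using emeasure_eq_measure2[of P lebesgue] by (simp del: measure_completion)
    qed auto
    also have "\<dots> \<le> B"
    proof -
      have "emeasure \<nu> (UNIV \<inter> \<Union>(\<Phi> A N)) = (\<integral>\<^sup>+x\<in>\<Union>(\<Phi> A N). ennreal \<bar>f x\<bar> \<partial>lebesgue)"
        using \<nu>_eq[OF meas] by simp
      also have "\<dots> \<le> (\<integral>\<^sup>+x. ennreal \<bar>f x\<bar> \<partial>lebesgue)"
        by (intro nn_integral_mono) (auto simp: indicator_def)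
      finally show ?thesis unfolding B_def by (rule mult_left_mono) simp
    qed
    finally show "emeasure lebesgue (\<Union>(\<Phi> A N)) \<le> B" by simp
  qed
  also have "ennreal (2 ^ CARD('n)) * B = ennreal (12 ^ CARD('n) / t) * (\<integral>\<^sup>+x. ennreal \<bar>f x\<bar> \<partial>lebesgue)"
  proof -
    have "(12::real) ^ CARD('n) / t = 2 ^ CARD('n) * (6 ^ CARD('n) / t)"
      by (simp flip: power_mult_distrib)
    then show ?thesis unfolding B_def using t by (simp add: mult.assoc[symmetric] flip: ennreal_mult)
  qed
  finally show ?thesis .
qed

text \<open>
  The property of maximal functions for which a negative power is a harmless factor of a weight: on a
  cube, such a function exceeds a multiple of its essential infimum only on a small set.
\<close>
definition bounded_oscillation :: "real \<Rightarrow> (real ^ 'n \<Rightarrow> real) \<Rightarrow> bool"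
  where "bounded_oscillation D g \<longleftrightarrow> (\<forall>Q\<in>cubes. \<exists>I>0. (AE x in lebesgue. x \<in> Q \<longrightarrow> I \<le> g x) \<and>
    (\<forall>s>0. vol {x \<in> Q. s * I < g x} \<le> D / s * vol Q))"

text \<open>
  On a cube \<open>Q\<close> with lower bound \<open>I\<close> for \<open>g\<close>, the factor \<open>g x powr - r\<close> is at most \<open>I powr - r\<close>.  On the other
  hand, if \<open>s\<close> is a suitable multiple of \<open>vol Q / vol E\<close>, then \<open>g x \<le> s * I\<close> on at least half of \<open>E\<close>, and
  there the factor is at least \<open>(s * I) powr - r\<close>.  The loss \<open>s powr r\<close> is a power of \<open>vol Q / vol E\<close>, which
  the larger exponent absorbs.
\<close>
lemma quant_A_infinity_times_powr:
  fixes u g :: "real ^ 'n \<Rightarrow> real"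
  assumes u: "u \<in> quant_A_infinity C k" and g: "g \<in> borel_measurable lebesgue" "\<And>x. 0 < g x"
    and osc: "bounded_oscillation D g" and D: "1 \<le> D" and r: "0 \<le> r" "r \<le> real h"
  shows "(\<lambda>x. u x * g x powr (- r)) \<in> quant_A_infinity (C * 2 ^ k * (2 * D) ^ h) (k + h)"
proof -
  define u' where "u' x = u x * g x powr (- r)" for x
  note ub = quant_A_infinity_basic[OF u]
  note [measurable] = ub(3) g(1)
  have u'm [measurable]: "u' \<in> borel_measurable lebesgue" unfolding u'_def by measurable
  have u'p: "0 < u' x" for x using ub(4)[of x] g(2)[of x] by (simp add: u'_def)
  have C': "1 \<le> C * 2 ^ k * (2 * D) ^ h"
    by (rule mult_ge1_I[OF mult_ge1_I[OF ub(1) one_le_power] one_le_power]) (use D in simp_all)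
  have main: "emeasure (weight_measure u') Q < \<infinity> \<and> (\<forall>E\<in>sets lebesgue. E \<subseteq> Q \<longrightarrow>
      vol E ^ (k + h) * measure (weight_measure u') Q
        \<le> C * 2 ^ k * (2 * D) ^ h * vol Q ^ (k + h) * measure (weight_measure u') E)"
    if Q: "Q \<in> cubes" for Q
  proof -
    obtain I where I: "0 < I" "AE x in lebesgue. x \<in> Q \<longrightarrow> I \<le> g x"
      "\<And>s. 0 < s \<Longrightarrow> vol {x \<in> Q. s * I < g x} \<le> D / s * vol Q"
      using osc Q unfolding bounded_oscillation_def by blast
    note Qf = cube_lmeasurable[OF Q] and Qp = measure_cube_pos[OF Q]
    have Qm [measurable]: "Q \<in> sets lebesgue" using Qf by auto
    have "emeasure (weight_measure u') Q = (\<integral>\<^sup>+x\<in>Q. ennreal (u' x) \<partial>lebesgue)"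
      by (rule emeasure_weight_measure) measurable
    also have "\<dots> \<le> (\<integral>\<^sup>+x. ennreal (I powr (- r)) * (ennreal (u x) * indicator Q x) \<partial>lebesgue)"
    proof (rule nn_integral_mono_AE)
      show "AE x in lebesgue. ennreal (u' x) * indicator Q x
          \<le> ennreal (I powr (- r)) * (ennreal (u x) * indicator Q x)"
        using I(2)
      proof eventually_elim
        case (elim x)
        show ?case
        proof (cases "x \<in> Q")
          case True
          then have "g x powr (- r) \<le> I powr (- r)"
            using elim I(1) r by (intro powr_mono2') auto
          then have "u' x \<le> I powr (- r) * u x"
            using ub(4)[of x] by (simp add: u'_def mult.commute)
          then have "ennreal (u' x) \<le> ennreal (I powr (- r)) * ennreal (u x)"
            using ub(4)[of x] by (simp add: ennreal_leI flip: ennreal_mult)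
          with True show ?thesis by simp
        qed simp
      qed
    qed
    also have "\<dots> = ennreal (I powr (- r)) * emeasure (weight_measure u) Q"
      unfolding emeasure_weight_measure[OF ub(3) Qm] by (rule nn_integral_cmult) measurable
    finally have U'Q: "emeasure (weight_measure u') Q
        \<le> ennreal (I powr (- r)) * emeasure (weight_measure u) Q" .
    have UQ: "emeasure (weight_measure u) Q < \<infinity>" by (rule ub(5)[OF Q])
    have fin: "emeasure (weight_measure u') Q < \<infinity>"
      using U'Q UQ by (auto intro: le_less_trans simp: ennreal_mult_less_top)
    have U'Q': "measure (weight_measure u') Q \<le> I powr (- r) * mass u Q"
      using U'Q UQ fin by (simp add: emeasure_eq_ennreal_measure less_top flip: ennreal_mult)
    have "vol E ^ (k + h) * measure (weight_measure u') Q
        \<le> C * 2 ^ k * (2 * D) ^ h * vol Q ^ (k + h) * measure (weight_measure u') E"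
      if E: "E \<in> sets lebesgue" "E \<subseteq> Q" for E
    proof (cases "vol E = 0")
      case True
      have "0 \<le> C * 2 ^ k * (2 * D) ^ h * vol Q ^ (k + h) * measure (weight_measure u') E"
        using ub(1) D by (intro mult_nonneg_nonneg zero_le_power) auto
      then show ?thesis using True ub(2) by (simp add: zero_power del: measure_completion)
    next
      case False
      define e where "e = vol E"
      define z where "z = vol Q"
      have e: "0 < e" using False by (simp add: e_def zero_less_measure_iff)
      have z: "0 < z" using Qp by (simp add: z_def)
      have Ef: "E \<in> lmeasurable" using fmeasurableI2[OF Qf E(2,1)] .
      have ez: "e \<le> z" unfolding e_def z_def using E Qf by (intro measure_mono_fmeasurable) auto
      define s where "s = 2 * D * z / e"
      have "1 * e \<le> (2 * D) * z" using ez D e by (intro mult_mono) auto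
      then have s: "1 \<le> s" using e by (simp add: s_def)
      define F where "F = {x \<in> E. g x \<le> s * I}"
      have "F = {x \<in> space lebesgue. g x \<le> s * I} \<inter> E" by (auto simp: F_def)
      also have "\<dots> \<in> sets lebesgue" using E by (intro sets.Int) (measurable, auto)
      finally have F: "F \<in> sets lebesgue" "F \<subseteq> E" "F \<subseteq> Q" using E by (auto simp: F_def)
      note Fm [measurable] = F(1)
      have bad: "{x \<in> Q. s * I < g x} \<in> sets lebesgue"
      proof -
        have "{x \<in> Q. s * I < g x} = {x \<in> space lebesgue. s * I < g x} \<inter> Q" by auto
        also have "\<dots> \<in> sets lebesgue" by measurable
        finally show ?thesis .
      qed
      have "vol (E - F) \<le> vol {x \<in> Q. s * I < g x}"
        using E F bad fmeasurableI2[OF Qf _ bad] by (intro measure_mono_fmeasurable) (auto simp: F_def)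
      also have "\<dots> \<le> D / s * z" unfolding z_def using s by (intro I(3)) auto
      also have "\<dots> = e / 2" using e z D by (simp add: s_def)
      finally have "e / 2 \<le> vol F"
        using measurable_measure_Diff[OF Ef F(1,2)] by (simp add: e_def)
      then have "(e / 2) ^ k \<le> vol F ^ k" using e by (intro power_mono) auto
      then have "(e / 2) ^ k * mass u Q \<le> vol F ^ k * mass u Q"
        by (rule mult_right_mono) simp
      also have "\<dots> \<le> C * z ^ k * mass u F"
        unfolding z_def using u Q F by (auto simp: quant_A_infinity_def)
      finally have 1: "(e / 2) ^ k * mass u Q \<le> C * z ^ k * mass u F" .
      have finF: "emeasure (weight_measure u) F < \<infinity>" "emeasure (weight_measure u') F < \<infinity>"
        "emeasure (weight_measure u') E < \<infinity>"
        using emeasure_finite_subset[OF F(3), of "weight_measure u"]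
          emeasure_finite_subset[OF F(3), of "weight_measure u'"]
          emeasure_finite_subset[OF E(2), of "weight_measure u'"] UQ fin by auto
      have "ennreal ((s * I) powr (- r)) * emeasure (weight_measure u) F
          = (\<integral>\<^sup>+x. ennreal ((s * I) powr (- r)) * (ennreal (u x) * indicator F x) \<partial>lebesgue)"
        unfolding emeasure_weight_measure[OF ub(3) F(1)] by (rule nn_integral_cmult[symmetric]) measurable
      also have "\<dots> \<le> (\<integral>\<^sup>+x\<in>F. ennreal (u' x) \<partial>lebesgue)"
      proof (rule nn_integral_mono)
        fix x
        show "ennreal ((s * I) powr (- r)) * (ennreal (u x) * indicator F x) \<le> ennreal (u' x) * indicator F x"
        proof (cases "x \<in> F")
          case True
          then have "(s * I) powr (- r) \<le> g x powr (- r)"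
            using g(2)[of x] r by (intro powr_mono2') (auto simp: F_def)
          then have "(s * I) powr (- r) * u x \<le> u' x"
            using ub(4)[of x] by (simp add: u'_def mult.commute)
          then have "ennreal ((s * I) powr (- r)) * ennreal (u x) \<le> ennreal (u' x)"
            using ub(4)[of x] by (simp add: ennreal_leI flip: ennreal_mult)
          with True show ?thesis by simp
        qed simp
      qed
      also have "\<dots> = emeasure (weight_measure u') F"
        by (rule emeasure_weight_measure[OF u'm F(1), symmetric])
      finally have "(s * I) powr (- r) * mass u F \<le> measure (weight_measure u') F"
        using finF by (simp add: emeasure_eq_ennreal_measure less_top flip: ennreal_mult)
      also have "\<dots> \<le> measure (weight_measure u') E"
        using F E finF by (intro measure_mono_fmeasurable) (auto intro!: fmeasurableI)
      finally have 2: "(s * I) powr (- r) * mass u F \<le> measure (weight_measure u') E" .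
      have "s powr r \<le> s powr real h" using s r by (intro powr_mono) auto
      also have "\<dots> = s ^ h" using s by (simp add: powr_realpow)
      finally have 3: "s powr r \<le> s ^ h" .
      have "e ^ (k + h) * measure (weight_measure u') Q
          \<le> e ^ (k + h) * (I powr (- r) * mass u Q)"
        using e by (intro mult_left_mono U'Q') auto
      also have "\<dots> = 2 ^ k * e ^ h * I powr (- r) * ((e / 2) ^ k * mass u Q)"
        by (simp add: power_add power_divide)
      also have "\<dots> \<le> 2 ^ k * e ^ h * I powr (- r) * (C * z ^ k * mass u F)"
        using e by (intro mult_left_mono 1) auto
      also have "\<dots> = 2 ^ k * e ^ h * C * z ^ k * (s powr r * ((s * I) powr (- r) * mass u F))"
        using s I(1) by (simp add: powr_mult powr_minus field_simps)
      also have "\<dots> \<le> 2 ^ k * e ^ h * C * z ^ k * (s ^ h * measure (weight_measure u') E)"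
        using e z ub(1) s by (intro mult_left_mono mult_mono 2 3) auto
      also have "\<dots> = C * 2 ^ k * (2 * D) ^ h * z ^ (k + h) * measure (weight_measure u') E"
        using e by (simp add: s_def power_add power_divide power_mult_distrib)
      finally show ?thesis by (simp add: e_def z_def)
    qed
    with fin show ?thesis by blast
  qed
  show ?thesis
    using C' ub(2) u'm u'p main unfolding quant_A_infinity_def u'_def[symmetric] by auto
qed

text \<open>
  A cube \<open>R\<close> that meets \<open>Q\<close> and is at least as large is contained in a cube of three times its side that
  also contains \<open>Q\<close>; hence its average is at most \<open>3 ^ CARD('n) * I\<close>.  A smaller cube is contained in the
  threefold enlargement of \<open>Q\<close>, where the weak-type estimate for the restricted function applies.
\<close>
lemma HL_maximal_oscillation:
  fixes f :: "real ^ 'n \<Rightarrow> real"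
  assumes f [measurable]: "f \<in> borel_measurable lebesgue" and Q: "Q \<in> cubes"
    and I: "0 < I" "I = (INF x\<in>Q. HL_maximal f x)" "I < \<infinity>" and s: "0 < s"
  shows "emeasure lebesgue {x \<in> Q. ennreal s * I < HL_maximal f x}
    \<le> ennreal (36 ^ CARD('n) / s * vol Q)"
proof (cases "s \<le> 3 ^ CARD('n)")
  case True
  have "emeasure lebesgue {x \<in> Q. ennreal s * I < HL_maximal f x} \<le> emeasure lebesgue Q"
    using cube_lmeasurable[OF Q] by (intro emeasure_mono) auto
  also have "\<dots> = ennreal (vol Q)" by (rule emeasure_eq_measure2[OF cube_lmeasurable[OF Q]])
  also have "\<dots> \<le> ennreal (36 ^ CARD('n) / s * vol Q)"
  proof (intro ennreal_leI)
    have "s \<le> 36 ^ CARD('n)"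
      by (rule order_trans[OF True power_mono]) simp_all
    then have "1 \<le> 36 ^ CARD('n) / s" using s by simp
    from mult_right_mono[OF this, of "vol Q"]
    show "vol Q \<le> 36 ^ CARD('n) / s * vol Q" by simp
  qed
  finally show ?thesis .
next
  case False
  obtain a l where Q': "Q = cbox a (\<chi> i. a $ i + l)" and l: "0 < l" using Q by (rule cubeE)
  define Q3 where "Q3 = cbox (\<chi> i. a $ i - l) (\<chi> i. a $ i + l + l)"
  have Q3: "Q3 \<in> cubes" "vol Q3 = (3 * l) ^ CARD('n)"
    using cube_enlarge[OF l less_imp_le[OF l], of a] by (auto simp: Q3_def)
  have Q3m [measurable]: "Q3 \<in> sets lebesgue" using cube_lmeasurable[OF Q3(1)] by auto
  have mQ: "vol Q = l ^ CARD('n)" unfolding Q' by (rule measure_cube) (use l in simp)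
  have in_Q: "y \<in> Q \<longleftrightarrow> (\<forall>i. a $ i \<le> y $ i \<and> y $ i \<le> a $ i + l)" for y
    by (auto simp: Q' mem_box_cart)
  obtain i where i: "I = ennreal i" "0 < i" using I(1,3) by (cases I) auto
  have avg_I: "average R (\<lambda>y. ennreal \<bar>f y\<bar>) \<le> I" if R: "R \<in> cubes" "Q \<subseteq> R" for R
    unfolding I(2) by (intro INF_greatest average_le_HL_maximal R(1)) (use R(2) in auto)
  define f3 where "f3 x = f x * indicator Q3 x" for x
  have f3 [measurable]: "f3 \<in> borel_measurable lebesgue" unfolding f3_def by measurable
  have "{x \<in> Q. ennreal s * I < HL_maximal f x} \<subseteq> {x. ennreal (s * i) < HL_maximal f3 x}"
  proof
    fix x assume "x \<in> {x \<in> Q. ennreal s * I < HL_maximal f x}"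
    then have x: "x \<in> Q" and lt: "ennreal (s * i) < HL_maximal f x"
      using i s by (auto simp: ennreal_mult)
    obtain R where R: "R \<in> cubes" "x \<in> R" and avg: "ennreal (s * i) < average R (\<lambda>y. ennreal \<bar>f y\<bar>)"
      using lt by (rule less_HL_maximalE)
    obtain b r where R': "R = cbox b (\<chi> i. b $ i + r)" and r: "0 < r" using R(1) by (rule cubeE)
    have in_R: "y \<in> R \<longleftrightarrow> (\<forall>i. b $ i \<le> y $ i \<and> y $ i \<le> b $ i + r)" for y
      by (auto simp: R' mem_box_cart)
    have mR: "vol R = r ^ CARD('n)" unfolding R' by (rule measure_cube) (use r in simp)
    show "x \<in> {x. ennreal (s * i) < HL_maximal f3 x}"
    proof (cases "l \<le> r")
      case True
      define R3 where "R3 = cbox (\<chi> i. b $ i - r) (\<chi> i. b $ i + r + r)"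
      have R3: "R3 \<in> cubes" "vol R3 = (3 * r) ^ CARD('n)"
        using cube_enlarge[OF r less_imp_le[OF r], of b] by (auto simp: R3_def)
      have in_R3: "y \<in> R3 \<longleftrightarrow> (\<forall>i. b $ i - r \<le> y $ i \<and> y $ i \<le> b $ i + r + r)" for y
        by (auto simp: R3_def mem_box_cart)
      have "Q \<subseteq> R3"
      proof
        fix y assume "y \<in> Q"
        then have "b $ i - r \<le> y $ i \<and> y $ i \<le> b $ i + r + r" for i
          using x R(2) True unfolding in_Q in_R by (smt (verit))
        then show "y \<in> R3" unfolding in_R3 by blast
      qed
      then have "average R3 (\<lambda>y. ennreal \<bar>f y\<bar>) \<le> ennreal i" using avg_I[OF R3(1)] i by simp
      then have le: "(\<integral>\<^sup>+y\<in>R3. ennreal \<bar>f y\<bar> \<partial>lebesgue) \<le> ennreal i * ennreal (vol R3)"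
        using less_average_iff[OF R3(1), of "ennreal i" "\<lambda>y. ennreal \<bar>f y\<bar>"] by (simp add: not_less[symmetric])
      have "R \<subseteq> R3"
      proof
        fix y assume "y \<in> R"
        then have "b $ i - r \<le> y $ i \<and> y $ i \<le> b $ i + r + r" for i
          using r unfolding in_R by (smt (verit))
        then show "y \<in> R3" unfolding in_R3 by blast
      qed
      then have mono: "(\<integral>\<^sup>+y\<in>R. ennreal \<bar>f y\<bar> \<partial>lebesgue) \<le> (\<integral>\<^sup>+y\<in>R3. ennreal \<bar>f y\<bar> \<partial>lebesgue)"
        by (intro nn_integral_mono) (auto simp: indicator_def)
      have "ennreal (s * i) * ennreal (vol R) < (\<integral>\<^sup>+y\<in>R. ennreal \<bar>f y\<bar> \<partial>lebesgue)"
        using avg less_average_iff[OF R(1)] by simp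
      from less_le_trans[OF less_le_trans[OF this mono] le]
      have "ennreal (s * i) * ennreal (vol R) < ennreal i * ennreal (vol R3)" .
      then have "ennreal (s * i * r ^ CARD('n)) < ennreal (i * (3 * r) ^ CARD('n))"
        unfolding mR R3(2) using i s r by (simp add: ennreal_mult)
      then have "s * i * r ^ CARD('n) < i * (3 * r) ^ CARD('n)"
        using i s r by (subst (asm) ennreal_less_iff) auto
      then have "s < 3 ^ CARD('n)" using i r by (simp add: power_mult_distrib)
      with False show ?thesis by simp
    next
      case False
      have "R \<subseteq> Q3"
      proof
        fix y assume "y \<in> R"
        then have "a $ i - l \<le> y $ i \<and> y $ i \<le> a $ i + l + l" for i
          using x R(2) False unfolding in_Q in_R by (smt (verit))
        then show "y \<in> Q3" unfolding Q3_def by (simp add: mem_box_cart)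
      qed
      then have "average R (\<lambda>y. ennreal \<bar>f y\<bar>) = average R (\<lambda>y. ennreal \<bar>f3 y\<bar>)"
        unfolding average_def
        by (intro arg_cong2[where f = "(/)"] nn_integral_cong) (auto simp: f3_def indicator_def)
      also have "\<dots> \<le> HL_maximal f3 x" by (rule average_le_HL_maximal[OF R])
      finally show ?thesis using avg by (auto intro: less_le_trans)
    qed
  qed
  then have "emeasure lebesgue {x \<in> Q. ennreal s * I < HL_maximal f x}
      \<le> emeasure lebesgue {x. ennreal (s * i) < HL_maximal f3 x}"
  proof (rule emeasure_mono)
    have "{x. ennreal (s * i) < HL_maximal f3 x} = {x \<in> space lebesgue. ennreal (s * i)
        < HL_maximal f3 x}" by simp
    also have "\<dots> \<in> sets lebesgue" by measurable
    finally show "{x. ennreal (s * i) < HL_maximal f3 x} \<in> sets lebesgue" .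
  qed
  also have "\<dots> \<le> ennreal (12 ^ CARD('n) / (s * i)) * (\<integral>\<^sup>+x. ennreal \<bar>f3 x\<bar> \<partial>lebesgue)"
    by (rule HL_maximal_weak_type[OF f3]) (use s i in simp)
  also have "(\<integral>\<^sup>+x. ennreal \<bar>f3 x\<bar> \<partial>lebesgue) = (\<integral>\<^sup>+x\<in>Q3. ennreal \<bar>f x\<bar> \<partial>lebesgue)"
    by (intro nn_integral_cong) (auto simp: f3_def indicator_def)
  also have "\<dots> \<le> ennreal i * ennreal (vol Q3)"
  proof -
    have "Q \<subseteq> Q3"
    proof
      fix y assume "y \<in> Q"
      then have "a $ i - l \<le> y $ i \<and> y $ i \<le> a $ i + l + l" for i
        using l unfolding in_Q by (smt (verit))
      then show "y \<in> Q3" unfolding Q3_def by (simp add: mem_box_cart)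
    qed
    then have "average Q3 (\<lambda>y. ennreal \<bar>f y\<bar>) \<le> ennreal i" using avg_I[OF Q3(1)] i by simp
    then show ?thesis
      using less_average_iff[OF Q3(1), of "ennreal i" "\<lambda>y. ennreal \<bar>f y\<bar>"] by (simp add: not_less[symmetric])
  qed
  also have "ennreal (12 ^ CARD('n) / (s * i)) * (ennreal i * ennreal (vol Q3))
      = ennreal (12 ^ CARD('n) / (s * i) * (i * vol Q3))"
    using s i by (subst ennreal_mult, simp, simp, subst ennreal_mult, simp_all)
  also have "12 ^ CARD('n) / (s * i) * (i * vol Q3) = 36 ^ CARD('n) / s * vol Q"
  proof -
    have "(36::real) ^ CARD('n) = 12 ^ CARD('n) * 3 ^ CARD('n)" by (simp flip: power_mult_distrib)
    then show ?thesis unfolding Q3(2) mQ power_mult_distrib using i s by simp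
  qed
  finally show ?thesis by (simp add: mult_left_mono)
qed

lemma HL_maximal_pos:
  fixes f :: "real ^ 'n \<Rightarrow> real"
  assumes f [measurable]: "f \<in> borel_measurable lebesgue" and nz: "\<not> (AE x in lebesgue. f x = 0)"
    and Q: "Q \<in> cubes"
  shows "0 < (INF x\<in>Q. HL_maximal f x)"
proof -
  obtain a l where Q': "Q = cbox a (\<chi> i. a $ i + l)" and l: "0 < l" using Q by (rule cubeE)
  define R where "R k = cbox (\<chi> i. a $ i - real k) (\<chi> i. a $ i + l + real k)" for k :: nat
  have R: "R k \<in> cubes" for k using cube_enlarge(1)[OF l, of "real k" a] by (simp add: R_def)
  have Rm [measurable]: "R k \<in> sets lebesgue" for k using cube_lmeasurable[OF R] by auto
  have in_R: "y \<in> R k \<longleftrightarrow> (\<forall>i. a $ i - real k \<le> y $ i \<and> y $ i \<le> a $ i + l + real k)" for y k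
    by (auto simp: R_def mem_box_cart)
  have "\<exists>k. (\<integral>\<^sup>+x\<in>R k. ennreal \<bar>f x\<bar> \<partial>lebesgue) \<noteq> 0"
  proof (rule ccontr)
    assume "\<not> ?thesis"
    then have "(\<integral>\<^sup>+x. ennreal \<bar>f x\<bar> * indicator (R k) x \<partial>lebesgue) = 0" for k by simp
    then have "AE x in lebesgue. ennreal \<bar>f x\<bar> * indicator (R k) x = 0" for k
      by (subst (asm) nn_integral_0_iff_AE) auto
    then have "AE x in lebesgue. \<forall>k. ennreal \<bar>f x\<bar> * indicator (R k) x = 0"
      by (subst AE_all_countable) blast
    then have "AE x in lebesgue. f x = 0"
    proof eventually_elim
      case (elim x)
      obtain k :: nat where k: "norm (x - a) \<le> real k" using real_arch_simple by blast
      have "a $ i - real k \<le> x $ i \<and> x $ i \<le> a $ i + l + real k" for i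
        using component_le_norm_cart[of "x - a" i] k l by (auto simp: abs_le_iff)
      then have "x \<in> R k" unfolding in_R by blast
      with elim[rule_format, of k] show ?case by simp
    qed
    with nz show False by simp
  qed
  then obtain k where k: "(\<integral>\<^sup>+x\<in>R k. ennreal \<bar>f x\<bar> \<partial>lebesgue) \<noteq> 0" by blast
  then have "0 < average (R k) (\<lambda>y. ennreal \<bar>f y\<bar>)"
    unfolding less_average_iff[OF R] by (simp add: zero_less_iff_neq_zero)
  also have "\<dots> \<le> (INF x\<in>Q. HL_maximal f x)"
  proof (intro INF_greatest average_le_HL_maximal R)
    fix x assume "x \<in> Q"
    then have "a $ i - real k \<le> x $ i \<and> x $ i \<le> a $ i + l + real k" for i
    proof -
      have "a $ i \<le> x $ i \<and> x $ i \<le> a $ i + l"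
        using \<open>x \<in> Q\<close> unfolding Q' mem_box_cart by simp
      then show ?thesis using of_nat_0_le_iff[of k, where 'a = real] by linarith
    qed
    then show "x \<in> R k" unfolding in_R by blast
  qed
  finally show ?thesis .
qed

text \<open>
  The value one is a default at the points where the maximal function is zero or infinite.  In the
  application they form a null set.
\<close>
definition real_maximal :: "(real ^ 'n \<Rightarrow> real) \<Rightarrow> real ^ 'n \<Rightarrow> real"
  where "real_maximal f x = (if HL_maximal f x = 0 \<or> HL_maximal f x = \<infinity> then 1 else enn2real (HL_maximal f x))"

lemma real_maximal_measurable [measurable]: "real_maximal f \<in> borel_measurable lebesgue"
  unfolding real_maximal_def[abs_def] by measurable

lemma real_maximal_pos: "0 < real_maximal f x"
  by (auto simp: real_maximal_def enn2real_positive_iff zero_less_iff_neq_zero less_top)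

lemma ennreal_real_maximal:
  "HL_maximal f x \<noteq> 0 \<Longrightarrow> HL_maximal f x \<noteq> \<infinity> \<Longrightarrow> ennreal (real_maximal f x) = HL_maximal f x"
  by (simp add: real_maximal_def less_top)

lemma bounded_oscillation_real_maximal:
  fixes f :: "real ^ 'n \<Rightarrow> real"
  assumes f: "f \<in> borel_measurable lebesgue" and nz: "\<not> (AE x in lebesgue. f x = 0)"
    and fin: "AE x in lebesgue. HL_maximal f x < \<infinity>"
  shows "bounded_oscillation (36 ^ CARD('n)) (real_maximal f)"
  unfolding bounded_oscillation_def
proof
  fix Q :: "(real ^ 'n) set" assume Q: "Q \<in> cubes"
  define I where "I = (INF x\<in>Q. HL_maximal f x)"
  have I0: "0 < I" unfolding I_def by (rule HL_maximal_pos[OF f nz Q])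
  have le: "I \<le> HL_maximal f x" if "x \<in> Q" for x unfolding I_def using that by (rule INF_lower)
  have "I < \<infinity>"
  proof (rule ccontr)
    assume "\<not> I < \<infinity>"
    then have "I = \<infinity>" by (simp add: top.not_eq_extremum[symmetric])
    then have top: "HL_maximal f x = \<infinity>" if "x \<in> Q" for x using le[OF that] by (simp add: top_unique)
    have "AE x in lebesgue. x \<notin> Q" using fin top by (auto elim!: eventually_mono)
    then have "Q \<in> null_sets lebesgue" using cube_lmeasurable[OF Q] by (subst AE_iff_null_sets) auto
    then show False using measure_cube_pos[OF Q] by (auto simp: null_sets_def measure_def)
  qed
  then obtain i where i: "I = ennreal i" "0 < i" using I0 by (cases I) auto
  have AE: "AE x in lebesgue. x \<in> Q \<longrightarrow> i \<le> real_maximal f x"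
    using fin
  proof eventually_elim
    case (elim x)
    show ?case
    proof
      assume x: "x \<in> Q"
      then have "ennreal (real_maximal f x) = HL_maximal f x"
        using elim le[OF x] I0 by (intro ennreal_real_maximal) (auto simp: less_top)
      with le[OF x] i show "i \<le> real_maximal f x"
        using real_maximal_pos[of f x] by (metis ennreal_le_iff less_imp_le)
    qed
  qed
  have "vol {x \<in> Q. s * i < real_maximal f x} \<le> 36 ^ CARD('n) / s * vol Q"
    if s: "0 < s" for s
  proof -
    let ?L = "{x \<in> Q. s * i < real_maximal f x}" and ?B = "{x \<in> Q. ennreal s * I < HL_maximal f x}"
    have Qm: "Q \<in> sets lebesgue" using cube_lmeasurable[OF Q] by auto
    have Lm: "?L \<in> sets lebesgue" and Bm: "?B \<in> sets lebesgue"
    proof -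
      have "?L = {x \<in> space lebesgue. s * i < real_maximal f x} \<inter> Q" by auto
      also have "\<dots> \<in> sets lebesgue" using Qm by (intro sets.Int) (measurable)
      finally show "?L \<in> sets lebesgue" .
      have "?B = {x \<in> space lebesgue. ennreal s * I < HL_maximal f x} \<inter> Q" by auto
      also have "\<dots> \<in> sets lebesgue" using Qm by (intro sets.Int) (measurable)
      finally show "?B \<in> sets lebesgue" .
    qed
    have "AE x in lebesgue. x \<in> ?L \<longrightarrow> x \<in> ?B"
      using fin
    proof eventually_elim
      case (elim x)
      show ?case
      proof
        assume x: "x \<in> ?L"
        then have "ennreal (real_maximal f x) = HL_maximal f x"
          using elim le[of x] I0 by (intro ennreal_real_maximal) (auto simp: less_top)
        moreover have "ennreal (s * i) < ennreal (real_maximal f x)"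
          using x s i by (auto simp: ennreal_less_iff)
        ultimately show "x \<in> ?B" using x s i by (simp add: ennreal_mult)
      qed
    qed
    then have "emeasure lebesgue ?L \<le> emeasure lebesgue ?B" by (rule emeasure_mono_AE[OF _ Bm])
    also have "\<dots> \<le> ennreal (36 ^ CARD('n) / s * vol Q)"
      by (rule HL_maximal_oscillation[OF f Q I0 I_def \<open>I < \<infinity>\<close> s])
    finally have "emeasure lebesgue ?L \<le> ennreal (36 ^ CARD('n) / s * vol Q)" .
    then show ?thesis
      unfolding measure_def[of lebesgue ?L] using s by (intro enn2real_leI) auto
  qed
  with i AE show "\<exists>I>0. (AE x in lebesgue. x \<in> Q \<longrightarrow> I \<le> real_maximal f x) \<and>
      (\<forall>s>0. vol {x \<in> Q. s * I < real_maximal f x} \<le> 36 ^ CARD('n) / s * vol Q)"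
    by blast
qed

section \<open>The mixed estimate for one weight\<close>

lemma dyadic_scale:
  fixes r :: real
  assumes "0 < r"
  obtains k :: int where "2 powi k < r" "r \<le> 2 powi (k + 1)"
proof -
  define k where "k = \<lceil>log 2 r\<rceil> - 1"
  have "(2::real) powr real_of_int k < 2 powr log 2 r"
    by (intro powr_less_mono) (simp_all add: k_def, linarith)
  then have 1: "2 powi k < r" using assms powr_real_of_int'[of 2 k] by simp
  have "(2::real) powr log 2 r \<le> 2 powr real_of_int (k + 1)"
    by (intro powr_mono) (simp_all add: k_def)
  then have 2: "r \<le> 2 powi (k + 1)" using assms powr_real_of_int'[of 2 "k + 1"] by simp
  show ?thesis by (rule that[OF 1 2])
qed

text \<open>
  Sums over all dyadic levels are integrals with respect to the counting measure of the integers, so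
  that they can be interchanged with other integrals.
\<close>
abbreviation level_sum :: "(int \<Rightarrow> ennreal) \<Rightarrow> ennreal"
  where "level_sum f \<equiv> nn_integral (count_space UNIV) f"

lemma dyadic_layers_le:
  fixes y :: real
  shows "ennreal \<bar>y\<bar> \<le> (level_sum (\<lambda>k. ennreal (2 powi (k + 1)) * indicator {2 powi k <..} \<bar>y\<bar>))"
proof (cases "y = 0")
  case False
  then obtain k :: int where k: "2 powi k < \<bar>y\<bar>" "\<bar>y\<bar> \<le> 2 powi (k + 1)"
    using dyadic_scale[of "\<bar>y\<bar>"] by auto
  then have "ennreal \<bar>y\<bar> \<le> ennreal (2 powi (k + 1)) * indicator {2 powi k <..} \<bar>y\<bar>"
    by (simp add: ennreal_leI)
  also have "\<dots> \<le> (level_sum (\<lambda>k. ennreal (2 powi (k + 1)) * indicator {2 powi k <..} \<bar>y\<bar>))"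
    by (rule nn_integral_ge_point[of k UNIV
          "\<lambda>k. ennreal (2 powi (k + 1)) * indicator {2 powi k <..} \<bar>y\<bar>"]) simp
  finally show ?thesis .
qed simp

lemma ennreal_power_mono: "0 \<le> a \<Longrightarrow> s \<le> t \<Longrightarrow> ennreal_power s a \<le> ennreal_power t a"
proof -
  assume a: "0 \<le> a" and st: "s \<le> t"
  show "ennreal_power s a \<le> ennreal_power t a"
  proof (cases "t = \<infinity>")
    case False
    then have "enn2real s \<le> enn2real t" using st by (intro enn2real_mono) (auto simp: less_top)
    moreover have "s \<noteq> \<infinity>" using False st by (auto simp: top_unique)
    ultimately show ?thesis using False a by (auto simp: ennreal_power_def intro!: ennreal_leI powr_mono2)
  qed (simp add: ennreal_power_def)
qed

text \<open>
  The distribution function is decreasing, so its value at \<open>2 powi k\<close> is below its values on the interval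
  from \<open>2 powi (k - 1)\<close> to \<open>2 powi k\<close>.
\<close>
lemma dyadic_levels_Lorentz:
  fixes g :: "'a \<Rightarrow> ennreal"
  assumes g: "g \<in> borel_measurable \<mu>" and p: "1 \<le> p"
  shows "(level_sum (\<lambda>k. ennreal (2 powi (k + 1))
      * ennreal_power (distribution_function \<mu> g (2 powi k)) (1 / p))) \<le> 4 * Lorentz_q1_norm p \<mu> g"
proof -
  define \<phi> where "\<phi> y = ennreal_power (distribution_function \<mu> g y) (1 / p)" for y
  have anti: "\<phi> z \<le> \<phi> y" if "y \<le> z" for y z
  proof -
    have "{x \<in> space \<mu>. ennreal z < g x} \<subseteq> {x \<in> space \<mu>. ennreal y < g x}"
      using ennreal_leI[OF that] by (auto intro: le_less_trans)
    then show ?thesis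
      unfolding \<phi>_def distribution_function_def using g p
      by (intro ennreal_power_mono emeasure_mono) auto
  qed
  have single: "(level_sum (\<lambda>k. \<phi> (2 powi k) * indicator {2 powi (k - 1) <.. 2 powi k} y))
      \<le> \<phi> y * indicator {0 <..} y" for y :: real
  proof (cases "0 < y")
    case True
    then obtain k :: int where k: "2 powi k < y" "y \<le> 2 powi (k + 1)" by (rule dyadic_scale)
    have other: "y \<notin> {2 powi (l - 1) <.. 2 powi l}" if "l \<noteq> k + 1" for l
    proof
      assume l: "y \<in> {2 powi (l - 1) <.. 2 powi l}"
      then have "(2::real) powi k < 2 powi l" "(2::real) powi (l - 1) < 2 powi (k + 1)" using k by auto
      then have "k < l" "l - 1 < k + 1"
        using power_int_increasing[of l k "2::real"] power_int_increasing[of "k + 1" "l - 1" "2::real"]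
        by (smt (verit))+
      with that show False by simp
    qed
    have "(level_sum (\<lambda>l. \<phi> (2 powi l) * indicator {2 powi (l - 1) <.. 2 powi l} y))
        = (\<Sum>l\<in>{k + 1}. \<phi> (2 powi l) * indicator {2 powi (l - 1) <.. 2 powi l} y)"
      using other by (intro nn_integral_count_space') auto
    also have "\<dots> \<le> \<phi> y" using k anti by (auto simp: indicator_def)
    finally show ?thesis using True by simp
  next
    case False
    have "y \<notin> {2 powi (l - 1) <.. 2 powi l}" for l :: int
    proof -
      have "(0::real) < 2 powi (l - 1)" by simp
      then show ?thesis using False by (metis greaterThanAtMost_iff less_trans)
    qed
    then show ?thesis by simp
  qed
  have "(level_sum (\<lambda>k. ennreal (2 powi (k + 1)) * \<phi> (2 powi k)))
      = (level_sum (\<lambda>k. 4 * (\<integral>\<^sup>+y. \<phi> (2 powi k)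
          * indicator {2 powi (k - 1) <.. 2 powi k} y \<partial>(lborel :: real measure))))"
  proof (rule nn_integral_cong)
    fix k :: int
    have half: "(2::real) powi (k + 1) = 4 * (2 powi k - 2 powi (k - 1))"
      by (simp add: power_int_add power_int_diff)
    have le: "(2::real) powi (k - 1) \<le> 2 powi k" by (rule power_int_increasing) auto
    have "(\<integral>\<^sup>+y. \<phi> (2 powi k) * indicator {2 powi (k - 1) <.. 2 powi k} y \<partial>(lborel :: real measure))
        = \<phi> (2 powi k) * ennreal (2 powi k - 2 powi (k - 1))"
      using le by (subst nn_integral_cmult_indicator) auto
    then show "ennreal (2 powi (k + 1)) * \<phi> (2 powi k)
        = 4 * (\<integral>\<^sup>+y. \<phi> (2 powi k) * indicator {2 powi (k - 1) <.. 2 powi k} y \<partial>(lborel :: real measure))"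
      unfolding half using ennreal_mult'[of 4 "2 powi k - 2 powi (k - 1)"] by (simp only:) (simp add: ac_simps)
  qed
  also have "\<dots> = 4 * (level_sum (\<lambda>k. (\<integral>\<^sup>+y. \<phi> (2 powi k)
      * indicator {2 powi (k - 1) <.. 2 powi k} y \<partial>(lborel :: real measure))))"
    by (rule nn_integral_cmult) simp
  also have "(level_sum (\<lambda>k. (\<integral>\<^sup>+y. \<phi> (2 powi k)
      * indicator {2 powi (k - 1) <.. 2 powi k} y \<partial>(lborel :: real measure))))
      = (\<integral>\<^sup>+y. (level_sum (\<lambda>k. \<phi> (2 powi k) * indicator {2 powi (k - 1) <.. 2 powi k} y)) \<partial>(lborel :: real measure))"
    by (rule nn_integral_count_space_nn_integral[symmetric]) auto
  also have "\<dots> \<le> (\<integral>\<^sup>+y. \<phi> y * indicator {0 <..} y \<partial>(lborel :: real measure))"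
    by (rule nn_integral_mono) (rule single)
  also have "\<dots> \<le> Lorentz_q1_norm p \<mu> g"
  proof -
    have "1 \<le> ennreal p" using ennreal_leI[OF p] by simp
    from mult_right_mono[OF this zero_le] show ?thesis by (simp add: Lorentz_q1_norm_def \<phi>_def)
  qed
  finally show ?thesis unfolding \<phi>_def by (simp add: mult_left_mono)
qed

lemma mixed_weak_type_all_grids:
  fixes w :: "real ^ 'n \<Rightarrow> real"
  assumes w: "w \<in> quant_A_infinity C k"
  obtains B :: real where "0 < B"
    "\<And>V \<nu> T. V \<in> borel_measurable lebesgue \<Longrightarrow> (\<And>x. 0 < V x) \<Longrightarrow>
      (\<lambda>x. w x * V x) \<in> quant_A_infinity D h \<Longrightarrow> sets \<nu> = sets lebesgue \<Longrightarrow>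
      (\<And>x. x \<in> T \<Longrightarrow> \<exists>A N. \<exists>P\<in>grid A (- int N). x \<in> P \<and>
        ennreal (V x * mass w P) < emeasure \<nu> P) \<Longrightarrow>
      emeasure (weight_measure (\<lambda>x. w x * V x)) T \<le> ennreal B * emeasure \<nu> UNIV"
proof -
  obtain B :: real where B: "0 < B" "\<And>V A K \<nu>. V \<in> borel_measurable lebesgue \<Longrightarrow> (\<And>x. 0 < V x) \<Longrightarrow>
      (\<lambda>x. w x * V x) \<in> quant_A_infinity D h \<Longrightarrow> sets \<nu> = sets lebesgue \<Longrightarrow>
      emeasure (weight_measure (\<lambda>x. w x * V x))
        {x. \<exists>Q\<in>grid A K. x \<in> Q \<and> ennreal (V x * mass w Q) < emeasure \<nu> Q}
        \<le> ennreal B * emeasure \<nu> UNIV"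
    by (rule dyadic_mixed_weak_type[OF w]) blast
  show ?thesis
  proof (rule that[of "2 ^ CARD('n) * B"])
    show "0 < 2 ^ CARD('n) * B" using B by simp
    fix V :: "real ^ 'n \<Rightarrow> real" and \<nu> :: "(real ^ 'n) measure" and T
    assume V: "V \<in> borel_measurable lebesgue" "\<And>x. 0 < V x"
      and u: "(\<lambda>x. w x * V x) \<in> quant_A_infinity D h" and \<nu>: "sets \<nu> = sets lebesgue"
      and T: "\<And>x. x \<in> T \<Longrightarrow> \<exists>A N. \<exists>P\<in>grid A (- int N). x \<in> P \<and>
        ennreal (V x * mass w P) < emeasure \<nu> P"
    note [measurable] = V(1)
    let ?U = "weight_measure (\<lambda>x. w x * V x)"
    define S where "S A N = {x. \<exists>Q\<in>grid A (- int N). x \<in> Q \<and>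
      ennreal (V x * mass w Q) < emeasure \<nu> Q}" for A N
    have S_meas: "S A N \<in> sets ?U" for A N
    proof -
      interpret laminar_family lebesgue "grid A (- int N) :: (real ^ 'n) set set" by (rule laminar_grid)
      have "S A N = (\<Union>Q\<in>grid A (- int N). {x \<in> space lebesgue. ennreal (V x * mass w Q) < emeasure \<nu> Q} \<inter> Q)"
        by (auto simp: S_def)
      also have "\<dots> \<in> sets lebesgue"
        using countable_cells
      proof (rule sets.countable_UN'')
        fix Q :: "(real ^ 'n) set" assume "Q \<in> grid A (- int N)"
        then have [measurable]: "Q \<in> sets lebesgue" using cells_measurable by auto
        show "{x \<in> space lebesgue. ennreal (V x * mass w Q) < emeasure \<nu> Q} \<inter> Q \<in> sets lebesgue"
          by measurable
      qed
      finally show ?thesis by simp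
    qed
    have "emeasure ?U T \<le> emeasure ?U (\<Union>A. \<Union>N. S A N)"
    proof (rule emeasure_mono)
      show "T \<subseteq> (\<Union>A. \<Union>N. S A N)" using T by (auto simp: S_def)
      show "(\<Union>A. \<Union>N. S A N) \<in> sets ?U" using S_meas by (intro sets.finite_UN sets.countable_UN) auto
    qed
    also have "\<dots> \<le> ennreal (2 ^ CARD('n)) * (ennreal B * emeasure \<nu> UNIV)"
    proof (rule emeasure_grids_le[OF S_meas])
      show "incseq (S A)" for A
        by (rule incseq_SucI) (use grid_mono in \<open>unfold S_def, blast\<close>)
      show "emeasure ?U (S A N) \<le> ennreal B * emeasure \<nu> UNIV" for A N
        unfolding S_def by (rule B(2)[OF V u \<nu>])
    qed
    also have "\<dots> = ennreal (2 ^ CARD('n) * B) * emeasure \<nu> UNIV"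
      using B by (simp add: ennreal_mult mult.assoc)
    finally show "emeasure ?U T \<le> ennreal (2 ^ CARD('n) * B) * emeasure \<nu> UNIV" .
  qed
qed

lemma A_R_1_average_cell:
  fixes w :: "real ^ 'n \<Rightarrow> real"
  assumes w: "w \<in> A_R_class 1"
  obtains A :: real where "0 < A" "\<And>K a P g. P \<in> grid a K \<Longrightarrow> g \<in> borel_measurable lebesgue \<Longrightarrow>
    (\<integral>\<^sup>+x\<in>P. g x \<partial>lebesgue)
      \<le> ennreal (A * vol P / mass w P) * (\<integral>\<^sup>+x\<in>P. g x \<partial>weight_measure w)"
proof -
  have wt: "weight w" using w by (simp add: A_R_class_def)
  obtain A :: real where A: "0 < A" "\<And>Q g. Q \<in> cubes \<Longrightarrow> g \<in> borel_measurable lebesgue \<Longrightarrow>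
    (\<integral>\<^sup>+x\<in>Q. g x \<partial>lebesgue)
      \<le> ennreal (A * vol Q / mass w Q) * (\<integral>\<^sup>+x\<in>Q. g x \<partial>weight_measure w)"
    by (rule A_R_1_average[OF w]) blast
  show ?thesis
  proof (rule that[OF A(1)])
    fix K a and P :: "(real ^ 'n) set" and g :: "real ^ 'n \<Rightarrow> ennreal"
    assume P: "P \<in> grid a K" and g: "g \<in> borel_measurable lebesgue"
    obtain k j where P': "P = cell a k j" using P by (auto simp: grid_def)
    obtain Q :: "(real ^ 'n) set" where Q: "Q \<in> cubes" "P \<subseteq> Q" "vol Q = vol P"
      "mass w Q = mass w P"
      using cell_cube_measure[OF weight_measurable[OF wt], of a k j] wt P' unfolding weight_def by metis
    have eq: "g x * indicator P x * indicator Q x = g x * indicator P x" for x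
      using Q(2) by (auto simp: indicator_def)
    have "P \<in> sets lebesgue" using P' cell_measurable by auto
    then have "(\<lambda>x. g x * indicator P x) \<in> borel_measurable lebesgue" using g by measurable
    from A(2)[OF Q(1) this] show "(\<integral>\<^sup>+x\<in>P. g x \<partial>lebesgue)
      \<le> ennreal (A * vol P / mass w P) * (\<integral>\<^sup>+x\<in>P. g x \<partial>weight_measure w)"
      unfolding eq Q(3,4) .
  qed
qed

text \<open>
  The constant \<open>B\<close> may depend on \<open>v\<close> only through the constants in the condition on the product weight.
\<close>
definition mixed_maximal_bound :: "(real ^ 'n \<Rightarrow> real) \<Rightarrow> real \<Rightarrow> real \<Rightarrow> nat \<Rightarrow> real \<Rightarrow> bool"
  where "mixed_maximal_bound w p D h B \<longleftrightarrow> (\<forall>v f t L. v \<in> borel_measurable lebesgue \<longrightarrow> (\<forall>x. 0 < v x) \<longrightarrow>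
      (\<lambda>x. w x * v x powr p) \<in> quant_A_infinity D h \<longrightarrow> f \<in> borel_measurable lebesgue \<longrightarrow>
      0 < t \<longrightarrow> 0 < L \<longrightarrow> Lorentz_q1_norm p (weight_measure w) (\<lambda>x. ennreal \<bar>f x\<bar>) \<le> ennreal L \<longrightarrow>
      emeasure (weight_measure (\<lambda>x. w x * v x powr p)) {x. ennreal (t * v x) < HL_maximal f x}
        \<le> ennreal (B * (L / t) powr p))"

text \<open>
  For the exponent one, the condition on \<open>w\<close> turns averages with respect to the volume into averages
  with respect to the mass of \<open>w\<close>, and the Lorentz norm is the norm of the space of integrable functions.
\<close>
lemma mixed_maximal_bound_1:
  fixes w :: "real ^ 'n \<Rightarrow> real"
  assumes w: "w \<in> A_R_class 1"
  obtains B :: real where "0 < B" "mixed_maximal_bound w 1 D h B"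
proof -
  have wt: "weight w" using w by (simp add: A_R_class_def)
  note [measurable] = weight_measurable[OF wt]
  obtain C k where cl: "w \<in> quant_A_infinity C k" by (rule A_R_quant_A_infinity[OF w order_refl])
  obtain A :: real where A: "0 < A" "\<And>K a P g. P \<in> grid a K \<Longrightarrow> g \<in> borel_measurable lebesgue \<Longrightarrow>
    (\<integral>\<^sup>+x\<in>P. g x \<partial>lebesgue)
      \<le> ennreal (A * vol P / mass w P) * (\<integral>\<^sup>+x\<in>P. g x \<partial>weight_measure w)"
    by (rule A_R_1_average_cell[OF w]) blast
  obtain B :: real where B: "0 < B"
    "\<And>V \<nu> T. V \<in> borel_measurable lebesgue \<Longrightarrow> (\<And>x. 0 < V x) \<Longrightarrow>
      (\<lambda>x. w x * V x) \<in> quant_A_infinity D h \<Longrightarrow> sets \<nu> = sets lebesgue \<Longrightarrow>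
      (\<And>x. x \<in> T \<Longrightarrow> \<exists>A N. \<exists>P\<in>grid A (- int N). x \<in> P \<and>
        ennreal (V x * mass w P) < emeasure \<nu> P) \<Longrightarrow>
      emeasure (weight_measure (\<lambda>x. w x * V x)) T \<le> ennreal B * emeasure \<nu> UNIV"
    by (rule mixed_weak_type_all_grids[OF cl]) blast
  define c where "c = 6 ^ CARD('n) * A"
  have c: "0 < c" using A by (simp add: c_def)
  have "mixed_maximal_bound w 1 D h (B * c * 4)"
    unfolding mixed_maximal_bound_def
  proof (intro allI impI)
    fix v f :: "real ^ 'n \<Rightarrow> real" and t L :: real
    assume v: "v \<in> borel_measurable lebesgue" "\<forall>x. 0 < v x"
      and u: "(\<lambda>x. w x * v x powr 1) \<in> quant_A_infinity D h" and f: "f \<in> borel_measurable lebesgue"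
      and t: "0 < t" and L: "0 < L" "Lorentz_q1_norm 1 (weight_measure w) (\<lambda>x. ennreal \<bar>f x\<bar>) \<le> ennreal L"
    note [measurable] = v(1) f
    have v1: "v x powr 1 = v x" for x using v(2) by (simp add: less_imp_le)
    have fw [measurable]: "f \<in> borel_measurable (weight_measure w)" by (simp add: weight_measure_def)
    define \<nu> where "\<nu> = density (weight_measure w) (\<lambda>x. ennreal (c / t) * ennreal \<bar>f x\<bar>)"
    have \<nu>: "sets \<nu> = sets lebesgue" by (simp add: \<nu>_def)
    have \<nu>_eq: "emeasure \<nu> E = ennreal (c / t) * (\<integral>\<^sup>+x\<in>E. ennreal \<bar>f x\<bar> \<partial>weight_measure w)"
      if E: "E \<in> sets lebesgue" for E
    proof -
      note [measurable] = E
      have [measurable]: "E \<in> sets (weight_measure w)" using E by simp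
      have "emeasure \<nu> E = (\<integral>\<^sup>+x. ennreal (c / t) * (ennreal \<bar>f x\<bar> * indicator E x) \<partial>weight_measure w)"
        unfolding \<nu>_def by (subst emeasure_density) (auto simp: mult.assoc)
      also have "\<dots> = ennreal (c / t) * (\<integral>\<^sup>+x\<in>E. ennreal \<bar>f x\<bar> \<partial>weight_measure w)"
        by (rule nn_integral_cmult) measurable
      finally show ?thesis .
    qed
    have "emeasure (weight_measure (\<lambda>x. w x * v x)) {x. ennreal (t * v x) < HL_maximal f x}
        \<le> ennreal B * emeasure \<nu> UNIV"
    proof (rule B(2)[OF v(1) _ _ \<nu>])
      show "0 < v x" for x using v(2) by simp
      show "(\<lambda>x. w x * v x) \<in> quant_A_infinity D h" using u unfolding v1 .
      fix x assume "x \<in> {x. ennreal (t * v x) < HL_maximal f x}"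
      then obtain a N P where P: "P \<in> grid a (- int N)" "x \<in> P" "ennreal (t * v x) * ennreal (vol P)
          < ennreal (6 ^ CARD('n)) * (\<integral>\<^sup>+x\<in>P. ennreal \<bar>f x\<bar> \<partial>lebesgue)"
        by (auto elim: HL_maximal_cell)
      define W where "W = mass w P"
      define l where "l = vol P"
      have W: "0 < W" unfolding W_def by (rule quant_A_infinity_cell(2)[OF cl P(1)])
      have l: "0 < l" using P(1) by (auto simp: grid_def l_def measure_cell simp del: measure_completion)
      have Pm: "P \<in> sets lebesgue" using P(1) cell_measurable by (auto simp: grid_def)
      note P(3)
      also have "ennreal (6 ^ CARD('n)) * (\<integral>\<^sup>+x\<in>P. ennreal \<bar>f x\<bar> \<partial>lebesgue)
          \<le> ennreal (6 ^ CARD('n)) * (ennreal (A * l / W) * (\<integral>\<^sup>+x\<in>P. ennreal \<bar>f x\<bar> \<partial>weight_measure w))"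
        unfolding l_def W_def by (intro mult_left_mono A(2)[OF P(1)]) auto
      also have "\<dots> = ennreal (6 ^ CARD('n) * (A * l / W)) * (\<integral>\<^sup>+x\<in>P. ennreal \<bar>f x\<bar> \<partial>weight_measure w)"
        using A W l by (subst ennreal_mult) (auto simp: mult.assoc)
      also have "6 ^ CARD('n) * (A * l / W) = (l * t / W) * (c / t)"
        using t by (simp add: c_def)
      also have "ennreal ((l * t / W) * (c / t)) * (\<integral>\<^sup>+x\<in>P. ennreal \<bar>f x\<bar> \<partial>weight_measure w)
          = ennreal (l * t / W) * emeasure \<nu> P"
        unfolding \<nu>_eq[OF Pm] using l t W c by (subst ennreal_mult) (auto simp: mult.assoc)
      also have "ennreal (t * v x) * ennreal (vol P) = ennreal (l * t / W) * ennreal (v x * W)"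
        unfolding l_def[symmetric] using l t W v(2)[rule_format, of x]
        by (simp add: ac_simps flip: ennreal_mult)
      finally have lt: "ennreal (l * t / W) * ennreal (v x * W) < ennreal (l * t / W) * emeasure \<nu> P" .
      have "ennreal (v x * W) < emeasure \<nu> P"
      proof (rule ccontr)
        assume "\<not> ennreal (v x * W) < emeasure \<nu> P"
        then have "ennreal (l * t / W) * emeasure \<nu> P \<le> ennreal (l * t / W) * ennreal (v x * W)"
          by (intro mult_left_mono) auto
        with lt show False by simp
      qed
      with P(1,2) show "\<exists>A N. \<exists>P\<in>grid A (- int N). x \<in> P \<and>
          ennreal (v x * mass w P) < emeasure \<nu> P" unfolding W_def by blast
    qed
    also have "emeasure \<nu> UNIV = ennreal (c / t) * (\<integral>\<^sup>+x. ennreal \<bar>f x\<bar> \<partial>weight_measure w)"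
      using \<nu>_eq[of UNIV] by simp
    also have "(\<integral>\<^sup>+x. ennreal \<bar>f x\<bar> \<partial>weight_measure w) \<le> 4 * ennreal L"
    proof -
      have "(\<integral>\<^sup>+x. ennreal \<bar>f x\<bar> \<partial>weight_measure w)
          \<le> (\<integral>\<^sup>+x. (level_sum (\<lambda>k. ennreal (2 powi (k + 1))
              * indicator {2 powi k <..} \<bar>f x\<bar>)) \<partial>weight_measure w)"
        by (intro nn_integral_mono dyadic_layers_le)
      also have "\<dots> = (level_sum (\<lambda>k. (\<integral>\<^sup>+x. ennreal (2 powi (k + 1))
          * indicator {2 powi k <..} \<bar>f x\<bar> \<partial>weight_measure w)))"
        by (rule nn_integral_count_space_nn_integral) auto
      also have "\<dots> = (level_sum (\<lambda>k. ennreal (2 powi (k + 1))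
          * ennreal_power (distribution_function (weight_measure w) (\<lambda>x. ennreal \<bar>f x\<bar>) (2 powi k)) (1 / 1)))"
      proof (rule nn_integral_cong)
        fix k :: int
        let ?E = "{x \<in> space (weight_measure w). 2 powi k < \<bar>f x\<bar>}"
        have eq: "{x \<in> space (weight_measure w). ennreal (2 powi k) < ennreal \<bar>f x\<bar>} = ?E"
          by (auto simp: ennreal_less_iff)
        have id: "ennreal_power s 1 = s" for s by (cases s) (auto simp: ennreal_power_def)
        have "(\<integral>\<^sup>+x. ennreal (2 powi (k + 1)) * indicator {2 powi k <..} \<bar>f x\<bar> \<partial>weight_measure w)
            = (\<integral>\<^sup>+x. ennreal (2 powi (k + 1)) * indicator ?E x \<partial>weight_measure w)"
          by (intro nn_integral_cong) (auto simp: indicator_def)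
        also have "\<dots> = ennreal (2 powi (k + 1)) * emeasure (weight_measure w) ?E"
          by (rule nn_integral_cmult_indicator) measurable
        finally show "(\<integral>\<^sup>+x. ennreal (2 powi (k + 1)) * indicator {2 powi k <..} \<bar>f x\<bar> \<partial>weight_measure w)
          = ennreal (2 powi (k + 1)) * ennreal_power (distribution_function (weight_measure w) (\<lambda>x. ennreal \<bar>f x\<bar>) (2 powi k)) (1 / 1)"
          unfolding distribution_function_def eq by (simp add: id)
      qed
      also have "\<dots> \<le> 4 * Lorentz_q1_norm 1 (weight_measure w) (\<lambda>x. ennreal \<bar>f x\<bar>)"
        by (rule dyadic_levels_Lorentz) auto
      also have "\<dots> \<le> 4 * ennreal L" by (intro mult_left_mono L(2)) simp
      finally show ?thesis .
    qed
    also have "ennreal B * (ennreal (c / t) * (4 * ennreal L)) = ennreal (B * c * 4 * (L / t) powr 1)"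
    proof -
      have "4 * ennreal L = ennreal (4 * L)" using L by (simp add: ennreal_mult)
      then show ?thesis using B c t L by (simp add: powr_one ac_simps flip: ennreal_mult)
    qed
    finally show "emeasure (weight_measure (\<lambda>x. w x * v x powr 1)) {x. ennreal (t * v x) < HL_maximal f x}
        \<le> ennreal (B * c * 4 * (L / t) powr 1)"
      unfolding v1 by (simp add: mult_left_mono)
  qed
  moreover have "0 < B * c * 4" using B c by simp
  ultimately show ?thesis by (rule that[rotated])
qed


lemma A_R_restricted_cell:
  fixes w :: "real ^ 'n \<Rightarrow> real"
  assumes w: "w \<in> A_R_class p" and p: "1 \<le> p"
  obtains B :: real where "0 < B" "\<And>a K P E. P \<in> grid a K \<Longrightarrow> E \<in> sets lebesgue \<Longrightarrow> E \<subseteq> P \<Longrightarrow>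
    vol E * mass w P powr (1 / p)
      \<le> B * vol P * mass w E powr (1 / p)"
proof -
  have wt: "weight w" using w by (simp add: A_R_class_def)
  obtain B :: real where B: "0 < B" "\<And>Q E. Q \<in> cubes \<Longrightarrow> E \<in> sets lebesgue \<Longrightarrow> E \<subseteq> Q \<Longrightarrow>
    vol E * mass w Q powr (1 / p)
      \<le> B * vol Q * mass w E powr (1 / p)"
    by (rule A_R_restricted[OF w p]) blast
  show ?thesis
  proof (rule that[OF B(1)])
    fix a K and P E :: "(real ^ 'n) set"
    assume P: "P \<in> grid a K" and E: "E \<in> sets lebesgue" "E \<subseteq> P"
    obtain k j where P': "P = cell a k j" using P by (auto simp: grid_def)
    obtain Q :: "(real ^ 'n) set" where Q: "Q \<in> cubes" "P \<subseteq> Q" "vol Q = vol P"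
      "mass w Q = mass w P"
      using cell_cube_measure[OF weight_measurable[OF wt], of a k j] wt P' unfolding weight_def by metis
    show "vol E * mass w P powr (1 / p)
        \<le> B * vol P * mass w E powr (1 / p)"
      using B(2)[OF Q(1) E(1)] E(2) Q(2) unfolding Q(3,4) by blast
  qed
qed

text \<open>
  For a characteristic function the restricted condition on \<open>w\<close> can be raised to the power \<open>p\<close>.  It then
  compares \<open>v x powr p * mass w P\<close> with a multiple of \<open>mass w (E \<inter> P)\<close>, which is the situation of the mixed
  estimate with \<open>V = v powr p\<close>.
\<close>
lemma mixed_restricted_bound:
  fixes w :: "real ^ 'n \<Rightarrow> real"
  assumes w: "w \<in> A_R_class p" and p: "1 \<le> p"
  obtains B :: real where "0 < B"
    "\<And>v E s. v \<in> borel_measurable lebesgue \<Longrightarrow> (\<And>x. 0 < v x) \<Longrightarrow>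
      (\<lambda>x. w x * v x powr p) \<in> quant_A_infinity D h \<Longrightarrow> E \<in> sets lebesgue \<Longrightarrow> 0 < s \<Longrightarrow>
      emeasure (weight_measure (\<lambda>x. w x * v x powr p)) {x. ennreal (s * v x) < HL_maximal (indicator E) x}
        \<le> ennreal (B * s powr (- p)) * emeasure (weight_measure w) E"
proof -
  obtain C k where cl: "w \<in> quant_A_infinity C k" by (rule A_R_quant_A_infinity[OF w p])
  obtain A :: real where A: "0 < A" "\<And>a K P E. P \<in> grid a K \<Longrightarrow> E \<in> sets lebesgue \<Longrightarrow> E \<subseteq> P \<Longrightarrow>
    vol E * mass w P powr (1 / p)
      \<le> A * vol P * mass w E powr (1 / p)"
    by (rule A_R_restricted_cell[OF w p]) blast
  obtain B :: real where B: "0 < B"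
    "\<And>V \<nu> T. V \<in> borel_measurable lebesgue \<Longrightarrow> (\<And>x. 0 < V x) \<Longrightarrow>
      (\<lambda>x. w x * V x) \<in> quant_A_infinity D h \<Longrightarrow> sets \<nu> = sets lebesgue \<Longrightarrow>
      (\<And>x. x \<in> T \<Longrightarrow> \<exists>A N. \<exists>P\<in>grid A (- int N). x \<in> P \<and>
        ennreal (V x * mass w P) < emeasure \<nu> P) \<Longrightarrow>
      emeasure (weight_measure (\<lambda>x. w x * V x)) T \<le> ennreal B * emeasure \<nu> UNIV"
    by (rule mixed_weak_type_all_grids[OF cl]) blast
  define a where "a = 6 ^ CARD('n) * A"
  have a: "0 < a" using A by (simp add: a_def)
  show ?thesis
  proof (rule that[of "B * a powr p"])
    show "0 < B * a powr p" using B a by simp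
    fix v :: "real ^ 'n \<Rightarrow> real" and E :: "(real ^ 'n) set" and s :: real
    assume v: "v \<in> borel_measurable lebesgue" "\<And>x. 0 < v x"
      and u: "(\<lambda>x. w x * v x powr p) \<in> quant_A_infinity D h" and E: "E \<in> sets lebesgue" and s: "0 < s"
    note [measurable] = v(1) E
    define c where "c = (a / s) powr p"
    have c: "0 < c" using a s by (simp add: c_def)
    define \<nu> where "\<nu> = density (weight_measure w) (\<lambda>x. ennreal c * indicator E x)"
    have \<nu>: "sets \<nu> = sets lebesgue" by (simp add: \<nu>_def)
    have Ew [measurable]: "E \<in> sets (weight_measure w)" using E by simp
    have \<nu>_eq: "emeasure \<nu> F = ennreal c * emeasure (weight_measure w) (E \<inter> F)"
      if F: "F \<in> sets lebesgue" for F
    proof -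
      have "emeasure \<nu> F = (\<integral>\<^sup>+x. ennreal c * indicator (E \<inter> F) x \<partial>weight_measure w)"
        unfolding \<nu>_def using F
        by (subst emeasure_density) (auto simp: indicator_inter_arith mult.assoc intro!: nn_integral_cong)
      also have "\<dots> = ennreal c * emeasure (weight_measure w) (E \<inter> F)"
        using E F by (intro nn_integral_cmult_indicator) auto
      finally show ?thesis .
    qed
    have "emeasure (weight_measure (\<lambda>x. w x * v x powr p)) {x. ennreal (s * v x) < HL_maximal (indicator E) x}
        \<le> ennreal B * emeasure \<nu> UNIV"
    proof (rule B(2)[OF _ _ u \<nu>])
      show "(\<lambda>x. v x powr p) \<in> borel_measurable lebesgue" by measurable
      show "0 < v x powr p" for x using v(2)[of x] by simp
      fix x assume "x \<in> {x. ennreal (s * v x) < HL_maximal (indicator E) x}"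
      then obtain b N P where P: "P \<in> grid b (- int N)" "x \<in> P" "ennreal (s * v x) * ennreal (vol P)
          < ennreal (6 ^ CARD('n)) * (\<integral>\<^sup>+x\<in>P. ennreal \<bar>indicator E x\<bar> \<partial>lebesgue)"
        by (auto elim: HL_maximal_cell)
      define W where "W = mass w P"
      define l where "l = vol P"
      define e where "e = vol (E \<inter> P)"
      define d where "d = mass w (E \<inter> P)"
      have W: "0 < W" unfolding W_def by (rule quant_A_infinity_cell(2)[OF cl P(1)])
      have l: "0 < l" using P(1) by (auto simp: grid_def l_def measure_cell simp del: measure_completion)
      have Pf: "P \<in> lmeasurable" using P(1) cell_measurable by (auto simp: grid_def)
      have EPf: "E \<inter> P \<in> lmeasurable" by (rule fmeasurableI2[OF Pf]) (use E Pf in auto)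
      have EP: "E \<inter> P \<in> sets lebesgue" using EPf by auto
      have d_eq: "emeasure (weight_measure w) (E \<inter> P) = ennreal d"
        using emeasure_finite_subset[of "E \<inter> P" P "weight_measure w"] quant_A_infinity_cell(1)[OF cl P(1)] Pf
        by (auto simp: d_def emeasure_eq_ennreal_measure less_top)
      have "(\<integral>\<^sup>+x\<in>P. ennreal \<bar>indicator E x\<bar> \<partial>lebesgue) = (\<integral>\<^sup>+x. indicator (E \<inter> P) x \<partial>lebesgue)"
        by (intro nn_integral_cong) (auto simp: indicator_def)
      also have "\<dots> = emeasure lebesgue (E \<inter> P)" using EP by simp
      also have "\<dots> = ennreal e" unfolding e_def by (rule emeasure_eq_measure2[OF EPf])
      finally have "ennreal (s * v x * l) < ennreal (6 ^ CARD('n) * e)"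
        using P(3) s v(2)[of x] unfolding l_def[symmetric] by (simp add: ennreal_mult l less_imp_le e_def)
      then have "s * v x * l < 6 ^ CARD('n) * e"
        using s v(2)[of x] l by (subst (asm) ennreal_less_iff) auto
      then have "s * v x * l * W powr (1 / p) < 6 ^ CARD('n) * e * W powr (1 / p)"
        using W by (intro mult_strict_right_mono) auto
      also have "\<dots> = 6 ^ CARD('n) * (e * W powr (1 / p))" by simp
      also have "\<dots> \<le> 6 ^ CARD('n) * (A * l * d powr (1 / p))"
        unfolding e_def W_def l_def d_def by (intro mult_left_mono A(2)[OF P(1) EP]) auto
      finally have "l * (s * (v x * W powr (1 / p))) < l * (a * d powr (1 / p))"
        by (simp add: a_def ac_simps)
      then have "v x * W powr (1 / p) < a / s * d powr (1 / p)"
        using l s by (simp add: field_simps)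
      then have "(v x * W powr (1 / p)) powr p < (a / s * d powr (1 / p)) powr p"
        using p v(2)[of x] by (intro powr_less_mono2) auto
      also have "(v x * W powr (1 / p)) powr p = v x powr p * W"
        using p v(2)[of x] W by (subst powr_mult) (auto simp: powr_powr)
      also have "(a / s * d powr (1 / p)) powr p = c * d"
        unfolding c_def using p a s by (subst powr_mult) (auto simp: powr_powr d_def)
      finally have "ennreal (v x powr p * W) < ennreal (c * d)"
        using W by (simp add: ennreal_less_iff)
      also have "\<dots> = emeasure \<nu> P"
        using c Pf by (subst \<nu>_eq) (auto simp: d_eq ennreal_mult')
      finally show "\<exists>A N. \<exists>P\<in>grid A (- int N). x \<in> P \<and>
          ennreal (v x powr p * mass w P) < emeasure \<nu> P"
        using P(1,2) unfolding W_def by blast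
    qed
    also have "emeasure \<nu> UNIV = ennreal c * emeasure (weight_measure w) E" using \<nu>_eq[of UNIV] by simp
    also have "ennreal B * (ennreal c * emeasure (weight_measure w) E)
        = ennreal (B * a powr p * s powr (- p)) * emeasure (weight_measure w) E"
    proof -
      have "B * a powr p * s powr (- p) = B * c"
        using a s by (simp add: c_def powr_divide powr_minus_divide)
      then show ?thesis using B c by (simp add: ennreal_mult mult.assoc)
    qed
    finally show "emeasure (weight_measure (\<lambda>x. w x * v x powr p)) {x. ennreal (s * v x)
        < HL_maximal (indicator E) x}
        \<le> ennreal (B * a powr p * s powr (- p)) * emeasure (weight_measure w) E" .
  qed
qed

lemma nn_integral_eq_0_levels:
  fixes g :: "'a \<Rightarrow> real"
  assumes g: "g \<in> borel_measurable \<mu>"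
    and zero: "\<And>y. 0 < y \<Longrightarrow> emeasure \<mu> {x \<in> space \<mu>. y < g x} = 0"
  shows "(\<integral>\<^sup>+x\<in>F. ennreal (g x) \<partial>\<mu>) = 0"
proof -
  have "{x \<in> space \<mu>. 0 < g x} = (\<Union>n. {x \<in> space \<mu>. 1 / real (Suc n) < g x})"
    by (auto intro: less_trans[rotated] elim!: nat_approx_posE)
  moreover have "(\<Union>n. {x \<in> space \<mu>. 1 / real (Suc n) < g x}) \<in> null_sets \<mu>"
    using g zero by (intro null_sets_UN null_setsI) auto
  ultimately have "AE x in \<mu>. \<not> 0 < g x"
    by (intro AE_I'[of "{x \<in> space \<mu>. 0 < g x}"]) auto
  then have "AE x in \<mu>. ennreal (g x) * indicator F x = 0"
    by eventually_elim (simp add: ennreal_neg)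
  then show ?thesis using nn_integral_cong_AE by fastforce
qed

lemma HL_maximal_layers:
  fixes f :: "real ^ 'n \<Rightarrow> real"
  assumes f [measurable]: "f \<in> borel_measurable lebesgue"
  shows "HL_maximal f x \<le> (level_sum (\<lambda>k. ennreal (2 powi (k + 1))
      * HL_maximal (indicator {y. 2 powi k < \<bar>f y\<bar>}) x))"
  unfolding HL_maximal_def[of f]
proof (rule SUP_least)
  fix Q :: "(real ^ 'n) set" assume "Q \<in> {Q \<in> cubes. x \<in> Q}"
  then have Q: "Q \<in> cubes" "x \<in> Q" by auto
  have [measurable]: "Q \<in> sets lebesgue" using cube_lmeasurable[OF Q(1)] by auto
  let ?E = "\<lambda>k :: int. {y. 2 powi k < \<bar>f y\<bar>}"
  have "(\<integral>\<^sup>+y\<in>Q. ennreal \<bar>f y\<bar> \<partial>lebesgue)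
      \<le> (\<integral>\<^sup>+y. (level_sum (\<lambda>k. ennreal (2 powi (k + 1))
          * (indicator {2 powi k <..} \<bar>f y\<bar> * indicator Q y))) \<partial>lebesgue)"
  proof (rule nn_integral_mono)
    fix y
    show "ennreal \<bar>f y\<bar> * indicator Q y
        \<le> (level_sum (\<lambda>k. ennreal (2 powi (k + 1)) * (indicator {2 powi k <..} \<bar>f y\<bar> * indicator Q y)))"
      using dyadic_layers_le[of "f y"] by (cases "y \<in> Q") auto
  qed
  also have "\<dots> = (level_sum (\<lambda>k. (\<integral>\<^sup>+y. ennreal (2 powi (k + 1))
      * (indicator {2 powi k <..} \<bar>f y\<bar> * indicator Q y) \<partial>lebesgue)))"
    by (rule nn_integral_count_space_nn_integral) auto
  also have "\<dots> = (level_sum (\<lambda>k. ennreal (2 powi (k + 1)) * (\<integral>\<^sup>+y\<in>Q. ennreal \<bar>indicator (?E k) y\<bar> \<partial>lebesgue)))"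
  proof (rule nn_integral_cong)
    fix k :: int
    have "(\<integral>\<^sup>+y. ennreal (2 powi (k + 1)) * (indicator {2 powi k <..} \<bar>f y\<bar> * indicator Q y) \<partial>lebesgue)
        = ennreal (2 powi (k + 1)) * (\<integral>\<^sup>+y. indicator {2 powi k <..} \<bar>f y\<bar> * indicator Q y \<partial>lebesgue)"
      by (rule nn_integral_cmult) measurable
    also have "(\<integral>\<^sup>+y. indicator {2 powi k <..} \<bar>f y\<bar> * indicator Q y \<partial>lebesgue)
        = (\<integral>\<^sup>+y\<in>Q. ennreal \<bar>indicator (?E k) y\<bar> \<partial>lebesgue)"
      by (intro nn_integral_cong) (auto simp: indicator_def)
    finally show "(\<integral>\<^sup>+y. ennreal (2 powi (k + 1)) * (indicator {2 powi k <..} \<bar>f y\<bar> * indicator Q y) \<partial>lebesgue)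
      = ennreal (2 powi (k + 1)) * (\<integral>\<^sup>+y\<in>Q. ennreal \<bar>indicator (?E k) y\<bar> \<partial>lebesgue)" .
  qed
  finally have le: "(\<integral>\<^sup>+y\<in>Q. ennreal \<bar>f y\<bar> \<partial>lebesgue)
      \<le> (level_sum (\<lambda>k. ennreal (2 powi (k + 1)) * (\<integral>\<^sup>+y\<in>Q. ennreal \<bar>indicator (?E k) y\<bar> \<partial>lebesgue)))" .
  have "average Q (\<lambda>y. ennreal \<bar>f y\<bar>)
      \<le> (level_sum (\<lambda>k. ennreal (2 powi (k + 1)) * (\<integral>\<^sup>+y\<in>Q. ennreal \<bar>indicator (?E k) y\<bar> \<partial>lebesgue)))
        / emeasure lebesgue Q"
    unfolding average_def by (rule divide_right_mono_ennreal[OF le])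
  also have "\<dots> = (level_sum (\<lambda>k. ennreal (2 powi (k + 1)) * average Q (\<lambda>y. ennreal \<bar>indicator (?E k) y\<bar>)))"
    unfolding average_def by (subst nn_integral_divide[symmetric]) (auto simp: ennreal_times_divide)
  also have "\<dots> \<le> (level_sum (\<lambda>k. ennreal (2 powi (k + 1)) * HL_maximal (indicator (?E k)) x))"
    by (intro nn_integral_mono mult_left_mono average_le_HL_maximal Q) auto
  finally show "average Q (\<lambda>y. ennreal \<bar>f y\<bar>)
    \<le> (level_sum (\<lambda>k. ennreal (2 powi (k + 1)) * HL_maximal (indicator (?E k)) x))" .
qed

lemma HL_maximal_indicator_le_1:
  fixes E :: "(real ^ 'n) set"
  shows "HL_maximal (indicator E) x \<le> 1"
  unfolding HL_maximal_def
proof (rule SUP_least)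
  fix Q :: "(real ^ 'n) set" assume "Q \<in> {Q \<in> cubes. x \<in> Q}"
  then have Q: "Q \<in> cubes" by auto
  have Qm: "Q \<in> sets lebesgue" using cube_lmeasurable[OF Q] by auto
  have "(\<integral>\<^sup>+y\<in>Q. ennreal \<bar>indicator E y\<bar> \<partial>lebesgue) \<le> (\<integral>\<^sup>+y. indicator Q y \<partial>lebesgue)"
    by (intro nn_integral_mono) (auto simp: indicator_def)
  also have "\<dots> = emeasure lebesgue Q" using Qm by simp
  finally have "(\<integral>\<^sup>+y\<in>Q. ennreal \<bar>indicator E y\<bar> \<partial>lebesgue) \<le> emeasure lebesgue Q * 1" by simp
  moreover have "0 < emeasure lebesgue Q"
    using measure_cube_pos[OF Q] by (simp add: measure_def enn2real_positive_iff)
  ultimately show "average Q (\<lambda>y. ennreal \<bar>indicator E y\<bar>) \<le> 1"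
    unfolding average_def by (intro divide_le_posI_ennreal) auto
qed

text \<open>
  Let \<open>F\<close> be a part of finite mass \<open>m\<close> of the level set.  Then \<open>t * m\<close> is at most the integral of \<open>M f / v\<close>
  over \<open>F\<close>.  By sublinearity this is bounded by the sum over the dyadic layers of \<open>f\<close>, and
  Kolmogorov's inequality turns the restricted estimate for each layer into \<open>m powr (1 - 1 / p)\<close> times
  a summand of the Lorentz norm.
\<close>
lemma mixed_maximal_bound_gt_1:
  fixes w :: "real ^ 'n \<Rightarrow> real"
  assumes w: "w \<in> A_R_class p" and p: "1 < p"
  obtains B :: real where "0 < B" "mixed_maximal_bound w p D h B"
proof -
  have wt: "weight w" using w by (simp add: A_R_class_def)
  note wm [measurable] = weight_measurable[OF wt]
  obtain B :: real where B: "0 < B"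
    "\<And>v E s. v \<in> borel_measurable lebesgue \<Longrightarrow> (\<And>x. 0 < v x) \<Longrightarrow>
      (\<lambda>x. w x * v x powr p) \<in> quant_A_infinity D h \<Longrightarrow> E \<in> sets lebesgue \<Longrightarrow> 0 < s \<Longrightarrow>
      emeasure (weight_measure (\<lambda>x. w x * v x powr p)) {x. ennreal (s * v x) < HL_maximal (indicator E) x}
        \<le> ennreal (B * s powr (- p)) * emeasure (weight_measure w) E"
    by (rule mixed_restricted_bound[OF w less_imp_le[OF p]]) blast
  define Ko where "Ko = kolmogorov_const p * B powr (1 / p)"
  have Ko: "0 < Ko" using B kolmogorov_const_pos[OF p] by (simp add: Ko_def)
  have "mixed_maximal_bound w p D h ((4 * Ko) powr p)"
    unfolding mixed_maximal_bound_def
  proof (intro allI impI)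
    fix v f :: "real ^ 'n \<Rightarrow> real" and t L :: real
    assume v: "v \<in> borel_measurable lebesgue" "\<forall>x. 0 < v x"
      and u: "(\<lambda>x. w x * v x powr p) \<in> quant_A_infinity D h" and f: "f \<in> borel_measurable lebesgue"
      and t: "0 < t" and L: "0 < L" "Lorentz_q1_norm p (weight_measure w) (\<lambda>x. ennreal \<bar>f x\<bar>) \<le> ennreal L"
    note [measurable] = v(1) f
    have vp: "0 < v x" for x using v(2) by simp
    let ?U = "weight_measure (\<lambda>x. w x * v x powr p)"
    define E where "E k = {y. 2 powi k < \<bar>f y\<bar>}" for k :: int
    have Em [measurable]: "E k \<in> sets lebesgue" for k
      unfolding E_def sets_weight_measure by (rule sets_lebesgue_Collect) measurable
    let ?c = "\<lambda>k :: int. ennreal (2 powi (k + 1)) * ennreal_power (emeasure (weight_measure w) (E k)) (1 / p)"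
    have dist: "distribution_function (weight_measure w) (\<lambda>x. ennreal \<bar>f x\<bar>) (2 powi k)
        = emeasure (weight_measure w) (E k)" for k :: int
      by (auto simp: distribution_function_def E_def ennreal_less_iff intro!: arg_cong2[where f = emeasure])
    have sum_le: "(level_sum ?c) \<le> ennreal (4 * L)"
    proof -
      have "(level_sum ?c)
          \<le> 4 * Lorentz_q1_norm p (weight_measure w) (\<lambda>x. ennreal \<bar>f x\<bar>)"
        unfolding dist[symmetric] using p by (intro dyadic_levels_Lorentz) (auto simp: weight_measure_def)
      also have "\<dots> \<le> 4 * ennreal L" by (intro mult_left_mono L(2)) simp
      finally show ?thesis using L(1) by (simp add: ennreal_mult)
    qed
    have Efin: "emeasure (weight_measure w) (E k) < \<infinity>" for k
    proof (rule ccontr)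
      assume "\<not> emeasure (weight_measure w) (E k) < \<infinity>"
      then have inf: "emeasure (weight_measure w) (E k) = \<infinity>" by (simp add: top.not_eq_extremum[symmetric])
      have "?c k
          \<le> (level_sum ?c)"
        by (rule nn_integral_ge_point[of k UNIV
              ?c]) simp
      also note sum_le
      finally show False by (simp add: inf ennreal_power_def ennreal_mult_top top_unique)
    qed
    define d where "d k = mass w (E k)" for k
    have d_eq: "emeasure (weight_measure w) (E k) = ennreal (d k)" for k
      using Efin[of k] by (simp add: d_def emeasure_eq_ennreal_measure less_top)
    have d_nonneg: "0 \<le> d k" for k by (simp add: d_def)
    define g where "g k x = enn2real (HL_maximal (indicator (E k)) x) / v x" for k x
    have g_meas [measurable]: "g k \<in> borel_measurable lebesgue" for k unfolding g_def by measurable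
    have gU: "g k \<in> borel_measurable ?U" for k by (simp add: weight_measure_def)
    have g_eq: "HL_maximal (indicator (E k)) x = ennreal (g k x) * ennreal (v x)" for k x
    proof -
      have "HL_maximal (indicator (E k)) x < \<infinity>"
        using HL_maximal_indicator_le_1[of "E k" x] by (rule le_less_trans) simp
      then have "HL_maximal (indicator (E k)) x = ennreal (g k x * v x)"
        using vp[of x] by (simp add: g_def less_top)
      also have "\<dots> = ennreal (g k x) * ennreal (v x)"
        using vp[of x] by (intro ennreal_mult) (auto simp: g_def)
      finally show ?thesis .
    qed
    have weak: "emeasure ?U {x \<in> space ?U. y < g k x} \<le> ennreal (B * d k * y powr (- p))" if y: "0 < y" for k y
    proof -
      have "ennreal (y * v x) < HL_maximal (indicator (E k)) x" if "y < g k x" for x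
      proof -
        have "ennreal (y * v x) < ennreal (g k x * v x)"
          using that y vp[of x] by (subst ennreal_less_iff) auto
        also have "\<dots> = HL_maximal (indicator (E k)) x"
          unfolding g_eq using that y vp[of x] by (intro ennreal_mult) auto
        finally show ?thesis .
      qed
      moreover have "{x. ennreal (y * v x) < HL_maximal (indicator (E k)) x} \<in> sets ?U"
        unfolding sets_weight_measure by (rule sets_lebesgue_Collect) measurable
      ultimately have "emeasure ?U {x \<in> space ?U. y < g k x}
          \<le> emeasure ?U {x. ennreal (y * v x) < HL_maximal (indicator (E k)) x}"
        by (intro emeasure_mono) auto
      also have "\<dots> \<le> ennreal (B * y powr (- p)) * emeasure (weight_measure w) (E k)"
        by (rule B(2)[OF v(1) vp u Em y])
      also have "\<dots> = ennreal (B * d k * y powr (- p))"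
        unfolding d_eq using B d_nonneg by (simp add: ac_simps flip: ennreal_mult)
      finally show ?thesis .
    qed
    let ?T = "{x. ennreal (t * v x) < HL_maximal f x}"
    have T_meas: "?T \<in> sets ?U"
      unfolding sets_weight_measure by (rule sets_lebesgue_Collect) measurable
    have bound: "emeasure ?U F \<le> ennreal ((4 * Ko) powr p * (L / t) powr p)"
      if F: "F \<in> sets ?U" "F \<subseteq> ?T" "emeasure ?U F < \<infinity>" for F
    proof -
      define m where "m = measure ?U F"
      have m: "0 \<le> m" "emeasure ?U F = ennreal m"
        using F(3) by (auto simp: m_def emeasure_eq_ennreal_measure less_top)
      have int: "(\<integral>\<^sup>+x\<in>F. ennreal (g k x) \<partial>?U) \<le> ennreal (Ko * m powr (1 - 1 / p) * d k powr (1 / p))" for k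
      proof (cases "d k = 0")
        case True
        have "(\<integral>\<^sup>+x\<in>F. ennreal (g k x) \<partial>?U) = 0"
          using weak[of _ k] True by (intro nn_integral_eq_0_levels[OF gU]) auto
        then show ?thesis by simp
      next
        case False
        define N where "N = (B * d k) powr (1 / p)"
        have N: "0 < N" using False B d_nonneg[of k] by (simp add: N_def)
        have "(\<integral>\<^sup>+x\<in>F. ennreal (g k x) \<partial>?U) \<le> ennreal (kolmogorov_const p * N * measure ?U F powr (1 - 1 / p))"
        proof (rule kolmogorov_inequality[OF gU F(1,3) p N])
          fix y :: real assume y: "0 < y"
          have "B * d k * y powr (- p) = (N / y) powr p"
            using y N B d_nonneg[of k] p by (simp add: N_def powr_divide powr_powr powr_minus_divide)
          with weak[OF y, of k] show "emeasure ?U {x \<in> space ?U. y < g k x} \<le> ennreal ((N / y) powr p)" by simp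
        qed
        also have "kolmogorov_const p * N * measure ?U F powr (1 - 1 / p)
            = Ko * m powr (1 - 1 / p) * d k powr (1 / p)"
          using B d_nonneg[of k] by (simp add: N_def Ko_def m_def powr_mult)
        finally show ?thesis .
      qed
      have gF: "(\<lambda>x. ennreal (g k x) * indicator F x) \<in> borel_measurable ?U" for k
        by (intro borel_measurable_times_ennreal measurable_compose[OF gU measurable_ennreal]
            borel_measurable_indicator F(1))
      have "ennreal (t * m) = (\<integral>\<^sup>+x\<in>F. ennreal t \<partial>?U)"
        using F t m by (simp add: nn_integral_cmult_indicator ennreal_mult)
      also have "\<dots> \<le> (\<integral>\<^sup>+x. (level_sum (\<lambda>k. ennreal (2 powi (k + 1)) * (ennreal (g k x) * indicator F x))) \<partial>?U)"
      proof (rule nn_integral_mono)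
        fix x
        show "ennreal t * indicator F x \<le> (level_sum (\<lambda>k. ennreal (2 powi (k + 1))
            * (ennreal (g k x) * indicator F x)))"
        proof (cases "x \<in> F")
          case True
          then have "ennreal (t * v x) \<le> HL_maximal f x" using F(2) by (auto intro: less_imp_le)
          also have "\<dots> \<le> (level_sum (\<lambda>k. ennreal (2 powi (k + 1)) * HL_maximal (indicator (E k)) x))"
            unfolding E_def by (rule HL_maximal_layers[OF f])
          also have "\<dots> = (level_sum (\<lambda>k. ennreal (v x) * (ennreal (2 powi (k + 1)) * ennreal (g k x))))"
            unfolding g_eq by (simp add: ac_simps)
          also have "\<dots> = ennreal (v x) * (level_sum (\<lambda>k. ennreal (2 powi (k + 1)) * ennreal (g k x)))"
            by (rule nn_integral_cmult) simp
          finally have "ennreal (v x) * ennreal t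
              \<le> ennreal (v x) * (level_sum (\<lambda>k. ennreal (2 powi (k + 1)) * ennreal (g k x)))"
            using t vp[of x] by (simp add: ennreal_mult mult.commute)
          then have "ennreal t \<le> (level_sum (\<lambda>k. ennreal (2 powi (k + 1)) * ennreal (g k x)))"
            using vp[of x] by (subst (asm) ennreal_mult_le_mult_iff) auto
          with True show ?thesis by simp
        qed simp
      qed
      also have "\<dots> = (level_sum (\<lambda>k. (\<integral>\<^sup>+x. ennreal (2 powi (k + 1)) * (ennreal (g k x) * indicator F x) \<partial>?U)))"
        by (intro nn_integral_count_space_nn_integral countableI_type borel_measurable_times_ennreal gF borel_measurable_const)
      also have "\<dots> = (level_sum (\<lambda>k. ennreal (2 powi (k + 1)) * (\<integral>\<^sup>+x\<in>F. ennreal (g k x) \<partial>?U)))"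
        by (intro nn_integral_cong nn_integral_cmult gF)
      also have "\<dots> \<le> (level_sum (\<lambda>k. ennreal (Ko * m powr (1 - 1 / p)) * (?c k)))"
      proof (rule nn_integral_mono)
        fix k :: int
        have "ennreal (2 powi (k + 1)) * (\<integral>\<^sup>+x\<in>F. ennreal (g k x) \<partial>?U)
            \<le> ennreal (2 powi (k + 1)) * ennreal (Ko * m powr (1 - 1 / p) * d k powr (1 / p))"
          by (intro mult_left_mono int) simp
        also have "\<dots> = ennreal (Ko * m powr (1 - 1 / p))
            * (ennreal (2 powi (k + 1)) * ennreal (d k powr (1 / p)))"
          using Ko by (simp add: ennreal_mult ac_simps)
        also have "ennreal (d k powr (1 / p)) = ennreal_power (emeasure (weight_measure w) (E k)) (1 / p)"
          using d_nonneg[of k] by (simp add: d_eq ennreal_power_def)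
        finally show "ennreal (2 powi (k + 1)) * (\<integral>\<^sup>+x\<in>F. ennreal (g k x) \<partial>?U)
          \<le> ennreal (Ko * m powr (1 - 1 / p)) * (?c k)" .
      qed
      also have "\<dots> = ennreal (Ko * m powr (1 - 1 / p)) * (level_sum ?c)"
        by (rule nn_integral_cmult) simp
      also have "\<dots> \<le> ennreal (Ko * m powr (1 - 1 / p)) * ennreal (4 * L)"
        by (rule mult_left_mono[OF sum_le]) simp
      also have "\<dots> = ennreal (Ko * m powr (1 - 1 / p) * (4 * L))"
        using Ko L by (simp flip: ennreal_mult)
      finally have tm: "t * m \<le> Ko * m powr (1 - 1 / p) * (4 * L)"
        using Ko L by (subst (asm) ennreal_le_iff) auto
      have "m \<le> (4 * Ko) powr p * (L / t) powr p"
      proof (cases "m = 0")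
        case False
        then have mp: "0 < m" using m by simp
        have "m = m powr (1 - 1 / p) * m powr (1 / p)" using mp by (simp flip: powr_add)
        then have "m powr (1 - 1 / p) * (t * m powr (1 / p)) \<le> m powr (1 - 1 / p) * (4 * Ko * L)"
          using tm by (simp add: ac_simps)
        then have "m powr (1 / p) \<le> 4 * Ko * (L / t)"
          using mp t by (simp add: field_simps)
        then have "(m powr (1 / p)) powr p \<le> (4 * Ko * (L / t)) powr p"
          using p by (intro powr_mono2) auto
        also have "(m powr (1 / p)) powr p = m" using p mp by (simp add: powr_powr)
        also have "(4 * Ko * (L / t)) powr p = (4 * Ko) powr p * (L / t) powr p"
          by (rule powr_mult)
        finally show ?thesis .
      qed simp
      then show ?thesis unfolding m(2) by (rule ennreal_leI)
    qed
    define R where "R N = cbox (\<chi> i. - real (Suc N)) (\<chi> i. real (Suc N)) \<inter> ?T" for N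
    have R: "R N \<in> sets ?U" "R N \<subseteq> ?T" "emeasure ?U (R N) < \<infinity>" for N
    proof -
      have "(\<chi> i. real (Suc N)) = (\<chi> i. (\<chi> i. - real (Suc N)) $ i + 2 * real (Suc N))"
        by (simp add: vec_eq_iff)
      then have cube: "cbox (\<chi> i. - real (Suc N)) (\<chi> i. real (Suc N)) \<in> (cubes :: (real ^ 'n) set set)"
        using cubeI[of "2 * real (Suc N)" "(\<chi> i. - real (Suc N)) :: real ^ 'n"] by simp
      then show "R N \<in> sets ?U" using T_meas by (auto simp: R_def)
      show "R N \<subseteq> ?T" by (simp add: R_def)
      show "emeasure ?U (R N) < \<infinity>"
        by (rule emeasure_finite_subset[OF _ _ quant_A_infinity_basic(5)[OF u cube]]) (auto simp: R_def)
    qed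
    have "incseq R"
    proof (intro incseq_SucI subsetI)
      fix N x assume x: "x \<in> R N"
      then have "- real (Suc N) \<le> x $ i \<and> x $ i \<le> real (Suc N)" for i
        by (simp add: R_def mem_box_cart del: of_nat_Suc)
      then have "- real (Suc (Suc N)) \<le> x $ i \<and> x $ i \<le> real (Suc (Suc N))" for i
        by (smt (verit) of_nat_Suc)
      then show "x \<in> R (Suc N)" using x by (simp add: R_def mem_box_cart del: of_nat_Suc)
    qed
    have "?T = (\<Union>N. R N)"
    proof (intro equalityI subsetI)
      fix x assume x: "x \<in> ?T"
      obtain N :: nat where N: "norm x \<le> real N" using real_arch_simple by blast
      have "- real (Suc N) \<le> x $ i \<and> x $ i \<le> real (Suc N)" for i
        using component_le_norm_cart[of x i] N by (simp add: abs_le_iff)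
      then have "x \<in> R N" using x by (simp add: R_def mem_box_cart)
      then show "x \<in> (\<Union>N. R N)" by blast
    qed (use R(2) in blast)
    then have "emeasure ?U ?T = (SUP N. emeasure ?U (R N))"
      using R(1) \<open>incseq R\<close> by (subst SUP_emeasure_incseq) auto
    also have "\<dots> \<le> ennreal ((4 * Ko) powr p * (L / t) powr p)"
      by (intro SUP_least bound R)
    finally show "emeasure ?U ?T \<le> ennreal ((4 * Ko) powr p * (L / t) powr p)" .
  qed
  moreover have "0 < (4 * Ko) powr p" using Ko by simp
  ultimately show ?thesis by (rule that[rotated])
qed

theorem mixed_maximal_bound_A_R:
  fixes w :: "real ^ 'n \<Rightarrow> real"
  assumes w: "w \<in> A_R_class p" and p: "1 \<le> p"
  obtains B :: real where "0 < B" "mixed_maximal_bound w p D h B"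
proof (cases "p = 1")
  case True
  with w mixed_maximal_bound_1[of w D h] that show ?thesis by blast
next
  case False
  with p mixed_maximal_bound_gt_1[OF w, of D h] that show ?thesis by force
qed

section \<open>Dividing by maximal functions\<close>

text \<open>
  This is the mixed estimate with \<open>v = 1\<close>, at levels tending to infinity.
\<close>
lemma HL_maximal_finite_AE:
  fixes w f :: "real ^ 'n \<Rightarrow> real"
  assumes w: "w \<in> A_R_class p" and p: "1 \<le> p" and f [measurable]: "f \<in> borel_measurable lebesgue"
    and fin: "Lorentz_q1_norm p (weight_measure w) (\<lambda>x. ennreal \<bar>f x\<bar>) < \<infinity>"
  shows "AE x in lebesgue. HL_maximal f x < \<infinity>"
proof -
  have wt: "weight w" using w by (simp add: A_R_class_def)
  obtain C k where cl: "w \<in> quant_A_infinity C k" by (rule A_R_quant_A_infinity[OF w p])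
  obtain B where B: "0 < B" "mixed_maximal_bound w p C k B" by (rule mixed_maximal_bound_A_R[OF w p])
  define L where "L = max 1 (enn2real (Lorentz_q1_norm p (weight_measure w) (\<lambda>x. ennreal \<bar>f x\<bar>)))"
  have L: "0 < L" "Lorentz_q1_norm p (weight_measure w) (\<lambda>x. ennreal \<bar>f x\<bar>) \<le> ennreal L"
  proof -
    have "Lorentz_q1_norm p (weight_measure w) (\<lambda>x. ennreal \<bar>f x\<bar>)
        = ennreal (enn2real (Lorentz_q1_norm p (weight_measure w) (\<lambda>x. ennreal \<bar>f x\<bar>)))"
      using fin by (simp add: less_top)
    also have "\<dots> \<le> ennreal L" unfolding L_def by (intro ennreal_leI) simp
    finally show "Lorentz_q1_norm p (weight_measure w) (\<lambda>x. ennreal \<bar>f x\<bar>) \<le> ennreal L" .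
  qed (simp add: L_def)
  let ?I = "{x. HL_maximal f x = \<infinity>}"
  have le: "emeasure (weight_measure w) ?I \<le> ennreal (B * (L / real (Suc n)) powr p)" for n
  proof -
    have "{x. ennreal (real (Suc n) * 1) < HL_maximal f x} = {x \<in> space lebesgue. ennreal (real (Suc n))
        < HL_maximal f x}"
      by simp
    also have "\<dots> \<in> sets lebesgue" by measurable
    finally have meas: "{x. ennreal (real (Suc n) * 1) < HL_maximal f x} \<in> sets (weight_measure w)" by simp
    have "emeasure (weight_measure w) ?I \<le> emeasure (weight_measure w) {x. ennreal (real (Suc n) * 1)
        < HL_maximal f x}"
      by (rule emeasure_mono[OF _ meas]) auto
    also have "\<dots> \<le> ennreal (B * (L / real (Suc n)) powr p)"
      using B(2)[unfolded mixed_maximal_bound_def, rule_format, of "\<lambda>_. 1" f "real (Suc n)" L] cl f L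
      by simp
    finally show ?thesis .
  qed
  have "(\<lambda>n. L / real (Suc n)) \<longlonglongrightarrow> 0"
    by (rule LIMSEQ_Suc) (rule lim_const_over_n)
  then have "(\<lambda>n. (L / real (Suc n)) powr p) \<longlonglongrightarrow> 0"
    by (rule tendsto_zero_powrI[OF _ tendsto_const]) (use L(1) p in auto)
  then have "(\<lambda>n. ennreal (B * (L / real (Suc n)) powr p)) \<longlonglongrightarrow> ennreal (B * 0)"
    by (intro tendsto_intros)
  then have "emeasure (weight_measure w) ?I \<le> 0"
    using LIMSEQ_le_const[of _ "ennreal (B * 0)" "emeasure (weight_measure w) ?I"] le by auto
  moreover have "?I \<in> sets lebesgue"
    unfolding sets_weight_measure by (rule sets_lebesgue_Collect) measurable
  ultimately have "?I \<in> null_sets (weight_measure w)" by (auto simp: null_sets_def)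
  then have "?I \<in> null_sets lebesgue"
    using null_sets_weight_measure[OF weight_measurable[OF wt]] wt by (auto simp: weight_def)
  then show ?thesis
    by (rule AE_I') (auto simp: not_less top_unique)
qed

lemma Lorentz_q1_norm_eq_0D:
  fixes w f :: "real ^ 'n \<Rightarrow> real"
  assumes w: "weight w" and p: "1 \<le> p" and f [measurable]: "f \<in> borel_measurable lebesgue"
    and zero: "Lorentz_q1_norm p (weight_measure w) (\<lambda>x. ennreal \<bar>f x\<bar>) = 0"
  shows "AE x in lebesgue. f x = 0"
proof -
  define E where "E k = {y. 2 powi k < \<bar>f y\<bar>}" for k :: int
  have Em: "E k \<in> sets lebesgue" for k
    unfolding E_def sets_weight_measure by (rule sets_lebesgue_Collect) measurable
  have "E k \<in> null_sets lebesgue" for k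
  proof -
    let ?d = "\<lambda>k :: int. distribution_function (weight_measure w) (\<lambda>x. ennreal \<bar>f x\<bar>) (2 powi k)"
    have "ennreal (2 powi (k + 1)) * ennreal_power (?d k) (1 / p)
        \<le> (level_sum (\<lambda>k. ennreal (2 powi (k + 1)) * ennreal_power (?d k) (1 / p)))"
      by (rule nn_integral_ge_point[of k UNIV "\<lambda>k. ennreal (2 powi (k + 1))
          * ennreal_power (?d k) (1 / p)"]) simp
    also have "\<dots> \<le> 4 * Lorentz_q1_norm p (weight_measure w) (\<lambda>x. ennreal \<bar>f x\<bar>)"
      using p by (intro dyadic_levels_Lorentz) (auto simp: weight_measure_def)
    finally have "ennreal_power (?d k) (1 / p) = 0" by (simp add: zero)
    then have "?d k = 0"
      by (cases "?d k") (auto simp: ennreal_power_def ennreal_eq_0_iff split: if_splits)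
    moreover have "?d k = emeasure (weight_measure w) (E k)"
      by (auto simp: distribution_function_def E_def ennreal_less_iff intro!: arg_cong2[where f = emeasure])
    ultimately have "E k \<in> null_sets (weight_measure w)" using Em by (auto simp: null_sets_def)
    then show ?thesis
      using null_sets_weight_measure[OF weight_measurable[OF w]] w by (auto simp: weight_def)
  qed
  then have "(\<Union>k. E k) \<in> null_sets lebesgue" by (rule null_sets_UN)
  moreover have "{x \<in> space lebesgue. \<not> f x = 0} \<subseteq> (\<Union>k. E k)"
  proof
    fix x assume "x \<in> {x \<in> space lebesgue. \<not> f x = 0}"
    then obtain k :: int where "2 powi k < \<bar>f x\<bar>" using dyadic_scale[of "\<bar>f x\<bar>"] by auto
    then show "x \<in> (\<Union>k. E k)" by (auto simp: E_def)
  qed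
  ultimately show ?thesis by (rule AE_I')
qed

lemma HL_maximal_eq_0:
  fixes f :: "real ^ 'n \<Rightarrow> real"
  assumes "AE x in lebesgue. f x = 0"
  shows "HL_maximal f x = 0"
proof -
  have "average Q (\<lambda>y. ennreal \<bar>f y\<bar>) = 0" for Q
  proof -
    have "(\<integral>\<^sup>+y\<in>Q. ennreal \<bar>f y\<bar> \<partial>lebesgue) = (\<integral>\<^sup>+y. 0 \<partial>(lebesgue :: (real ^ 'n) measure))"
      by (rule nn_integral_cong_AE) (use assms in \<open>eventually_elim, simp\<close>)
    then show ?thesis by (simp add: average_def)
  qed
  then have "HL_maximal f x \<le> 0" unfolding HL_maximal_def by (intro SUP_least) simp
  then show ?thesis by simp
qed

lemma quant_A_infinity_times_prod:
  fixes u :: "real ^ 'n \<Rightarrow> real"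
  assumes J: "finite J" and D: "1 \<le> D" and r: "0 \<le> r" "r \<le> real h" and u: "u \<in> quant_A_infinity C k"
  shows "\<exists>C' k'. \<forall>g :: 'j \<Rightarrow> real ^ 'n \<Rightarrow> real.
    (\<forall>j\<in>J. g j \<in> borel_measurable lebesgue \<and> (\<forall>x. 0 < g j x) \<and> bounded_oscillation D (g j)) \<longrightarrow>
    (\<lambda>x. u x * (\<Prod>j\<in>J. g j x powr (- r))) \<in> quant_A_infinity C' k'"
  using J
proof induction
  case empty
  show ?case using u by (intro exI[of _ C] exI[of _ k]) simp
next
  case (insert a J)
  then obtain C' k' where IH: "\<And>g :: 'j \<Rightarrow> real ^ 'n \<Rightarrow> real.
    (\<forall>j\<in>J. g j \<in> borel_measurable lebesgue \<and> (\<forall>x. 0 < g j x) \<and> bounded_oscillation D (g j)) \<Longrightarrow>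
    (\<lambda>x. u x * (\<Prod>j\<in>J. g j x powr (- r))) \<in> quant_A_infinity C' k'" by blast
  show ?case
  proof (intro exI allI impI)
    fix g :: "'j \<Rightarrow> real ^ 'n \<Rightarrow> real"
    assume g: "\<forall>j\<in>insert a J. g j \<in> borel_measurable lebesgue \<and> (\<forall>x. 0 < g j x) \<and> bounded_oscillation D (g j)"
    have "(\<lambda>x. (u x * (\<Prod>j\<in>J. g j x powr (- r))) * g a x powr (- r))
        \<in> quant_A_infinity (C' * 2 ^ k' * (2 * D) ^ h) (k' + h)"
      using g by (intro quant_A_infinity_times_powr IH D r) auto
    moreover have "(\<lambda>x. (u x * (\<Prod>j\<in>J. g j x powr (- r))) * g a x powr (- r))
        = (\<lambda>x. u x * (\<Prod>j\<in>insert a J. g j x powr (- r)))"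
      using insert.hyps by (simp add: fun_eq_iff ac_simps)
    ultimately show "(\<lambda>x. u x * (\<Prod>j\<in>insert a J. g j x powr (- r)))
        \<in> quant_A_infinity (C' * 2 ^ k' * (2 * D) ^ h) (k' + h)" by simp
  qed
qed

text \<open>
  The order of the quantifiers matters: \<open>B\<close> is fixed before the functions \<open>g j\<close>, which will be maximal
  functions.
\<close>
lemma mixed_maximal_bound_divided:
  fixes w v :: "real ^ 'n \<Rightarrow> real" and J :: "'j set"
  assumes w: "w \<in> A_R_class p" and p: "1 \<le> p" and J: "finite J" and D: "1 \<le> D"
    and v: "v \<in> borel_measurable lebesgue" "\<And>x. 0 < v x"
    and u: "(\<lambda>x. w x * v x powr p) \<in> A_infinity"
  shows "\<exists>B>0. \<forall>g :: 'j \<Rightarrow> real ^ 'n \<Rightarrow> real. \<forall>f t L.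
    (\<forall>j\<in>J. g j \<in> borel_measurable lebesgue \<and> (\<forall>x. 0 < g j x) \<and> bounded_oscillation D (g j)) \<longrightarrow>
    f \<in> borel_measurable lebesgue \<longrightarrow> 0 < t \<longrightarrow> 0 < L \<longrightarrow>
    Lorentz_q1_norm p (weight_measure w) (\<lambda>x. ennreal \<bar>f x\<bar>) \<le> ennreal L \<longrightarrow>
    emeasure (weight_measure (\<lambda>x. w x * (v x / (\<Prod>j\<in>J. g j x)) powr p))
      {x. ennreal (t * (v x / (\<Prod>j\<in>J. g j x))) < HL_maximal f x} \<le> ennreal (B * (L / t) powr p)"
proof -
  obtain C k where u': "(\<lambda>x. w x * v x powr p) \<in> quant_A_infinity C k"
    by (rule A_infinity_quant_A_infinity[OF u])
  have h: "0 \<le> p" "p \<le> real (nat \<lceil>p\<rceil>)" using p by linarith+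
  obtain C' k' where cl: "\<forall>g :: 'j \<Rightarrow> real ^ 'n \<Rightarrow> real.
    (\<forall>j\<in>J. g j \<in> borel_measurable lebesgue \<and> (\<forall>x. 0 < g j x) \<and> bounded_oscillation D (g j)) \<longrightarrow>
    (\<lambda>x. w x * v x powr p * (\<Prod>j\<in>J. g j x powr (- p))) \<in> quant_A_infinity C' k'"
    using quant_A_infinity_times_prod[OF J D h u'] by (elim exE)
  obtain B where B: "0 < B" "mixed_maximal_bound w p C' k' B" by (rule mixed_maximal_bound_A_R[OF w p])
  show ?thesis
  proof (intro exI[of _ B] conjI allI impI B(1))
    fix g :: "'j \<Rightarrow> real ^ 'n \<Rightarrow> real" and f :: "real ^ 'n \<Rightarrow> real" and t L :: real
    assume g: "\<forall>j\<in>J. g j \<in> borel_measurable lebesgue \<and> (\<forall>x. 0 < g j x) \<and> bounded_oscillation D (g j)"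
      and f: "f \<in> borel_measurable lebesgue" and t: "0 < t" and L: "0 < L"
        "Lorentz_q1_norm p (weight_measure w) (\<lambda>x. ennreal \<bar>f x\<bar>) \<le> ennreal L"
    have pos: "0 < (\<Prod>j\<in>J. g j x)" for x using g by (intro prod_pos) auto
    have eq: "w x * (v x / (\<Prod>j\<in>J. g j x)) powr p = w x * v x powr p * (\<Prod>j\<in>J. g j x powr (- p))" for x
    proof -
      show ?thesis
        unfolding prod_powr_distrib[symmetric] unfolding powr_minus_divide using pos[of x] v(2)[of x]
        by (simp add: powr_divide)
    qed
    have "(\<lambda>x. v x / (\<Prod>j\<in>J. g j x)) \<in> borel_measurable lebesgue"
      using v(1) g by (intro borel_measurable_divide borel_measurable_prod) auto
    moreover have "\<forall>x. 0 < v x / (\<Prod>j\<in>J. g j x)" using pos v(2) by simp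
    moreover have "(\<lambda>x. w x * (v x / (\<Prod>j\<in>J. g j x)) powr p) \<in> quant_A_infinity C' k'"
      unfolding eq by (rule cl[THEN spec, THEN mp, OF g])
    ultimately show "emeasure (weight_measure (\<lambda>x. w x * (v x / (\<Prod>j\<in>J. g j x)) powr p))
      {x. ennreal (t * (v x / (\<Prod>j\<in>J. g j x))) < HL_maximal f x} \<le> ennreal (B * (L / t) powr p)"
      using B(2)[unfolded mixed_maximal_bound_def, rule_format, of "\<lambda>x. v x / (\<Prod>j\<in>J. g j x)" f t L] f t L
      by blast
  qed
qed

section \<open>Inequalities for products and weak norms\<close>

lemma weighted_AM_GM:
  fixes z \<theta> :: "'i \<Rightarrow> real"
  assumes "finite I" "\<And>i. i \<in> I \<Longrightarrow> 0 < z i" "\<And>i. i \<in> I \<Longrightarrow> 0 \<le> \<theta> i" "(\<Sum>i\<in>I. \<theta> i) = 1"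
  shows "(\<Prod>i\<in>I. z i powr \<theta> i) \<le> (\<Sum>i\<in>I. \<theta> i * z i)"
proof -
  have "(\<Prod>i\<in>I. z i powr \<theta> i) = (\<Prod>i\<in>I. exp (\<theta> i * ln (z i)))"
    using assms(2) by (intro prod.cong refl) (force simp: powr_def)
  also have "\<dots> = exp (\<Sum>i\<in>I. \<theta> i *\<^sub>R ln (z i))" using assms(1) by (simp add: exp_sum)
  also have "\<dots> \<le> (\<Sum>i\<in>I. \<theta> i * exp (ln (z i)))"
    using assms by (intro convex_on_sum[OF _ _ exp_convex]) auto
  also have "\<dots> = (\<Sum>i\<in>I. \<theta> i * z i)" using assms(2) by (intro sum.cong) auto
  finally show ?thesis .
qed

text \<open>
  Hoelder's inequality with several factors, deduced from the weighted inequality of arithmetic and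
  geometric means for the functions normalised by their bounds \<open>b i\<close>.
\<close>
lemma nn_integral_prod_powr_le:
  fixes H :: "'i \<Rightarrow> 'a \<Rightarrow> real" and b \<theta> :: "'i \<Rightarrow> real"
  assumes I: "finite I" and \<theta>: "\<And>i. i \<in> I \<Longrightarrow> 0 \<le> \<theta> i" "(\<Sum>i\<in>I. \<theta> i) = 1"
    and H: "\<And>i. i \<in> I \<Longrightarrow> H i \<in> borel_measurable M" "\<And>i x. i \<in> I \<Longrightarrow> 0 < H i x"
    and S [measurable]: "S \<in> sets M" and b: "\<And>i. i \<in> I \<Longrightarrow> 0 < b i"
    and le: "\<And>i. i \<in> I \<Longrightarrow> (\<integral>\<^sup>+x\<in>S. ennreal (H i x) \<partial>M) \<le> ennreal (b i)"
  shows "(\<integral>\<^sup>+x\<in>S. ennreal (\<Prod>i\<in>I. H i x powr \<theta> i) \<partial>M) \<le> ennreal (\<Prod>i\<in>I. b i powr \<theta> i)"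
proof -
  define P where "P = (\<Prod>i\<in>I. b i powr \<theta> i)"
  have P: "0 \<le> P" unfolding P_def by (intro prod_nonneg) auto
  have pt: "(\<Prod>i\<in>I. H i x powr \<theta> i) \<le> P * (\<Sum>i\<in>I. \<theta> i / b i * H i x)" for x
  proof -
    have "(\<Prod>i\<in>I. H i x powr \<theta> i) = (\<Prod>i\<in>I. b i powr \<theta> i * (H i x / b i) powr \<theta> i)"
    proof (rule prod.cong[OF refl])
      fix i assume i: "i \<in> I"
      show "H i x powr \<theta> i = b i powr \<theta> i * (H i x / b i) powr \<theta> i"
        using b[OF i] by (simp add: powr_divide)
    qed
    also have "\<dots> = P * (\<Prod>i\<in>I. (H i x / b i) powr \<theta> i)" by (simp add: P_def prod.distrib)
    also have "\<dots> \<le> P * (\<Sum>i\<in>I. \<theta> i * (H i x / b i))"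
      using I \<theta> H(2) b by (intro mult_left_mono weighted_AM_GM P) auto
    finally show ?thesis by simp
  qed
  have "(\<integral>\<^sup>+x\<in>S. ennreal (\<Prod>i\<in>I. H i x powr \<theta> i) \<partial>M)
      \<le> (\<integral>\<^sup>+x. ennreal P * (\<Sum>i\<in>I. ennreal (\<theta> i / b i) * (ennreal (H i x) * indicator S x)) \<partial>M)"
  proof (rule nn_integral_mono)
    fix x
    have nonneg: "0 \<le> \<theta> i / b i * H i x" if "i \<in> I" for i
      using \<theta>(1)[OF that] b[OF that] H(2)[OF that, of x] by simp
    have "ennreal (\<Prod>i\<in>I. H i x powr \<theta> i) \<le> ennreal (P * (\<Sum>i\<in>I. \<theta> i / b i * H i x))"
      by (rule ennreal_leI[OF pt])
    also have "\<dots> = ennreal P * (\<Sum>i\<in>I. ennreal (\<theta> i / b i * H i x))"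
      using P nonneg by (simp add: ennreal_mult' sum_ennreal)
    also have "\<dots> = ennreal P * (\<Sum>i\<in>I. ennreal (\<theta> i / b i) * ennreal (H i x))"
      using \<theta>(1) b by (intro arg_cong[where f = "(*) (ennreal P)"] sum.cong refl ennreal_mult') (auto simp: less_imp_le)
    finally show "ennreal (\<Prod>i\<in>I. H i x powr \<theta> i) * indicator S x
        \<le> ennreal P * (\<Sum>i\<in>I. ennreal (\<theta> i / b i) * (ennreal (H i x) * indicator S x))"
      by (cases "x \<in> S") auto
  qed
  also have "\<dots> = ennreal P * (\<Sum>i\<in>I. ennreal (\<theta> i / b i) * (\<integral>\<^sup>+x\<in>S. ennreal (H i x) \<partial>M))"
    using H(1) by (subst nn_integral_cmult) (auto simp: nn_integral_sum nn_integral_cmult)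
  also have "\<dots> \<le> ennreal P * (\<Sum>i\<in>I. ennreal (\<theta> i / b i) * ennreal (b i))"
    by (intro mult_left_mono sum_mono le) auto
  also have "(\<Sum>i\<in>I. ennreal (\<theta> i / b i) * ennreal (b i)) = (\<Sum>i\<in>I. ennreal (\<theta> i))"
  proof (rule sum.cong[OF refl])
    fix i assume i: "i \<in> I"
    show "ennreal (\<theta> i / b i) * ennreal (b i) = ennreal (\<theta> i)"
      using b[OF i] \<theta>(1)[OF i] by (simp flip: ennreal_mult)
  qed
  also have "\<dots> = 1" using \<theta> by (simp add: sum_ennreal)
  finally show ?thesis by (simp add: P_def)
qed

lemma weak_norm_le:
  assumes p: "0 < p" and K: "0 \<le> K" "0 \<le> L"
    and le: "\<And>y. 0 < y \<Longrightarrow> distribution_function \<mu> g y \<le> ennreal (K * (L / y) powr p)"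
  shows "weak_norm (ennreal p) \<mu> g \<le> ennreal (K powr (1 / p) * L)"
proof -
  have "ennreal y * ennreal_power (distribution_function \<mu> g y) (1 / p) \<le> ennreal (K powr (1 / p) * L)"
    if y: "0 < y" for y
  proof -
    have "ennreal_power (distribution_function \<mu> g y) (1 / p)
        \<le> ennreal_power (ennreal (K * (L / y) powr p)) (1 / p)"
      using p by (intro ennreal_power_mono le y) simp
    also have "\<dots> = ennreal ((K * (L / y) powr p) powr (1 / p))"
      using K by (simp add: ennreal_power_def)
    also have "(K * (L / y) powr p) powr (1 / p) = K powr (1 / p) * (L / y)"
      using K p y by (subst powr_mult) (auto simp: powr_powr)
    finally have "ennreal y * ennreal_power (distribution_function \<mu> g y) (1 / p)
        \<le> ennreal y * ennreal (K powr (1 / p) * (L / y))"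
      by (rule mult_left_mono) simp
    also have "\<dots> = ennreal (K powr (1 / p) * L)"
      using y K by (simp flip: ennreal_mult)
    finally show ?thesis .
  qed
  then show ?thesis using p by (auto simp: weak_norm_def intro!: SUP_least)
qed

section \<open>The product of maximal functions\<close>

lemma prod_mono_ennreal:
  fixes f g :: "'i \<Rightarrow> ennreal"
  assumes "\<And>i. i \<in> I \<Longrightarrow> f i \<le> g i"
  shows "(\<Prod>i\<in>I. f i) \<le> (\<Prod>i\<in>I. g i)"
  using assms by (induction I rule: infinite_finite_induct) (auto intro: mult_mono)

lemma multi_maximal_le_tensor:
  fixes f :: "nat \<Rightarrow> real ^ 'n \<Rightarrow> real"
  shows "multi_maximal m f x \<le> HL_maximal_tensor m f x"
  unfolding multi_maximal_def HL_maximal_tensor_def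
proof (rule SUP_least)
  fix Q :: "(real ^ 'n) set" assume Q: "Q \<in> cubes"
  show "(\<Prod>i = 1..m. average Q (\<lambda>y. ennreal \<bar>f i y\<bar>)) * indicator Q x \<le> (\<Prod>i = 1..m. HL_maximal (f i) x)"
    using average_le_HL_maximal[OF Q] by (cases "x \<in> Q") (auto intro!: prod_mono_ennreal)
qed

lemma weak_norm_mono:
  assumes p: "0 \<le> p" and g: "g \<in> borel_measurable \<mu>" and le: "\<And>x. x \<in> space \<mu> \<Longrightarrow> f x \<le> g x"
  shows "weak_norm (ennreal p) \<mu> f \<le> weak_norm (ennreal p) \<mu> g"
proof -
  have "distribution_function \<mu> f y \<le> distribution_function \<mu> g y" for y
    unfolding distribution_function_def using g le
    by (intro emeasure_mono) (auto intro: less_le_trans)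
  then have "ennreal y * ennreal_power (distribution_function \<mu> f y) (1 / p)
      \<le> ennreal y * ennreal_power (distribution_function \<mu> g y) (1 / p)" for y
    using p by (intro mult_left_mono ennreal_power_mono) auto
  then show ?thesis using p by (auto simp: weak_norm_def intro!: SUP_mono)
qed

lemma prod_ennreal_eq_top:
  fixes f :: "'i \<Rightarrow> ennreal"
  assumes "finite I" "i \<in> I" "f i = \<infinity>" "\<And>j. j \<in> I \<Longrightarrow> f j \<noteq> 0"
  shows "(\<Prod>j\<in>I. f j) = \<infinity>"
proof -
  have "(\<Prod>j\<in>I. f j) = f i * (\<Prod>j\<in>I - {i}. f j)" using assms(1,2) by (rule prod.remove)
  moreover have "(\<Prod>j\<in>I - {i}. f j) \<noteq> 0" using assms by (auto simp: prod_zero_iff)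
  ultimately show ?thesis using assms(3) by (simp add: ennreal_top_mult)
qed

text \<open>
  Put \<open>V i = v / (\<Prod>j \<noteq> i. g j)\<close> and \<open>H i = w i * V i powr p i\<close>.
  Hoelder's inequality with the exponents \<open>p\<^sub>0 / p i\<close> bounds the integral of
  \<open>\<Prod>i. H i powr (p\<^sub>0 / p i)\<close> by the given bounds for the single weights.  This product differs from
  the weight in question by a power of \<open>G / v\<close>, which is at most \<open>2 * s\<close> on \<open>S\<close>.
\<close>
lemma tensor_level_bound:
  fixes m :: nat and p B L :: "nat \<Rightarrow> real" and p\<^sub>0 s :: real
    and w g :: "nat \<Rightarrow> real ^ 'n \<Rightarrow> real" and v :: "real ^ 'n \<Rightarrow> real"
  defines "G \<equiv> \<lambda>x. \<Prod>i=1..m. g i x"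
  assumes m: "1 \<le> m" and p: "\<And>i. i \<in> {1..m} \<Longrightarrow> 1 \<le> p i" and p0: "0 < p\<^sub>0" "1 / p\<^sub>0 = (\<Sum>i=1..m. 1 / p i)"
    and w: "\<And>i. i \<in> {1..m} \<Longrightarrow> w i \<in> borel_measurable lebesgue" "\<And>i x. i \<in> {1..m} \<Longrightarrow> 0 < w i x"
    and g: "\<And>i. i \<in> {1..m} \<Longrightarrow> g i \<in> borel_measurable lebesgue" "\<And>i x. i \<in> {1..m} \<Longrightarrow> 0 < g i x"
    and v: "v \<in> borel_measurable lebesgue" "\<And>x. 0 < v x"
    and BL: "\<And>i. i \<in> {1..m} \<Longrightarrow> 0 < B i" "\<And>i. i \<in> {1..m} \<Longrightarrow> 0 < L i" and s: "0 < s"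
    and S: "S \<in> sets lebesgue" "\<And>x. x \<in> S \<Longrightarrow> G x \<le> 2 * s * v x"
    and bound: "\<And>i. i \<in> {1..m} \<Longrightarrow>
      emeasure (weight_measure (\<lambda>x. w i x * (v x / (\<Prod>j\<in>{1..m} - {i}. g j x)) powr p i)) S
        \<le> ennreal (B i * (L i / s) powr p i)"
  shows "emeasure (weight_measure (\<lambda>x. (\<Prod>i=1..m. w i x powr (p\<^sub>0 / p i)) * v x powr p\<^sub>0)) S
    \<le> ennreal ((2 powr p\<^sub>0) ^ (m - 1) * (\<Prod>i=1..m. B i powr (p\<^sub>0 / p i)) * ((\<Prod>i=1..m. L i) / s) powr p\<^sub>0)"
proof -
  let ?I = "{1..m}"
  define \<theta> where "\<theta> i = p\<^sub>0 / p i" for i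
  define V where "V i x = v x / (\<Prod>j\<in>?I - {i}. g j x)" for i x
  define H where "H i x = w i x * V i x powr p i" for i x
  have \<theta>: "0 \<le> \<theta> i" if "i \<in> ?I" for i using p[OF that] p0 by (simp add: \<theta>_def)
  have "(\<Sum>i\<in>?I. \<theta> i) = p\<^sub>0 * (\<Sum>i\<in>?I. 1 / p i)" by (simp add: \<theta>_def sum_distrib_left)
  then have \<theta>_sum: "(\<Sum>i\<in>?I. \<theta> i) = 1" unfolding p0(2)[symmetric] using p0(1) by simp
  have Gp: "0 < G x" for x unfolding G_def using g(2) by (intro prod_pos) auto
  have rest: "0 < (\<Prod>j\<in>?I - {i}. g j x)" for i x using g(2) by (intro prod_pos) auto
  have Vp: "0 < V i x" for i x using v(2) rest by (simp add: V_def)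
  have V_eq: "V i x = v x * g i x / G x" if "i \<in> ?I" for i x
  proof -
    have "G x = g i x * (\<Prod>j\<in>?I - {i}. g j x)"
      unfolding G_def using that by (intro prod.remove) auto
    then show ?thesis using g(2)[OF that, of x] rest[of x i] by (simp add: V_def)
  qed
  have [measurable]: "V i \<in> borel_measurable lebesgue" if "i \<in> ?I" for i
    unfolding V_def using v(1) g(1) by (intro borel_measurable_divide borel_measurable_prod) auto
  have Hm: "H i \<in> borel_measurable lebesgue" if "i \<in> ?I" for i
    unfolding H_def using w(1)[OF that] that by measurable
  have Hp: "0 < H i x" if "i \<in> ?I" for i x
    using w(2)[OF that, of x] Vp[of i x] by (simp add: H_def)
  \<comment> \<open>The factors \<open>V i\<close> have product \<open>v ^ m / G ^ (m - 1)\<close>, and \<open>G / v\<close> is at most \<open>2 * s\<close> on \<open>S\<close>.\<close>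
  have pt: "(\<Prod>i\<in>?I. w i x powr \<theta> i) * v x powr p\<^sub>0
      \<le> ((2 * s) powr p\<^sub>0) ^ (m - 1) * (\<Prod>i\<in>?I. H i x powr \<theta> i)" if x: "x \<in> S" for x
  proof -
    have "(\<Prod>i\<in>?I. V i x) = (\<Prod>i\<in>?I. v x / G x * g i x)"
      by (intro prod.cong refl) (simp add: V_eq)
    also have "\<dots> = (\<Prod>i\<in>?I. v x / G x) * (\<Prod>i\<in>?I. g i x)" by (rule prod.distrib)
    also have "\<dots> = (v x / G x) ^ m * G x" by (simp add: G_def)
    also have "\<dots> = (v x / G x) ^ (m - 1) * v x"
      using m Gp[of x] by (cases m) auto
    finally have "v x = (G x / v x) ^ (m - 1) * (\<Prod>i\<in>?I. V i x)"
      using Gp[of x] v(2)[of x] by (simp add: power_divide)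
    then have "v x powr p\<^sub>0 = ((G x / v x) ^ (m - 1)) powr p\<^sub>0 * (\<Prod>i\<in>?I. V i x) powr p\<^sub>0"
      by (metis powr_mult)
    also have "((G x / v x) ^ (m - 1)) powr p\<^sub>0 = ((G x / v x) powr p\<^sub>0) ^ (m - 1)"
      using Gp[of x] v(2)[of x] by (simp add: powr_power powr_powr mult.commute flip: powr_realpow)
    finally have v_eq: "v x powr p\<^sub>0 = ((G x / v x) powr p\<^sub>0) ^ (m - 1) * (\<Prod>i\<in>?I. V i x) powr p\<^sub>0" .
    have "G x / v x \<le> 2 * s" using S(2)[OF x] v(2)[of x] by (simp add: pos_divide_le_eq)
    then have "((G x / v x) powr p\<^sub>0) ^ (m - 1) \<le> ((2 * s) powr p\<^sub>0) ^ (m - 1)"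
      using Gp[of x] v(2)[of x] p0 by (intro power_mono powr_mono2) auto
    then have le: "((G x / v x) powr p\<^sub>0) ^ (m - 1) * ((\<Prod>i\<in>?I. w i x powr \<theta> i) * (\<Prod>i\<in>?I. V i x) powr p\<^sub>0)
        \<le> ((2 * s) powr p\<^sub>0) ^ (m - 1) * ((\<Prod>i\<in>?I. w i x powr \<theta> i) * (\<Prod>i\<in>?I. V i x) powr p\<^sub>0)"
      by (intro mult_right_mono mult_nonneg_nonneg prod_nonneg) auto
    have HV: "(\<Prod>i\<in>?I. w i x powr \<theta> i) * (\<Prod>i\<in>?I. V i x) powr p\<^sub>0 = (\<Prod>i\<in>?I. H i x powr \<theta> i)"
    proof -
      have "H i x powr \<theta> i = w i x powr \<theta> i * V i x powr p\<^sub>0" if "i \<in> ?I" for i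
        using p[OF that] by (simp add: H_def powr_mult powr_powr \<theta>_def)
      then have "(\<Prod>i\<in>?I. H i x powr \<theta> i) = (\<Prod>i\<in>?I. w i x powr \<theta> i * V i x powr p\<^sub>0)"
        by (intro prod.cong) auto
      then show ?thesis by (simp add: prod.distrib prod_powr_distrib)
    qed
    show ?thesis unfolding v_eq HV[symmetric] using le by (simp add: ac_simps)
  qed
  define c where "c = ((2 * s) powr p\<^sub>0) ^ (m - 1)"
  define b where "b i = B i * (L i / s) powr p i" for i
  have b: "0 < b i" if "i \<in> ?I" for i using BL[OF that] s by (simp add: b_def)
  have wm: "(\<lambda>x. \<Prod>i\<in>?I. w i x powr \<theta> i) \<in> borel_measurable lebesgue"
    using w(1) by (intro borel_measurable_prod powr_real_measurable) auto
  have "emeasure (weight_measure (\<lambda>x. (\<Prod>i\<in>?I. w i x powr \<theta> i) * v x powr p\<^sub>0)) S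
      = (\<integral>\<^sup>+x\<in>S. ennreal ((\<Prod>i\<in>?I. w i x powr \<theta> i) * v x powr p\<^sub>0) \<partial>lebesgue)"
    using wm v(1) S(1) by (intro emeasure_weight_measure borel_measurable_times powr_real_measurable) auto
  also have "\<dots> \<le> (\<integral>\<^sup>+x. ennreal c * (ennreal (\<Prod>i\<in>?I. H i x powr \<theta> i) * indicator S x) \<partial>lebesgue)"
  proof (rule nn_integral_mono)
    fix x
    show "ennreal ((\<Prod>i\<in>?I. w i x powr \<theta> i) * v x powr p\<^sub>0) * indicator S x
        \<le> ennreal c * (ennreal (\<Prod>i\<in>?I. H i x powr \<theta> i) * indicator S x)"
    proof (cases "x \<in> S")
      case True
      have "ennreal ((\<Prod>i\<in>?I. w i x powr \<theta> i) * v x powr p\<^sub>0) \<le> ennreal (c * (\<Prod>i\<in>?I. H i x powr \<theta> i))"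
        unfolding c_def by (intro ennreal_leI pt True)
      also have "\<dots> = ennreal c * ennreal (\<Prod>i\<in>?I. H i x powr \<theta> i)"
        by (rule ennreal_mult') (simp add: c_def)
      finally show ?thesis using True by simp
    qed simp
  qed
  also have "\<dots> = ennreal c * (\<integral>\<^sup>+x\<in>S. ennreal (\<Prod>i\<in>?I. H i x powr \<theta> i) \<partial>lebesgue)"
  proof (rule nn_integral_cmult)
    have "(\<lambda>x. \<Prod>i\<in>?I. H i x powr \<theta> i) \<in> borel_measurable lebesgue"
      using Hm by (intro borel_measurable_prod powr_real_measurable) auto
    then show "(\<lambda>x. ennreal (\<Prod>i\<in>?I. H i x powr \<theta> i) * indicator S x) \<in> borel_measurable lebesgue"
      using S(1) by measurable
  qed
  also have "\<dots> \<le> ennreal c * ennreal (\<Prod>i\<in>?I. b i powr \<theta> i)"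
  proof (intro mult_left_mono nn_integral_prod_powr_le \<theta> \<theta>_sum Hm Hp S(1) b)
    fix i assume i: "i \<in> ?I"
    have "(\<integral>\<^sup>+x\<in>S. ennreal (H i x) \<partial>lebesgue) = emeasure (weight_measure (H i)) S"
      by (rule emeasure_weight_measure[OF Hm[OF i] S(1), symmetric])
    then show "(\<integral>\<^sup>+x\<in>S. ennreal (H i x) \<partial>lebesgue) \<le> ennreal (b i)"
      using bound[OF i] by (simp add: H_def[abs_def] V_def b_def)
  qed auto
  also have "\<dots> = ennreal (c * (\<Prod>i\<in>?I. b i powr \<theta> i))"
    by (rule ennreal_mult'[symmetric]) (simp add: c_def)
  also have "c * (\<Prod>i\<in>?I. b i powr \<theta> i)
      = (2 powr p\<^sub>0) ^ (m - 1) * (\<Prod>i\<in>?I. B i powr \<theta> i) * ((\<Prod>i\<in>?I. L i) / s) powr p\<^sub>0"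
  proof -
    have "b i powr \<theta> i = B i powr \<theta> i * (L i powr p\<^sub>0 / s powr p\<^sub>0)" if "i \<in> ?I" for i
      using p[OF that] by (simp add: b_def powr_mult powr_powr powr_divide \<theta>_def)
    then have "(\<Prod>i\<in>?I. b i powr \<theta> i) = (\<Prod>i\<in>?I. B i powr \<theta> i * (L i powr p\<^sub>0 / s powr p\<^sub>0))"
      by (intro prod.cong) auto
    also have "\<dots> = (\<Prod>i\<in>?I. B i powr \<theta> i) * ((\<Prod>i\<in>?I. L i) powr p\<^sub>0 / (s powr p\<^sub>0) ^ m)"
      by (simp add: prod.distrib prod_dividef prod_powr_distrib)
    also have "(s powr p\<^sub>0) ^ m = (s powr p\<^sub>0) ^ (m - 1) * s powr p\<^sub>0" using m by (cases m) auto
    finally show ?thesis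
      using s by (simp add: c_def powr_mult powr_divide power_mult_distrib)
  qed
  finally show ?thesis by (simp add: \<theta>_def)
qed

text \<open>
  The level set is the union of the shells where \<open>G / v\<close> lies between \<open>2 ^ k * y\<close> and
  \<open>2 * 2 ^ k * y\<close>.  On a shell the condition \<open>2 ^ k * y * v < G\<close> says that \<open>g i\<close> exceeds
  \<open>2 ^ k * y * v / (\<Prod>j \<noteq> i. g j)\<close>, for each \<open>i\<close>; the bounds for the shells form a geometric series.
\<close>
lemma tensor_distribution_bound:
  fixes m :: nat and p B L :: "nat \<Rightarrow> real" and p\<^sub>0 y :: real
    and w g :: "nat \<Rightarrow> real ^ 'n \<Rightarrow> real" and v :: "real ^ 'n \<Rightarrow> real"
  defines "G \<equiv> \<lambda>x. \<Prod>i=1..m. g i x"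
  assumes m: "1 \<le> m" and p: "\<And>i. i \<in> {1..m} \<Longrightarrow> 1 \<le> p i" and p0: "0 < p\<^sub>0" "1 / p\<^sub>0 = (\<Sum>i=1..m. 1 / p i)"
    and w: "\<And>i. i \<in> {1..m} \<Longrightarrow> w i \<in> borel_measurable lebesgue" "\<And>i x. i \<in> {1..m} \<Longrightarrow> 0 < w i x"
    and g: "\<And>i. i \<in> {1..m} \<Longrightarrow> g i \<in> borel_measurable lebesgue" "\<And>i x. i \<in> {1..m} \<Longrightarrow> 0 < g i x"
    and v: "v \<in> borel_measurable lebesgue" "\<And>x. 0 < v x"
    and BL: "\<And>i. i \<in> {1..m} \<Longrightarrow> 0 < B i" "\<And>i. i \<in> {1..m} \<Longrightarrow> 0 < L i" and y: "0 < y"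
    and bound: "\<And>i s. i \<in> {1..m} \<Longrightarrow> 0 < s \<Longrightarrow>
      emeasure (weight_measure (\<lambda>x. w i x * (v x / (\<Prod>j\<in>{1..m} - {i}. g j x)) powr p i))
          {x. s * (v x / (\<Prod>j\<in>{1..m} - {i}. g j x)) < g i x}
        \<le> ennreal (B i * (L i / s) powr p i)"
  shows "emeasure (weight_measure (\<lambda>x. (\<Prod>i=1..m. w i x powr (p\<^sub>0 / p i)) * v x powr p\<^sub>0)) {x. y * v x < G x}
    \<le> ennreal ((2 powr p\<^sub>0) ^ (m - 1) * (\<Prod>i=1..m. B i powr (p\<^sub>0 / p i)) / (1 - 2 powr - p\<^sub>0)
        * ((\<Prod>i=1..m. L i) / y) powr p\<^sub>0)"
proof -
  let ?I = "{1..m}" and ?N = "weight_measure (\<lambda>x. (\<Prod>i=1..m. w i x powr (p\<^sub>0 / p i)) * v x powr p\<^sub>0)"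
  note [measurable] = v(1)
  have Gm [measurable]: "G \<in> borel_measurable lebesgue"
    unfolding G_def using g(1) by (intro borel_measurable_prod) auto
  define M where "M = (2 powr p\<^sub>0) ^ (m - 1) * (\<Prod>i=1..m. B i powr (p\<^sub>0 / p i))"
  define \<Lambda> where "\<Lambda> = (\<Prod>i=1..m. L i)"
  have M: "0 \<le> M" unfolding M_def by (intro mult_nonneg_nonneg prod_nonneg) auto
  have \<Lambda>: "0 < \<Lambda>" unfolding \<Lambda>_def using BL(2) by (intro prod_pos) auto
  define S where "S k = {x. 2 ^ k * y * v x < G x \<and> G x \<le> 2 * (2 ^ k * y) * v x}" for k :: nat
  have S_meas: "S k \<in> sets lebesgue" for k
    unfolding S_def sets_weight_measure by (rule sets_lebesgue_Collect) measurable
  have level: "emeasure ?N (S k) \<le> ennreal (M * (\<Lambda> / (2 ^ k * y)) powr p\<^sub>0)" for k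
    unfolding M_def \<Lambda>_def
  proof (rule tensor_level_bound[OF m p p0 w g v BL])
    show "0 < 2 ^ k * y" using y by simp
    show "(\<Prod>i=1..m. g i x) \<le> 2 * (2 ^ k * y) * v x" if "x \<in> S k" for x
      using that by (simp add: S_def G_def)
    fix i assume i: "i \<in> ?I"
    have rest: "0 < (\<Prod>j\<in>?I - {i}. g j x)" for x using g(2) by (intro prod_pos) auto
    have G_eq: "G x = g i x * (\<Prod>j\<in>?I - {i}. g j x)" for x
      unfolding G_def using i by (intro prod.remove) auto
    let ?T = "{x. 2 ^ k * y * (v x / (\<Prod>j\<in>?I - {i}. g j x)) < g i x}"
    have "?T \<in> sets lebesgue"
    proof -
      have [measurable]: "(\<lambda>x. \<Prod>j\<in>?I - {i}. g j x) \<in> borel_measurable lebesgue"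
        using g(1) by (intro borel_measurable_prod) auto
      note [measurable] = g(1)[OF i]
      have "?T = {x \<in> space lebesgue. 2 ^ k * y * (v x / (\<Prod>j\<in>?I - {i}. g j x)) < g i x}" by simp
      also have "\<dots> \<in> sets lebesgue" by measurable
      finally show ?thesis .
    qed
    moreover have "S k \<subseteq> ?T" using rest by (auto simp: S_def G_eq pos_divide_less_eq)
    ultimately show "emeasure (weight_measure (\<lambda>x. w i x * (v x / (\<Prod>j\<in>?I - {i}. g j x)) powr p i)) (S k)
        \<le> ennreal (B i * (L i / (2 ^ k * y)) powr p i)"
      by (intro order_trans[OF emeasure_mono bound[OF i]]) (use y in auto)
  qed (use S_meas in auto)
  have "{x. y * v x < G x} \<subseteq> (\<Union>k. S k)"
  proof
    fix x assume "x \<in> {x. y * v x < G x}"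
    then have "1 < G x / (y * v x)" using y v(2)[of x] by simp
    moreover obtain n where n: "G x / (y * v x) < 2 ^ n" using real_arch_pow[of 2] by auto
    define l where "l = (LEAST n. G x / (y * v x) \<le> 2 ^ n)"
    have l: "G x / (y * v x) \<le> 2 ^ l" unfolding l_def by (rule LeastI[of _ n]) (use n in simp)
    ultimately have "l \<noteq> 0" by (intro notI) simp
    then obtain k where k: "l = Suc k" by (cases l) auto
    then have "\<not> G x / (y * v x) \<le> 2 ^ k" using not_less_Least[of k "\<lambda>n. G x / (y * v x)
        \<le> 2 ^ n"] unfolding l_def by simp
    then have "x \<in> S k" using l y v(2)[of x] unfolding S_def k
      by (simp add: pos_divide_le_eq not_le pos_less_divide_eq mult.assoc)
    then show "x \<in> (\<Union>k. S k)" by blast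
  qed
  then have "emeasure ?N {x. y * v x < G x} \<le> emeasure ?N (\<Union>k. S k)"
    using S_meas by (intro emeasure_mono) auto
  also have "\<dots> \<le> (\<Sum>k. emeasure ?N (S k))"
    using S_meas by (intro emeasure_subadditive_countably) auto
  also have "\<dots> \<le> (\<Sum>k. ennreal (M * (\<Lambda> / (2 ^ k * y)) powr p\<^sub>0))"
    by (intro suminf_le level) auto
  also have "\<dots> = (\<Sum>k. ennreal (M * (\<Lambda> / y) powr p\<^sub>0 * (2 powr - p\<^sub>0) ^ k))"
  proof -
    have "M * (\<Lambda> / (2 ^ k * y)) powr p\<^sub>0 = M * (\<Lambda> / y) powr p\<^sub>0 * (2 powr - p\<^sub>0) ^ k" for k
    proof -
      have "(2 powr - p\<^sub>0) ^ k = 1 / (2 ^ k) powr p\<^sub>0"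
      proof -
        have "(2 powr - p\<^sub>0) ^ k = 2 powr - (real k * p\<^sub>0)" by (simp add: powr_power mult.commute)
        also have "\<dots> = 1 / 2 powr (real k * p\<^sub>0)" by (rule powr_minus_divide)
        also have "2 powr (real k * p\<^sub>0) = (2 ^ k) powr p\<^sub>0"
          by (simp add: powr_powr flip: powr_realpow)
        finally show ?thesis .
      qed
      then show ?thesis by (simp add: powr_divide powr_mult)
    qed
    then show ?thesis by (simp only:)
  qed
  also have "\<dots> = ennreal (\<Sum>k. M * (\<Lambda> / y) powr p\<^sub>0 * (2 powr - p\<^sub>0) ^ k)"
    using M p0 by (intro suminf_ennreal2 summable_mult summable_geometric) (auto simp: powr_less_one)
  also have "(\<Sum>k. M * (\<Lambda> / y) powr p\<^sub>0 * (2 powr - p\<^sub>0) ^ k) = M / (1 - 2 powr - p\<^sub>0) * (\<Lambda> / y) powr p\<^sub>0"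
    using p0 by (subst suminf_mult) (auto simp: suminf_geometric summable_geometric powr_less_one)
  finally show ?thesis unfolding M_def \<Lambda>_def .
qed

theorem theorem4p2:
  fixes m :: nat and p :: "nat \<Rightarrow> real" and p\<^sub>0 :: real
    and w :: "nat \<Rightarrow> real ^ 'n \<Rightarrow> real" and v \<nu> :: "real ^ 'n \<Rightarrow> real"
  assumes "1 \<le> m"
    and "\<And>i. i \<in> {1..m} \<Longrightarrow> 1 \<le> p i"
    and "1 / p\<^sub>0 = (\<Sum>i=1..m. 1 / p i)"
    and "\<And>i. i \<in> {1..m} \<Longrightarrow> weight (w i)"
    and "\<And>i. i \<in> {1..m} \<Longrightarrow> w i \<in> A_R_class (p i)"
    and "\<And>x. \<nu> x = (\<Prod>i=1..m. w i x powr (p\<^sub>0 / p i))"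
    and "weight v"
    and "weight (\<lambda>x. \<nu> x * v x powr p\<^sub>0)"
    and "\<And>i. i \<in> {1..m} \<Longrightarrow> (\<lambda>x. w i x * v x powr p i) \<in> A_infinity"
  shows "\<exists>C::real. C > 0 \<and>
    (\<forall>f :: nat \<Rightarrow> real ^ 'n \<Rightarrow> real.
      (\<forall>i\<in>{1..m}. f i \<in> borel_measurable lebesgue) \<longrightarrow>
        weak_norm (ennreal p\<^sub>0) (weight_measure (\<lambda>x. \<nu> x * v x powr p\<^sub>0))
            (\<lambda>x. multi_maximal m f x / ennreal (v x))
          \<le> weak_norm (ennreal p\<^sub>0) (weight_measure (\<lambda>x. \<nu> x * v x powr p\<^sub>0))
            (\<lambda>x. HL_maximal_tensor m f x / ennreal (v x))
        \<and> weak_norm (ennreal p\<^sub>0) (weight_measure (\<lambda>x. \<nu> x * v x powr p\<^sub>0))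
            (\<lambda>x. HL_maximal_tensor m f x / ennreal (v x))
          \<le> ennreal C *
            (\<Prod>i=1..m. Lorentz_q1_norm (p i) (weight_measure (w i)) (\<lambda>x. ennreal \<bar>f i x\<bar>)))"
proof -
  note m = assms(1) and p = assms(2) and wt = assms(4) and AR = assms(5) and \<nu> = assms(6)
  let ?I = "{1..m}"
  let ?u = "\<lambda>x. \<nu> x * v x powr p\<^sub>0"
  let ?N = "weight_measure ?u"
  define D :: real where "D = 36 ^ CARD('n)"
  have D: "1 \<le> D" unfolding D_def by simp
  have "0 < (\<Sum>i\<in>?I. 1 / p i)" using m p by (intro sum_pos) (auto intro: less_le_trans[OF zero_less_one])
  then have p0: "0 < p\<^sub>0" using assms(3) by (metis zero_less_divide_1_iff)
  have v: "v \<in> borel_measurable lebesgue" "\<And>x. 0 < v x"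
    using weight_measurable[OF assms(7)] assms(7) by (auto simp: weight_def)
  note [measurable] = v(1)
  have w: "w i \<in> borel_measurable lebesgue" "0 < w i x" if "i \<in> ?I" for i x
    using weight_measurable[OF wt[OF that]] wt[OF that] by (auto simp: weight_def)
  have um: "?u \<in> borel_measurable lebesgue" by (rule weight_measurable[OF assms(8)])
  have up: "0 < ?u x" for x using assms(8) by (simp add: weight_def)
  have "\<forall>i\<in>?I. \<exists>B>0. \<forall>g :: nat \<Rightarrow> real ^ 'n \<Rightarrow> real. \<forall>f t L.
    (\<forall>j\<in>?I - {i}. g j \<in> borel_measurable lebesgue \<and> (\<forall>x. 0 < g j x) \<and> bounded_oscillation D (g j)) \<longrightarrow>
    f \<in> borel_measurable lebesgue \<longrightarrow> 0 < t \<longrightarrow> 0 < L \<longrightarrow>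
    Lorentz_q1_norm (p i) (weight_measure (w i)) (\<lambda>x. ennreal \<bar>f x\<bar>) \<le> ennreal L \<longrightarrow>
    emeasure (weight_measure (\<lambda>x. w i x * (v x / (\<Prod>j\<in>?I - {i}. g j x)) powr p i))
      {x. ennreal (t * (v x / (\<Prod>j\<in>?I - {i}. g j x))) < HL_maximal f x} \<le> ennreal (B * (L / t) powr p i)"
    by (intro ballI mixed_maximal_bound_divided AR p D v assms(9)) auto
  then obtain B where B: "\<forall>i\<in>?I. 0 < B i \<and> (\<forall>g :: nat \<Rightarrow> real ^ 'n \<Rightarrow> real. \<forall>f t L.
    (\<forall>j\<in>?I - {i}. g j \<in> borel_measurable lebesgue \<and> (\<forall>x. 0 < g j x) \<and> bounded_oscillation D (g j)) \<longrightarrow>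
    f \<in> borel_measurable lebesgue \<longrightarrow> 0 < t \<longrightarrow> 0 < L \<longrightarrow>
    Lorentz_q1_norm (p i) (weight_measure (w i)) (\<lambda>x. ennreal \<bar>f x\<bar>) \<le> ennreal L \<longrightarrow>
    emeasure (weight_measure (\<lambda>x. w i x * (v x / (\<Prod>j\<in>?I - {i}. g j x)) powr p i))
      {x. ennreal (t * (v x / (\<Prod>j\<in>?I - {i}. g j x))) < HL_maximal f x} \<le> ennreal (B i * (L / t) powr p i))"
    unfolding bchoice_iff Bex_def by blast
  define K where "K = (2 powr p\<^sub>0) ^ (m - 1) * (\<Prod>i=1..m. B i powr (p\<^sub>0 / p i)) / (1 - 2 powr - p\<^sub>0)"
  have "2 powr - p\<^sub>0 < 1" using p0 by (simp add: powr_less_one)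
  moreover have "0 < (\<Prod>i=1..m. B i powr (p\<^sub>0 / p i))"
  proof (rule prod_pos)
    fix i assume "i \<in> ?I"
    then have "0 < B i" using B by blast
    then show "0 < B i powr (p\<^sub>0 / p i)" by simp
  qed
  ultimately have K: "0 < K" unfolding K_def by simp
  define C where "C = K powr (1 / p\<^sub>0)"
  have C: "0 < C" using K by (simp add: C_def)
  have main: "weak_norm (ennreal p\<^sub>0) ?N (\<lambda>x. HL_maximal_tensor m f x / ennreal (v x))
      \<le> ennreal C * (\<Prod>i=1..m. Lorentz_q1_norm (p i) (weight_measure (w i)) (\<lambda>x. ennreal \<bar>f i x\<bar>))"
    if f: "\<forall>i\<in>?I. f i \<in> borel_measurable lebesgue" for f :: "nat \<Rightarrow> real ^ 'n \<Rightarrow> real"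
  proof -
    let ?L = "\<lambda>i. Lorentz_q1_norm (p i) (weight_measure (w i)) (\<lambda>x. ennreal \<bar>f i x\<bar>)"
    \<comment> \<open>The product of the norms could be \<open>0 * \<infinity> = 0\<close>; a norm vanishes only for a null function, in which
      case the maximal function vanishes as well.\<close>
    consider (null) i where "i \<in> ?I" "AE x in lebesgue. f i x = 0"
      | (infinite) i where "i \<in> ?I" "?L i = \<infinity>" "\<And>j. j \<in> ?I \<Longrightarrow> ?L j \<noteq> 0"
      | (finite) "\<And>i. i \<in> ?I \<Longrightarrow> \<not> (AE x in lebesgue. f i x = 0)" "\<And>i. i \<in> ?I \<Longrightarrow> ?L i < \<infinity>"
          "\<And>i. i \<in> ?I \<Longrightarrow> ?L i \<noteq> 0"
      using Lorentz_q1_norm_eq_0D[OF wt p f[rule_format]] top.not_eq_extremum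
      by (metis infinity_ennreal_def)
    then show ?thesis
    proof cases
      case null
      have "HL_maximal_tensor m f x = 0" for x
        unfolding HL_maximal_tensor_def using null(1) HL_maximal_eq_0[OF null(2)] by (intro prod_zero bexI[of _ i]) auto
      then have "weak_norm (ennreal p\<^sub>0) ?N (\<lambda>x. HL_maximal_tensor m f x / ennreal (v x))
          \<le> ennreal (0 powr (1 / p\<^sub>0) * 0)"
        using p0 by (intro weak_norm_le) (auto simp: distribution_function_def)
      then show ?thesis by simp
    next
      case infinite
      have "(\<Prod>i\<in>?I. ?L i) = \<infinity>" by (rule prod_ennreal_eq_top[of ?I i]) (use infinite in auto)
      then show ?thesis using C by (simp add: ennreal_mult_top)
    next
      case finite
      define L where "L i = enn2real (?L i)" for i
      have L_eq: "?L i = ennreal (L i)" and Lp: "0 < L i" if "i \<in> ?I" for i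
        using finite(2,3)[OF that]
        by (auto simp: L_def enn2real_positive_iff zero_less_iff_neq_zero)
      define g where "g i = real_maximal (f i)" for i
      have fin: "AE x in lebesgue. HL_maximal (f i) x < \<infinity>" if "i \<in> ?I" for i
        using that f by (intro HL_maximal_finite_AE[OF AR p _ finite(2)]) auto
      have g: "g i \<in> borel_measurable lebesgue" "\<And>x. 0 < g i x" "bounded_oscillation D (g i)" if "i \<in> ?I" for i
        using bounded_oscillation_real_maximal[OF f[rule_format, OF that] finite(1)[OF that] fin[OF that]]
        by (auto simp: g_def real_maximal_pos D_def)
      have ge: "AE x in lebesgue. \<forall>i\<in>?I. HL_maximal (f i) x = ennreal (g i x)"
      proof (rule AE_finite_allI)
        fix i assume i: "i \<in> ?I"
        have pos: "HL_maximal (f i) x \<noteq> 0" for x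
        proof -
          have "x \<in> cbox x (\<chi> i. x $ i + 1)" by (simp add: mem_box_cart)
          then have "(INF y\<in>cbox x (\<chi> i. x $ i + 1). HL_maximal (f i) y) \<le> HL_maximal (f i) x"
            by (rule INF_lower)
          with HL_maximal_pos[OF f[rule_format, OF i] finite(1)[OF i] cubeI[of 1 x]] show ?thesis by auto
        qed
        show "AE x in lebesgue. HL_maximal (f i) x = ennreal (g i x)"
          using fin[OF i]
        proof eventually_elim
          case (elim x)
          then show ?case unfolding g_def using pos by (intro ennreal_real_maximal[symmetric]) auto
        qed
      qed simp
      have null_N: "AE x in ?N. \<forall>i\<in>?I. HL_maximal (f i) x = ennreal (g i x)"
        using ge um up unfolding weight_measure_def by (subst AE_density) auto
      have dist: "distribution_function ?N (\<lambda>x. HL_maximal_tensor m f x / ennreal (v x)) y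
          \<le> ennreal (K * ((\<Prod>i=1..m. L i) / y) powr p\<^sub>0)" if y: "0 < y" for y
      proof -
        have [measurable]: "(\<lambda>x. \<Prod>i=1..m. g i x) \<in> borel_measurable lebesgue"
          using g(1) by (intro borel_measurable_prod) auto
        have T: "{x. y * v x < (\<Prod>i=1..m. g i x)} \<in> sets ?N"
          unfolding sets_weight_measure by (rule sets_lebesgue_Collect) measurable
        have "distribution_function ?N (\<lambda>x. HL_maximal_tensor m f x / ennreal (v x)) y
            \<le> emeasure ?N {x. y * v x < (\<Prod>i=1..m. g i x)}"
          unfolding distribution_function_def
        proof (rule emeasure_mono_AE[OF _ T])
          show "AE x in ?N. x \<in> {x \<in> space ?N. ennreal y < HL_maximal_tensor m f x / ennreal (v x)}
              \<longrightarrow> x \<in> {x. y * v x < (\<Prod>i=1..m. g i x)}"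
            using null_N
          proof eventually_elim
            case (elim x)
            have "HL_maximal_tensor m f x = ennreal (\<Prod>i=1..m. g i x)"
              unfolding HL_maximal_tensor_def using elim g(2) by (subst prod_ennreal[symmetric]) (auto simp: less_imp_le)
            moreover have "0 \<le> (\<Prod>i=1..m. g i x)" using g(2) by (intro prod_nonneg) (auto simp: less_imp_le)
            ultimately show ?case
              using v(2)[of x] y by (auto simp: divide_ennreal ennreal_less_iff pos_less_divide_eq)
          qed
        qed
        also have "\<dots> \<le> ennreal (K * ((\<Prod>i=1..m. L i) / y) powr p\<^sub>0)"
          unfolding K_def \<nu>
        proof (rule tensor_distribution_bound[OF m p p0 assms(3) w g(1,2) v _ Lp y])
          show "0 < B i" if "i \<in> ?I" for i using B that by blast
          fix i and s :: real assume i: "i \<in> ?I" and s: "0 < s"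
          let ?V = "\<lambda>x. v x / (\<Prod>j\<in>?I - {i}. g j x)"
          have Vm: "?V \<in> borel_measurable lebesgue"
            using v(1) g(1) by (intro borel_measurable_divide borel_measurable_prod) auto
          have Vp: "0 < ?V x" for x using v(2) g(2) by (intro divide_pos_pos prod_pos) auto
          note [measurable] = Vm w(1)[OF i]
          have set: "{x. ennreal (s * ?V x) < HL_maximal (f i) x} \<in> sets (weight_measure (\<lambda>x. w i x
              * ?V x powr p i))"
            unfolding sets_weight_measure by (rule sets_lebesgue_Collect) measurable
          have AE: "AE x in weight_measure (\<lambda>x. w i x * ?V x powr p i). HL_maximal (f i) x = ennreal (g i x)"
            using ge i unfolding weight_measure_def by (subst AE_density) (measurable, auto elim: eventually_mono)
          have "emeasure (weight_measure (\<lambda>x. w i x * ?V x powr p i)) {x. s * ?V x < g i x}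
              \<le> emeasure (weight_measure (\<lambda>x. w i x * ?V x powr p i)) {x. ennreal (s * ?V x)
                  < HL_maximal (f i) x}"
          proof (rule emeasure_mono_AE[OF _ set])
            show "AE x in weight_measure (\<lambda>x. w i x * ?V x powr p i).
                x \<in> {x. s * ?V x < g i x} \<longrightarrow> x \<in> {x. ennreal (s * ?V x) < HL_maximal (f i) x}"
              using AE
            proof eventually_elim
              case (elim x)
              have "0 \<le> s * ?V x" by (intro mult_nonneg_nonneg less_imp_le[OF s] less_imp_le[OF Vp])
              then show ?case using elim by (simp add: ennreal_less_iff)
            qed
          qed
          also have "\<dots> \<le> ennreal (B i * (L i / s) powr p i)"
            using B[rule_format, OF i, THEN conjunct2, rule_format, of g "f i" s "L i"] g f i s Lp[OF i] L_eq[OF i]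
            by auto
          finally show "emeasure (weight_measure (\<lambda>x. w i x * ?V x powr p i)) {x. s * ?V x < g i x}
              \<le> ennreal (B i * (L i / s) powr p i)" .
        qed
        finally show ?thesis .
      qed
      have "weak_norm (ennreal p\<^sub>0) ?N (\<lambda>x. HL_maximal_tensor m f x / ennreal (v x))
          \<le> ennreal (C * (\<Prod>i=1..m. L i))"
        unfolding C_def using Lp K
        by (intro weak_norm_le p0 dist prod_nonneg) (auto simp: less_imp_le)
      also have "\<dots> = ennreal C * (\<Prod>i\<in>?I. ?L i)"
      proof -
        have "(\<Prod>i\<in>?I. ?L i) = (\<Prod>i\<in>?I. ennreal (L i))" using L_eq by (intro prod.cong) auto
        also have "\<dots> = ennreal (\<Prod>i\<in>?I. L i)" using Lp by (intro prod_ennreal) (auto simp: less_imp_le)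
        finally show ?thesis using C by (simp add: ennreal_mult')
      qed
      finally show ?thesis .
    qed
  qed
  have "weak_norm (ennreal p\<^sub>0) ?N (\<lambda>x. multi_maximal m f x / ennreal (v x))
      \<le> weak_norm (ennreal p\<^sub>0) ?N (\<lambda>x. HL_maximal_tensor m f x / ennreal (v x))"
    for f :: "nat \<Rightarrow> real ^ 'n \<Rightarrow> real"
  proof (rule weak_norm_mono)
    have "(\<lambda>x. HL_maximal_tensor m f x / ennreal (v x)) \<in> borel_measurable lebesgue"
      unfolding HL_maximal_tensor_def by measurable
    then show "(\<lambda>x. HL_maximal_tensor m f x / ennreal (v x)) \<in> borel_measurable ?N"
      by (simp add: weight_measure_def)
    show "multi_maximal m f x / ennreal (v x) \<le> HL_maximal_tensor m f x / ennreal (v x)" for x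
      by (intro divide_right_mono_ennreal multi_maximal_le_tensor)
  qed (use p0 in simp)
  with main C show ?thesis by blast
qed

end
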